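(* Suppose that $\{X_n;n\ge1\}$ is a sequence of independent and identically distributed random variables in a sub-linear expectation space $(\Omega,\mathscr H,\widehat{\mathbb E})$ with $\widehat{\mathbb E}[X_1]=\widehat{\mathbb E}[-X_1]=0$ and $\lim_{c\to\infty}\widehat{\mathbb E}[(X_1^2-c)^+]=0$. Write $S_n=\sum_{k=1}^nX_k$, $\overline\sigma^2=\widehat{\mathbb E}[X_1^2]$ and $\underline\sigma^2=\widehat{\mathcal E}[X_1^2]$. Then for any continuous function $\varphi$ satisfying $|\varphi(x)|\le C(1+x^2)$, $$\lim_{n\to\infty}\widehat{\mathbb E}\left[\varphi\left(\frac{S_n}{\sqrt n}\right)\right]=\widetilde{\mathbb E}[\varphi(\xi)],\qquad(\ast)$$ where $\xi\sim N(0,[\underline\sigma^2,\overline\sigma^2])$ under $\widetilde{\mathbb E}$. Further, if $p>2$ and $\widehat{\mathbb E}[|X_1|^p]<\infty$, then $(\ast)$ holds for any continuous function $\varphi$ satisfying $|\varphi(x)|\le C(1+|x|^p)$.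
   Context: Let $(\Omega,\mathcal F)$ be a given measurable space and $\mathscr H$ a linear space of real functions defined on $(\Omega,\mathcal F)$ such that $\varphi(X_1,\ldots,X_n)\in\mathscr H$ whenever $X_1,\ldots,X_n\in\mathscr H$ and $\varphi\in C_{l,Lip}(\mathbb R^n)$, where $C_{l,Lip}(\mathbb R^n)$ is the linear space of (local Lipschitz) functions $\varphi$ with $|\varphi(x)-\varphi(y)|\le C(1+|x|^m+|y|^m)|x-y|$ for all $x,y\in\mathbb R^n$, for some $C>0$, $m\in\mathbb N$ depending on $\varphi$. $\mathscr H$ is considered as a space of random variables. A sub-linear expectation on $\mathscr H$ is a map $\widehat{\mathbb E}:\mathscr H\to[-\infty,\infty]$ such that for all $X,Y\in\mathscr H$: $X\ge Y$ implies $\widehat{\mathbb E}[X]\ge\widehat{\mathbb E}[Y]$; $\widehat{\mathbb E}[c]=c$ for constants $c$; $\widehat{\mathbb E}[X+Y]\le\widehat{\mathbb E}[X]+\widehat{\mathbb E}[Y]$ whenever the right side is not of the form $+\infty-\infty$ or $-\infty+\infty$; $\widehat{\mathbb E}[\lambda X]=\lambda\widehat{\mathbb E}[X]$ for $\lambda\ge0$. The triple $(\Omega,\mathscr H,\widehat{\mathbb E})$ is called a sub-linear expectation space. The conjugate expectation is $\widehat{\mathcal E}[X]=-\widehat{\mathbb E}[-X]$, $X\in\mathscr H$. Independence: a random vector $\boldsymbol Y=(Y_1,\ldots,Y_n)$ (with $Y_i\in\mathscr H$) is independent to $\boldsymbol X=(X_1,\ldots,X_m)$ (with $X_i\in\mathscr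 H$) under $\widehat{\mathbb E}$ if for each $\varphi\in C_{l,Lip}(\mathbb R^m\times\mathbb R^n)$, $\widehat{\mathbb E}[\varphi(\boldsymbol X,\boldsymbol Y)]=\widehat{\mathbb E}\big[\widehat{\mathbb E}[\varphi(\boldsymbol x,\boldsymbol Y)]\big|_{\boldsymbol x=\boldsymbol X}\big]$ whenever $\overline\varphi(\boldsymbol x):=\widehat{\mathbb E}[|\varphi(\boldsymbol x,\boldsymbol Y)|]<\infty$ for all $\boldsymbol x$ and $\widehat{\mathbb E}[|\overline\varphi(\boldsymbol X)|]<\infty$. The sequence $\{X_n;n\ge1\}$ is independent and identically distributed if for each $i\ge1$: $X_{i+1}$ is independent to $(X_1,\ldots,X_i)$, and $X_i\overset{d}=X_1$, i.e. $\widehat{\mathbb E}[\varphi(X_i)]=\widehat{\mathbb E}[\varphi(X_1)]$ for all $\varphi\in C_{l,Lip}(\mathbb R)$ whenever the sub-linear expectations are finite. Normal distribution under a sub-linear expectation: a random variable $\xi$ in a sub-linear expectation space $(\widetilde\Omega,\widetilde{\mathscr H},\widetilde{\mathbb E})$ is called normal $N(0,[\underline\sigma^2,\overline\sigma^2])$ distributed (written $\xi\sim N(0,[\underline\sigma^2,\overline\sigma^2])$ under $\widetilde{\mathbb E}$) if for any bounded Lipschitz function $\varphi$, the function $u(t,x)=\widetilde{\mathbb E}[\varphi(x+\sqrt t\,\xi)]$ ($x\in\mathbb R$, $t\ge0$) is the unique viscosity solution of the heat equation $\partial_tu-G(\partial_{xx}^2u)=0$, $u(0,x)=\varphi(x)$,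 where $G(\alpha)=\frac12(\overline\sigma^2\alpha^+-\underline\sigma^2\alpha^-)$.
   Formalization: All moments of ξ under the limiting expectation are assumed finite, since the stated definition of the normal law tests only bounded Lipschitz functions and (∗) can otherwise fail; identical distribution means that if either expectation is finite, both agree. *)

theory Defs
  imports "HOL-Analysis.Analysis"
begin

section \<open>Local Lipschitz functions\<close>

text \<open>
  The dimension varies in the definitions below, so a point of \<open>R^n\<close> is a sequence of type
  \<open>nat \<Rightarrow> real\<close> of which only the coordinates \<open>0, ..., n - 1\<close> matter, and
  \<open>L2_set x {..<n}\<close> is its Euclidean norm.  The inequality is required for all sequences; it
  forces \<open>\<phi>\<close> to depend on the first \<open>n\<close> coordinates only, so that \<open>C_lLip n\<close> corresponds
  exactly to the functions on \<open>R^n\<close>.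
\<close>

definition C_lLip :: "nat \<Rightarrow> ((nat \<Rightarrow> real) \<Rightarrow> real) set" where
  "C_lLip n = {\<phi>. \<exists>C>0. \<exists>m::nat. \<forall>x y.
     \<bar>\<phi> x - \<phi> y\<bar> \<le>
       C * (1 + L2_set x {..<n} ^ m + L2_set y {..<n} ^ m) * L2_set (\<lambda>i. x i - y i) {..<n}}"

text \<open>The identification of \<open>R^m \<times> R^n\<close> with \<open>R^(m+n)\<close>.\<close>

definition vec_append :: "nat \<Rightarrow> (nat \<Rightarrow> real) \<Rightarrow> (nat \<Rightarrow> real) \<Rightarrow> nat \<Rightarrow> real" where
  "vec_append m x y = (\<lambda>i. if i < m then x i else y (i - m))"


section \<open>Sub-linear expectation spaces\<close>

text \<open>
  \<open>M\<close> carries only the measurable space \<open>(\<Omega>, \<F>)\<close>; its measure plays no role.  The functional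
  \<open>E\<close> is total, but only its values on \<open>H\<close> are constrained.  Products in \<^typ>\<open>ereal\<close> satisfy
  \<open>0 * \<infinity> = 0\<close>, which agrees with \<open>E 0 = 0\<close> in positive homogeneity.
\<close>

locale sublinear_expectation_space =
  fixes M :: "'a measure" and H :: "('a \<Rightarrow> real) set" and E :: "('a \<Rightarrow> real) \<Rightarrow> ereal"
  assumes H_measurable: "H \<subseteq> borel_measurable M"
    and H_zero: "(\<lambda>_. 0) \<in> H"
    and H_add: "\<And>X Y. X \<in> H \<Longrightarrow> Y \<in> H \<Longrightarrow> (\<lambda>\<omega>. X \<omega> + Y \<omega>) \<in> H"
    and H_scale: "\<And>a X. X \<in> H \<Longrightarrow> (\<lambda>\<omega>. a * X \<omega>) \<in> H"
    and H_C_lLip: "\<And>n \<phi> X. \<phi> \<in> C_lLip n \<Longrightarrow> (\<And>i. i < n \<Longrightarrow> X i \<in> H) \<Longrightarrow>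
                     (\<lambda>\<omega>. \<phi> (\<lambda>i. X i \<omega>)) \<in> H"
    and E_mono: "\<And>X Y. X \<in> H \<Longrightarrow> Y \<in> H \<Longrightarrow> (\<And>\<omega>. \<omega> \<in> space M \<Longrightarrow> Y \<omega> \<le> X \<omega>) \<Longrightarrow> E Y \<le> E X"
    and E_const: "\<And>c. E (\<lambda>_. c) = ereal c"
    and E_subadd: "\<And>X Y. X \<in> H \<Longrightarrow> Y \<in> H \<Longrightarrow>
                     \<not> (E X = \<infinity> \<and> E Y = -\<infinity>) \<Longrightarrow> \<not> (E X = -\<infinity> \<and> E Y = \<infinity>) \<Longrightarrow>
                     E (\<lambda>\<omega>. X \<omega> + Y \<omega>) \<le> E X + E Y"
    and E_pos_homogeneous: "\<And>r X. X \<in> H \<Longrightarrow> 0 \<le> r \<Longrightarrow> E (\<lambda>\<omega>. r * X \<omega>) = ereal r * E X"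

definition conj_expectation :: "(('a \<Rightarrow> real) \<Rightarrow> ereal) \<Rightarrow> ('a \<Rightarrow> real) \<Rightarrow> ereal" where
  "conj_expectation E X = - E (\<lambda>\<omega>. - X \<omega>)"

text \<open>
  A continuous function of a random variable need not belong to \<open>H\<close>.  The usual extension of
  \<open>E\<close> to all functions gives a meaning to the expectation of such a function; it agrees with
  \<open>E\<close> on \<open>H\<close> (lemma \<open>ext_expectation_eq\<close>).
\<close>

definition ext_expectation ::
  "'a measure \<Rightarrow> ('a \<Rightarrow> real) set \<Rightarrow> (('a \<Rightarrow> real) \<Rightarrow> ereal) \<Rightarrow> ('a \<Rightarrow> real) \<Rightarrow> ereal" where
  "ext_expectation M H E Z = (INF Y\<in>{Y\<in>H. \<forall>\<omega>\<in>space M. Z \<omega> \<le> Y \<omega>}. E Y)"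

lemma (in sublinear_expectation_space) ext_expectation_eq:
  assumes "X \<in> H"
  shows "ext_expectation M H E X = E X"
  unfolding ext_expectation_def
proof (rule antisym)
  show "(INF Y\<in>{Y \<in> H. \<forall>\<omega>\<in>space M. X \<omega> \<le> Y \<omega>}. E Y) \<le> E X"
    using assms by (intro INF_lower) auto
  show "E X \<le> (INF Y\<in>{Y \<in> H. \<forall>\<omega>\<in>space M. X \<omega> \<le> Y \<omega>}. E Y)"
    using assms by (intro INF_greatest) (auto intro: E_mono)
qed


section \<open>Independence and identical distribution\<close>

text \<open>
  \<open>(Y 0, ..., Y (n - 1))\<close> is independent to \<open>(X 0, ..., X (m - 1))\<close>.  The identity is
  required for those \<open>\<phi>\<close> for which both sides and the integrability condition are defined, that
  is, for which \<open>\<phi>bar \<circ> X\<close> and \<open>g \<circ> X\<close> are in \<open>H\<close>.  The conversions to \<^typ>\<open>real\<close> are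
  harmless: \<open>E |\<phi>(x, Y)| < \<infinity>\<close> makes both \<open>\<phi>bar x\<close> and \<open>E \<phi>(x, Y)\<close> finite.
\<close>

definition indep_vector ::
  "('a \<Rightarrow> real) set \<Rightarrow> (('a \<Rightarrow> real) \<Rightarrow> ereal) \<Rightarrow>
   nat \<Rightarrow> (nat \<Rightarrow> 'a \<Rightarrow> real) \<Rightarrow> nat \<Rightarrow> (nat \<Rightarrow> 'a \<Rightarrow> real) \<Rightarrow> bool" where
  "indep_vector H E n Y m X \<longleftrightarrow>
     (\<forall>i<n. Y i \<in> H) \<and> (\<forall>i<m. X i \<in> H) \<and>
     (\<forall>\<phi>\<in>C_lLip (m + n).
        let \<phi>bar = (\<lambda>x. E (\<lambda>\<omega>. \<bar>\<phi> (vec_append m x (\<lambda>j. Y j \<omega>))\<bar>));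
            g = (\<lambda>x. real_of_ereal (E (\<lambda>\<omega>. \<phi> (vec_append m x (\<lambda>j. Y j \<omega>)))))
        in (\<forall>x. \<phi>bar x < \<infinity>) \<longrightarrow>
           (\<lambda>\<omega>. real_of_ereal (\<phi>bar (\<lambda>i. X i \<omega>))) \<in> H \<longrightarrow>
           (\<lambda>\<omega>. g (\<lambda>i. X i \<omega>)) \<in> H \<longrightarrow>
           E (\<lambda>\<omega>. \<bar>real_of_ereal (\<phi>bar (\<lambda>i. X i \<omega>))\<bar>) < \<infinity> \<longrightarrow>
           E (\<lambda>\<omega>. \<phi> (vec_append m (\<lambda>i. X i \<omega>) (\<lambda>j. Y j \<omega>))) = E (\<lambda>\<omega>. g (\<lambda>i. X i \<omega>)))"

text \<open>
  ``Whenever the sub-linear expectations are finite'' means that as soon as one of the two is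
  finite, so is the other, and they agree.  Requiring equality only when both are known to be
  finite would allow one variable to have finite and the other infinite variance.
\<close>

definition identically_distributed ::
  "(('a \<Rightarrow> real) \<Rightarrow> ereal) \<Rightarrow> ('a \<Rightarrow> real) \<Rightarrow> ('a \<Rightarrow> real) \<Rightarrow> bool" where
  "identically_distributed E X Y \<longleftrightarrow>
     (\<forall>\<phi>\<in>C_lLip 1. \<bar>E (\<lambda>\<omega>. \<phi> (\<lambda>_. X \<omega>))\<bar> \<noteq> \<infinity> \<or> \<bar>E (\<lambda>\<omega>. \<phi> (\<lambda>_. Y \<omega>))\<bar> \<noteq> \<infinity> \<longrightarrow>
        E (\<lambda>\<omega>. \<phi> (\<lambda>_. X \<omega>)) = E (\<lambda>\<omega>. \<phi> (\<lambda>_. Y \<omega>)))"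

text \<open>The sequence is \<open>X 1, X 2, ...\<close>; the value \<open>X 0\<close> is irrelevant.\<close>

definition iid_sequence ::
  "('a \<Rightarrow> real) set \<Rightarrow> (('a \<Rightarrow> real) \<Rightarrow> ereal) \<Rightarrow> (nat \<Rightarrow> 'a \<Rightarrow> real) \<Rightarrow> bool" where
  "iid_sequence H E X \<longleftrightarrow>
     (\<forall>i\<ge>1. X i \<in> H) \<and>
     (\<forall>i\<ge>1. indep_vector H E 1 (\<lambda>_. X (i + 1)) i (\<lambda>j. X (j + 1))) \<and>
     (\<forall>i\<ge>1. identically_distributed E (X i) (X 1))"


section \<open>Viscosity solutions of the heat equation\<close>

definition G_fun :: "real \<Rightarrow> real \<Rightarrow> real \<Rightarrow> real" where
  "G_fun vlow vup \<alpha> = (vup * max \<alpha> 0 - vlow * max (- \<alpha>) 0) / 2"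

text \<open>\<open>\<psi>\<close> is of class \<open>C^{1,2}\<close> on \<open>(0, \<infinity>) \<times> R\<close> with partial derivatives
  \<open>\<psi>t\<close>, \<open>\<psi>x\<close>, \<open>\<psi>xx\<close>.\<close>

definition C12_test ::
  "(real \<Rightarrow> real \<Rightarrow> real) \<Rightarrow> (real \<Rightarrow> real \<Rightarrow> real) \<Rightarrow> (real \<Rightarrow> real \<Rightarrow> real) \<Rightarrow>
   (real \<Rightarrow> real \<Rightarrow> real) \<Rightarrow> bool" where
  "C12_test \<psi> \<psi>t \<psi>x \<psi>xx \<longleftrightarrow>
     (\<forall>t>0. \<forall>x. ((\<lambda>s. \<psi> s x) has_real_derivative \<psi>t t x) (at t) \<and>
                ((\<lambda>y. \<psi> t y) has_real_derivative \<psi>x t x) (at x) \<and>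
                ((\<lambda>y. \<psi>x t y) has_real_derivative \<psi>xx t x) (at x)) \<and>
     (\<forall>f\<in>{\<psi>, \<psi>t, \<psi>x, \<psi>xx}. continuous_on ({0<..} \<times> UNIV) (\<lambda>(t, x). f t x))"

definition viscosity_subsolution :: "(real \<Rightarrow> real) \<Rightarrow> (real \<Rightarrow> real \<Rightarrow> real) \<Rightarrow> bool" where
  "viscosity_subsolution G u \<longleftrightarrow>
     (\<forall>\<psi> \<psi>t \<psi>x \<psi>xx t x. C12_test \<psi> \<psi>t \<psi>x \<psi>xx \<longrightarrow> 0 < t \<longrightarrow>
        (\<forall>\<^sub>F (s, y) in nhds (t, x). u s y - \<psi> s y \<le> u t x - \<psi> t x) \<longrightarrow>
        \<psi>t t x - G (\<psi>xx t x) \<le> 0)"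

definition viscosity_supersolution :: "(real \<Rightarrow> real) \<Rightarrow> (real \<Rightarrow> real \<Rightarrow> real) \<Rightarrow> bool" where
  "viscosity_supersolution G u \<longleftrightarrow>
     (\<forall>\<psi> \<psi>t \<psi>x \<psi>xx t x. C12_test \<psi> \<psi>t \<psi>x \<psi>xx \<longrightarrow> 0 < t \<longrightarrow>
        (\<forall>\<^sub>F (s, y) in nhds (t, x). u t x - \<psi> t x \<le> u s y - \<psi> s y) \<longrightarrow>
        0 \<le> \<psi>t t x - G (\<psi>xx t x))"

definition viscosity_solution ::
  "(real \<Rightarrow> real) \<Rightarrow> (real \<Rightarrow> real) \<Rightarrow> (real \<Rightarrow> real \<Rightarrow> real) \<Rightarrow> bool" where
  "viscosity_solution G \<phi> u \<longleftrightarrow>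
     continuous_on ({0..} \<times> UNIV) (\<lambda>(t, x). u t x) \<and> (\<forall>x. u 0 x = \<phi> x) \<and>
     viscosity_subsolution G u \<and> viscosity_supersolution G u"

text \<open>
  Uniqueness is understood among functions of polynomial growth in \<open>x\<close>, locally uniformly in
  time; without a growth condition it fails already for the classical heat equation.
\<close>

definition polynomial_growth :: "(real \<Rightarrow> real \<Rightarrow> real) \<Rightarrow> bool" where
  "polynomial_growth u \<longleftrightarrow>
     (\<forall>T>0. \<exists>C. \<exists>k::nat. \<forall>t\<in>{0..T}. \<forall>x. \<bar>u t x\<bar> \<le> C * (1 + \<bar>x\<bar> ^ k))"

definition unique_viscosity_solution ::
  "(real \<Rightarrow> real) \<Rightarrow> (real \<Rightarrow> real) \<Rightarrow> (real \<Rightarrow> real \<Rightarrow> real) \<Rightarrow> bool" where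
  "unique_viscosity_solution G \<phi> u \<longleftrightarrow>
     viscosity_solution G \<phi> u \<and> polynomial_growth u \<and>
     (\<forall>v. viscosity_solution G \<phi> v \<and> polynomial_growth v \<longrightarrow> (\<forall>t\<ge>0. \<forall>x. v t x = u t x))"


section \<open>The normal distribution\<close>

text \<open>
  The parameters are the variances \<open>vlow = \<sigma>low^2\<close> and \<open>vup = \<sigma>up^2\<close>.  For bounded \<open>\<phi>\<close> the
  expectation below is finite.  Only bounded test functions occur, so the definition by itself
  gives no control over \<open>E |\<xi>|^k\<close>: an expectation of the form
  \<open>E \<phi> = E0 \<phi> + limsup (\<lambda>x. \<phi> x / x^2)\<close> as \<open>|x|\<close> tends to infinity satisfies it together with
  \<open>E0\<close>.  Finiteness of the moments of \<open>\<xi>\<close> has to be assumed separately.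
\<close>

definition G_normal ::
  "('b \<Rightarrow> real) set \<Rightarrow> (('b \<Rightarrow> real) \<Rightarrow> ereal) \<Rightarrow> ('b \<Rightarrow> real) \<Rightarrow> real \<Rightarrow> real \<Rightarrow> bool" where
  "G_normal H E \<xi> vlow vup \<longleftrightarrow>
     \<xi> \<in> H \<and>
     (\<forall>\<phi> :: real \<Rightarrow> real. bounded (range \<phi>) \<and> (\<exists>L. L-lipschitz_on UNIV \<phi>) \<longrightarrow>
        unique_viscosity_solution (G_fun vlow vup) \<phi>
          (\<lambda>t x. real_of_ereal (E (\<lambda>\<omega>. \<phi> (x + sqrt t * \<xi> \<omega>)))))"

end

theory Submission
  imports Defs "HOL-Complex_Analysis.Great_Picard" "HOL-Real_Asymp.Real_Asymp"
begin

text \<open>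
  Let \<open>T\<^sub>n f y = E f(y + X\<^sub>1 / \<surd>n)\<close>.  Independence gives \<open>E f(S\<^sub>k / \<surd>n) = (T\<^sub>n\<^sup>k f)(0)\<close>, so the theorem is about
  the monotone scheme \<open>u\<^sub>n(k/n, x) = (T\<^sub>n\<^sup>k \<phi>)(x)\<close>.  For bounded Lipschitz \<open>\<phi>\<close> these functions are
  equicontinuous (Lipschitz in \<open>x\<close>, Hoelder of order 1/2 in \<open>t\<close>); hence every subsequence has a
  further subsequence that converges locally uniformly, and by consistency of the scheme its limit
  is a viscosity solution of the \<open>G\<close>-heat equation.  Since uniqueness is part of the definition of
  the \<open>G\<close>-normal distribution, all these limits agree with \<open>E' \<phi>(x + \<surd>t \<xi>)\<close>, and no regularity
  theory is needed.  Growth of order \<open>p\<close> is then reached by uniform integrability of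
  \<open>\<bar>S\<^sub>n / \<surd>n\<bar>\<^sup>p\<close>, for which the distance to \<open>[-R, R]\<close> raised to the power \<open>p\<close> serves as a Lyapunov
  function of \<open>T\<^sub>n\<close>.
\<close>

section \<open>Power inequalities\<close>

text \<open>Subadditivity yields upper bounds only, so a single step is always estimated by
  \<open>constant + slope * h + remainder\<close>. Since the expectations of \<open>X 1\<close> and
  \<open>- X 1\<close> both vanish, the linear term disappears whatever the sign of its slope, and
  only the remainder costs; this is why the expansions leave the slope existentially quantified. The
  main obstacle is that the step operator is nonlocal, while a viscosity test function controls the
  scheme only near the touching point. The gap is filled by a multiple of
  \<open>max (h\<^sup>2 - d) 0\<close>; after scaling the increment by \<open>1 / sqrt n\<close> it
  becomes \<open>max (h\<^sup>2 - n * d) 0 / n\<close>, whose expectation is o(1/n) by the tail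
  hypothesis. The same mechanism at order p leads to the condition that n times the expectation of
  \<open>max (\<bar>X 1 / sqrt n\<bar> powr p - 1 / 2) 0\<close> tends to 0. It follows from the
  tail hypothesis if p = 2 and from the moment of order p if p > 2, so both claims have one
  proof.\<close>

lemma powr_mean_value:
  fixes a b p :: real
  assumes "0 < a" "a < b"
  obtains z where "a < z" "z < b" "b powr p - a powr p = p * z powr (p - 1) * (b - a)"
proof -
  have "\<exists>z. a < z \<and> z < b \<and> b powr p - a powr p = (b - a) * (p * z powr (p - 1))"
    using assms by (intro MVT2) (auto intro!: has_real_derivative_powr)
  then show thesis using that by (auto simp: mult_ac)
qed

text \<open>Convexity of the power, with the tangent taken at \<open>x\<close> and evaluated at
  \<open>a\<close>.\<close>

lemma powr_tangent_le:
  fixes a x p :: real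
  assumes "0 < a" "0 < x" "1 \<le> p"
  shows "x powr p - a powr p \<le> p * x powr (p - 1) * (x - a)"
proof -
  consider "x = a" | "a < x" | "x < a" by linarith
  then show ?thesis
  proof cases
    case 2
    then obtain z where z: "a < z" "z < x" "x powr p - a powr p = p * z powr (p - 1) * (x - a)"
      using powr_mean_value assms by blast
    have "z powr (p - 1) \<le> x powr (p - 1)" using z assms by (intro powr_mono2) auto
    then show ?thesis unfolding z(3) using 2 assms
      by (intro mult_right_mono mult_left_mono) auto
  next
    case 3
    then obtain z where z: "x < z" "z < a" "a powr p - x powr p = p * z powr (p - 1) * (a - x)"
      using powr_mean_value assms by blast
    have "x powr (p - 1) \<le> z powr (p - 1)" using z assms by (intro powr_mono2) auto
    then have "p * x powr (p - 1) * (a - x) \<le> p * z powr (p - 1) * (a - x)"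
      using 3 assms by (intro mult_right_mono mult_left_mono) auto
    then show ?thesis using z(3) by (simp add: algebra_simps)
  qed auto
qed

lemma abs_powr_diff_le:
  fixes a b p :: real
  assumes "0 \<le> a" "0 \<le> b" "1 \<le> p"
  shows "\<bar>a powr p - b powr p\<bar> \<le> p * max a b powr (p - 1) * \<bar>a - b\<bar>"
proof -
  have main: "b powr p - a powr p \<le> p * b powr (p - 1) * (b - a)" "a powr p \<le> b powr p"
    if "0 \<le> a" "a \<le> b" for a b :: real
  proof -
    show "b powr p - a powr p \<le> p * b powr (p - 1) * (b - a)"
    \<comment> \<open>Powers are differentiated at positive points only, so the left endpoint 0 is
      treated by hand.\<close>
    proof (cases "a = 0")
      case True
      have "b powr p = b powr (p - 1) * b" using that by (simp add: powr_diff)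
      also have "\<dots> \<le> p * (b powr (p - 1) * b)" using assms that
        by (metis mult_right_mono mult_1 mult_nonneg_nonneg order_trans powr_ge_zero)
      finally show ?thesis using True by simp
    next
      case False
      then show ?thesis using that assms by (intro powr_tangent_le) auto
    qed
    show "a powr p \<le> b powr p" using that assms by (intro powr_mono2) auto
  qed
  show ?thesis
    using main[of a b] main[of b a] assms by (cases "a \<le> b") (auto simp: max_def)
qed

lemma powr_add_le:
  fixes a b q :: real
  assumes "0 \<le> a" "0 \<le> b" "0 \<le> q"
  shows "(a + b) powr q \<le> 2 powr q * (a powr q + b powr q)"
proof -
  have "(a + b) powr q \<le> (2 * max a b) powr q" using assms by (intro powr_mono2) auto
  also have "\<dots> = 2 powr q * max a b powr q" by (simp add: powr_mult)
  also have "\<dots> \<le> 2 powr q * (a powr q + b powr q)"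
    by (intro mult_left_mono) (auto simp: max_def)
  finally show ?thesis .
qed

lemma powr_le_one_add:
  fixes x q r :: real
  assumes "0 \<le> x" "0 \<le> q" "q \<le> r"
  shows "x powr q \<le> 1 + x powr r"
proof (cases "x \<le> 1")
  case True
  then have "x powr q \<le> 1" using assms by (intro powr_le1) auto
  then show ?thesis by (smt (verit) powr_ge_zero)
next
  case False
  then have "x powr q \<le> x powr r" using assms by (intro powr_mono) auto
  then show ?thesis by simp
qed

text \<open>The slope may depend on \<open>a\<close> but not on \<open>h\<close>, and
  \<open>C\<close> depends on \<open>p\<close> alone. While \<open>a + h\<close> keeps the sign of
  \<open>a\<close>, convexity bounds the Taylor remainder by a difference of first derivatives,
  which is controlled because \<open>p - 1 \<ge> 1\<close>. When the sign changes,
  \<open>\<bar>h\<bar> \<ge> \<bar>a\<bar>\<close> and every term is of order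
  \<open>\<bar>h\<bar> powr p\<close>.\<close>

lemma powr_second_order:
  fixes p :: real
  assumes "2 \<le> p"
  obtains C where "0 \<le> C"
    "\<And>a. \<exists>b. \<forall>h. \<bar>a + h\<bar> powr p \<le> \<bar>a\<bar> powr p + b * h + C * (\<bar>a\<bar> powr (p - 2) * h\<^sup>2 + \<bar>h\<bar> powr p)"
proof -
  \<comment> \<open>The first summand serves the case of equal signs, \<open>p + 1\<close> the
    change of sign; at \<open>a = 0\<close> only \<open>1 \<le> C\<close> matters.\<close>
  define C where "C = p * (p - 1) * 2 powr (p - 2) + p + 1"
  have C: "p * (p - 1) * 2 powr (p - 2) \<le> C" "p \<le> C" "1 \<le> C" "0 \<le> C"
    using assms by (auto simp: C_def intro!: add_nonneg_nonneg mult_nonneg_nonneg)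
  have h2: "\<bar>h\<bar> powr (p - 2) * h\<^sup>2 = \<bar>h\<bar> powr p" for h :: real
  proof (cases "h = 0")
    case False
    then show ?thesis by (simp add: powr_diff powr_numeral)
  qed auto
  have pos: "\<bar>a + h\<bar> powr p \<le> \<bar>a\<bar> powr p + p * a powr (p - 1) * h
      + C * (\<bar>a\<bar> powr (p - 2) * h\<^sup>2 + \<bar>h\<bar> powr p)" if "0 < a" for a h :: real
  proof (cases "0 < a + h")
    case True
    define x where "x = a + h"
    have x: "0 < x" using True by (simp add: x_def)
    have "x powr p - a powr p - p * a powr (p - 1) * (x - a)
        \<le> p * x powr (p - 1) * (x - a) - p * a powr (p - 1) * (x - a)"
      using powr_tangent_le[of a x p] that x assms by simp
    also have "\<dots> = p * ((x powr (p - 1) - a powr (p - 1)) * (x - a))" by (simp add: algebra_simps)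
    also have "\<dots> \<le> p * (\<bar>x powr (p - 1) - a powr (p - 1)\<bar> * \<bar>x - a\<bar>)"
      using assms by (intro mult_left_mono) (auto simp flip: abs_mult)
    also have "\<dots> \<le> p * (((p - 1) * max x a powr (p - 1 - 1) * \<bar>x - a\<bar>) * \<bar>x - a\<bar>)"
      using abs_powr_diff_le[of x a "p - 1"] that x assms
      by (intro mult_left_mono mult_right_mono) auto
    also have "\<dots> = p * (p - 1) * (max x a powr (p - 2) * h\<^sup>2)"
      by (simp add: x_def power2_eq_square abs_mult_self_eq mult_ac)
    also have "\<dots> \<le> p * (p - 1) * ((a + \<bar>h\<bar>) powr (p - 2) * h\<^sup>2)"
      using assms x that by (intro mult_left_mono mult_right_mono powr_mono2) (auto simp: x_def)
    also have "\<dots> \<le> p * (p - 1) * ((2 powr (p - 2) * (a powr (p - 2) + \<bar>h\<bar> powr (p - 2))) * h\<^sup>2)"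
      using assms that by (intro mult_left_mono mult_right_mono powr_add_le) auto
    also have "\<dots> = (p * (p - 1) * 2 powr (p - 2)) * (\<bar>a\<bar> powr (p - 2) * h\<^sup>2 + \<bar>h\<bar> powr p)"
      using that by (simp flip: h2 add: algebra_simps)
    also have "\<dots> \<le> C * (\<bar>a\<bar> powr (p - 2) * h\<^sup>2 + \<bar>h\<bar> powr p)"
      using C by (intro mult_right_mono) auto
    finally show ?thesis using that x by (simp add: x_def)
  next
    case False
    have h: "h < 0" "a \<le> \<bar>h\<bar>" "\<bar>a + h\<bar> \<le> \<bar>h\<bar>" using False that by auto
    have "\<bar>a + h\<bar> powr p \<le> \<bar>h\<bar> powr p" using h assms by (intro powr_mono2) auto
    moreover have "- (p * a powr (p - 1) * h) \<le> p * \<bar>h\<bar> powr p"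
    proof -
      have "- (p * a powr (p - 1) * h) = p * (a powr (p - 1) * \<bar>h\<bar>)" using h by simp
      also have "\<dots> \<le> p * (\<bar>h\<bar> powr (p - 1) * \<bar>h\<bar>)"
        using h that assms by (intro mult_left_mono mult_right_mono powr_mono2) auto
      also have "\<dots> = p * \<bar>h\<bar> powr p" using h by (simp add: powr_diff)
      finally show ?thesis .
    qed
    moreover have "(p + 1) * \<bar>h\<bar> powr p \<le> C * (\<bar>a\<bar> powr (p - 2) * h\<^sup>2 + \<bar>h\<bar> powr p)"
      using C assms by (intro mult_mono) (auto simp: C_def)
    moreover have "(p + 1) * \<bar>h\<bar> powr p = p * \<bar>h\<bar> powr p + \<bar>h\<bar> powr p" by (simp add: distrib_right)
    moreover have "0 \<le> \<bar>a\<bar> powr p" by simp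
    ultimately show ?thesis by linarith
  qed
  have "\<exists>b. \<forall>h. \<bar>a + h\<bar> powr p \<le> \<bar>a\<bar> powr p + b * h
      + C * (\<bar>a\<bar> powr (p - 2) * h\<^sup>2 + \<bar>h\<bar> powr p)" for a :: real
  proof -
    consider "0 < a" | "a < 0" | "a = 0" by linarith
    then show ?thesis
    proof cases
      case 1
      then show ?thesis using pos by blast
    next
      case 2
      have "\<bar>a + h\<bar> powr p \<le> \<bar>a\<bar> powr p + (- (p * (-a) powr (p - 1))) * h
          + C * (\<bar>a\<bar> powr (p - 2) * h\<^sup>2 + \<bar>h\<bar> powr p)" for h
      proof -
        have "\<bar>- a + - h\<bar> = \<bar>a + h\<bar>" by linarith
        then show ?thesis using pos[of "-a" "-h"] 2 by simp
      qed
      then show ?thesis by blast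
    next
      case 3
      have "\<bar>h\<bar> powr p \<le> C * \<bar>h\<bar> powr p" for h :: real
        using C by (metis mult_1 mult_right_mono powr_ge_zero)
      then show ?thesis using 3 by (intro exI[of _ 0]) auto
    qed
  qed
  then show thesis using that C by blast
qed

text \<open>The term linear in \<open>h\<close> disappears under a centered expectation.  Near the origin, where the
  distance to \<open>[-R, R]\<close> vanishes, an increment contributes only if it is large itself; elsewhere
  \<open>1 \<le> 4 \<bar>y\<bar>\<^sup>2 / R\<^sup>2\<close>.\<close>

lemma dist_interval_powr_step:
  fixes p :: real
  assumes "2 \<le> p"
  obtains C where "0 \<le> C"
    "\<And>R y. 2 \<le> R \<Longrightarrow> \<exists>b. \<forall>h. max (\<bar>y + h\<bar> - R) 0 powr p \<le> max (\<bar>y\<bar> - R) 0 powr p + b * h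
       + C * (1 + \<bar>y\<bar> powr p) * (4 / R\<^sup>2 * (h\<^sup>2 + \<bar>h\<bar> powr p) + 2 * max (\<bar>h\<bar> powr p - 1 / 2) 0)"
    "\<And>y. \<exists>b. \<forall>h. \<bar>y + h\<bar> powr p \<le> \<bar>y\<bar> powr p + b * h
       + C * (1 + \<bar>y\<bar> powr p) * (h\<^sup>2 + \<bar>h\<bar> powr p)"
proof -
  obtain C where C: "0 \<le> C" and step:
    "\<And>a. \<exists>b. \<forall>h. \<bar>a + h\<bar> powr p \<le> \<bar>a\<bar> powr p + b * h + C * (\<bar>a\<bar> powr (p - 2) * h\<^sup>2 + \<bar>h\<bar> powr p)"
    using powr_second_order[OF assms] by blast
  have two: "\<exists>b. \<forall>h. \<bar>y + h\<bar> powr p \<le> \<bar>y\<bar> powr p + b * h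
       + C * (1 + \<bar>y\<bar> powr p) * (h\<^sup>2 + \<bar>h\<bar> powr p)" for y
  proof -
    obtain b where b: "\<And>h. \<bar>y + h\<bar> powr p \<le> \<bar>y\<bar> powr p + b * h
        + C * (\<bar>y\<bar> powr (p - 2) * h\<^sup>2 + \<bar>h\<bar> powr p)"
      using step by blast
    have "C * (\<bar>y\<bar> powr (p - 2) * h\<^sup>2 + \<bar>h\<bar> powr p) \<le> C * ((1 + \<bar>y\<bar> powr p) * (h\<^sup>2 + \<bar>h\<bar> powr p))" for h
    proof (intro mult_left_mono C)
      have "\<bar>y\<bar> powr (p - 2) * h\<^sup>2 \<le> (1 + \<bar>y\<bar> powr p) * h\<^sup>2"
        using assms by (intro mult_right_mono powr_le_one_add) auto
      moreover have "\<bar>h\<bar> powr p \<le> (1 + \<bar>y\<bar> powr p) * \<bar>h\<bar> powr p"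
        by (simp add: mult_le_cancel_right1)
      ultimately show "\<bar>y\<bar> powr (p - 2) * h\<^sup>2 + \<bar>h\<bar> powr p \<le> (1 + \<bar>y\<bar> powr p) * (h\<^sup>2 + \<bar>h\<bar> powr p)"
        unfolding distrib_left by (rule add_mono)
    qed
    then show ?thesis using b by (intro exI[of _ b] allI) (smt (verit) mult.assoc)
  qed
  have one: "\<exists>b. \<forall>h. max (\<bar>y + h\<bar> - R) 0 powr p \<le> max (\<bar>y\<bar> - R) 0 powr p + b * h
       + C * (1 + \<bar>y\<bar> powr p) * (4 / R\<^sup>2 * (h\<^sup>2 + \<bar>h\<bar> powr p) + 2 * max (\<bar>h\<bar> powr p - 1 / 2) 0)"
    if R: "2 \<le> R" for R y :: real
  proof -
    \<comment> \<open>\<open>c\<close> is the point of \<open>[-R, R]\<close> nearest to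
      \<open>y\<close>, so \<open>\<bar>a\<bar>\<close> is the distance from \<open>y\<close> to the
      interval. As \<open>c\<close> is still a point of the interval when \<open>y\<close> moves to
      \<open>y + h\<close>, the new distance is at most \<open>\<bar>a + h\<bar>\<close>.\<close>
    define c where "c = max (- R) (min R y)"
    define a where "a = y - c"
    have a: "\<bar>a\<bar> = max (\<bar>y\<bar> - R) 0" using R by (auto simp: a_def c_def abs_if max_def min_def)
    obtain b where b: "\<And>h. \<bar>a + h\<bar> powr p \<le> \<bar>a\<bar> powr p + b * h
        + C * (\<bar>a\<bar> powr (p - 2) * h\<^sup>2 + \<bar>h\<bar> powr p)"
      using step by blast
    have ah: "max (\<bar>y + h\<bar> - R) 0 \<le> \<bar>a + h\<bar>" for h
      using R by (auto simp: a_def c_def abs_if max_def min_def)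
    have ahp: "max (\<bar>y + h\<bar> - R) 0 powr p \<le> \<bar>a + h\<bar> powr p" for h
      using ah assms by (intro powr_mono2) auto
    let ?W = "\<lambda>h. 4 / R\<^sup>2 * (h\<^sup>2 + \<bar>h\<bar> powr p)" and ?m = "\<lambda>h. 2 * max (\<bar>h\<bar> powr p - 1 / 2) 0"
    \<comment> \<open>For \<open>\<bar>y\<bar> \<le> R / 2\<close> the slope is set to 0: moderate
      increments leave the distance at 0, and a linear term could make the right-hand side
      negative.\<close>
    have main: "max (\<bar>y + h\<bar> - R) 0 powr p \<le> max (\<bar>y\<bar> - R) 0 powr p + (if \<bar>y\<bar> \<le> R / 2 then 0 else b) * h
       + C * ((1 + \<bar>y\<bar> powr p) * (?W h + ?m h))" for h
    proof -
      have W: "0 \<le> ?W h" "0 \<le> ?m h" by auto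
      show ?thesis
      proof (cases "\<bar>y\<bar> \<le> R / 2")
        case True
        have a0: "a = 0" using a True R by auto
        show ?thesis
        proof (cases "\<bar>h\<bar> \<le> R / 2")
          case h: True
          then have "\<bar>y + h\<bar> \<le> R" using True R by linarith
          then have "max (\<bar>y + h\<bar> - R) 0 = 0" by simp
          moreover have "0 \<le> C * ((1 + \<bar>y\<bar> powr p) * (?W h + ?m h))"
            using C W by (intro mult_nonneg_nonneg) auto
          ultimately show ?thesis using True by (simp add: max_def)
        next
          case False
          \<comment> \<open>Here \<open>\<bar>h\<bar> > R / 2 \<ge> 1\<close>, so subtracting the
            threshold \<open>1 / 2\<close> loses at most a factor 2.\<close>
          have "\<bar>h\<bar> powr p \<ge> 1" using False R assms by (intro ge_one_powr_ge_zero) auto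
          then have m: "\<bar>h\<bar> powr p \<le> ?m h" by simp
          also have "\<dots> \<le> ?W h + ?m h" using W by simp
          also have "\<dots> \<le> (1 + \<bar>y\<bar> powr p) * (?W h + ?m h)" using W
            by (metis add_increasing2 mult_1 mult_right_mono le_add_same_cancel1 powr_ge_zero add_nonneg_nonneg)
          finally have "C * \<bar>h\<bar> powr p \<le> C * ((1 + \<bar>y\<bar> powr p) * (?W h + ?m h))"
            using C by (intro mult_left_mono) auto
          \<comment> \<open>The expansion at \<open>a = 0\<close> is used for \<open>h\<close> and
            for \<open>-h\<close>: one of the two linear terms is nonpositive, which removes the
            slope.\<close>
          moreover have "\<bar>h\<bar> powr p \<le> b * h + C * \<bar>h\<bar> powr p" "\<bar>h\<bar> powr p \<le> - (b * h) + C * \<bar>h\<bar> powr p"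
            using b[of h] b[of "-h"] unfolding a0 by auto
          ultimately show ?thesis using ahp[of h] True R unfolding a0 by (auto simp: max_def)
        qed
      next
        case False
        then have y: "R / 2 \<le> \<bar>y\<bar>" by simp
        have R2: "1 \<le> 4 / R\<^sup>2 * y\<^sup>2"
        proof -
          have "(R / 2)\<^sup>2 \<le> \<bar>y\<bar>\<^sup>2" using y R by (intro power_mono) auto
          then show ?thesis using R by (simp add: field_simps power2_eq_square)
        qed
        have yp: "\<bar>y\<bar> powr (p - 2) * y\<^sup>2 = \<bar>y\<bar> powr p"
          using y R by (simp add: powr_diff powr_numeral)
        have y1: "1 \<le> \<bar>y\<bar> powr (p - 2)"
          using y R assms by (intro ge_one_powr_ge_zero) auto
        have "\<bar>y\<bar> powr (p - 2) * 1 \<le> \<bar>y\<bar> powr (p - 2) * (4 / R\<^sup>2 * y\<^sup>2)"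
          using R2 by (intro mult_left_mono) auto
        then have k1: "\<bar>y\<bar> powr (p - 2) \<le> 4 / R\<^sup>2 * \<bar>y\<bar> powr p"
          using yp by (simp add: mult_ac)
        have k2: "1 \<le> 4 / R\<^sup>2 * \<bar>y\<bar> powr p" using y1 k1 by linarith
        have "\<bar>a\<bar> powr (p - 2) \<le> \<bar>y\<bar> powr (p - 2)"
          using a R assms by (intro powr_mono2) auto
        then have "\<bar>a\<bar> powr (p - 2) * h\<^sup>2 + \<bar>h\<bar> powr p
            \<le> 4 / R\<^sup>2 * \<bar>y\<bar> powr p * h\<^sup>2 + 4 / R\<^sup>2 * \<bar>y\<bar> powr p * \<bar>h\<bar> powr p"
          using k1 k2 mult_right_mono[OF k2, of "\<bar>h\<bar> powr p"]
          by (intro add_mono mult_right_mono) auto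
        also have "\<dots> = \<bar>y\<bar> powr p * ?W h" by (simp add: algebra_simps add_divide_distrib)
        also have "\<dots> \<le> (1 + \<bar>y\<bar> powr p) * (?W h + ?m h)"
          using W by (intro mult_mono) auto
        finally have "C * (\<bar>a\<bar> powr (p - 2) * h\<^sup>2 + \<bar>h\<bar> powr p) \<le> C * ((1 + \<bar>y\<bar> powr p) * (?W h + ?m h))"
          using C by (intro mult_left_mono) auto
        then show ?thesis using ahp[of h] b[of h] a False by simp
      qed
    qed
    then show ?thesis by (intro exI[of _ "if \<bar>y\<bar> \<le> R / 2 then 0 else b"] allI) (metis mult.assoc)
  qed
  show thesis by (rule that[OF C]) (use one two in auto)
qed

section \<open>Functions with polynomially growing Lipschitz constant\<close>

text \<open>\<open>poly_lipschitz q\<close> is \<open>C_lLip\<close> on the real line with the exponent fixed to the real number \<open>q\<close>;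
  such functions grow at most like \<open>\<bar>x\<bar>\<^bsup>q + 1\<^esup>\<close>.\<close>

definition poly_lipschitz :: "real \<Rightarrow> (real \<Rightarrow> real) set" where
  "poly_lipschitz q = {f. \<exists>C\<ge>0. \<forall>x y. \<bar>f x - f y\<bar> \<le> C * (1 + \<bar>x\<bar> powr q + \<bar>y\<bar> powr q) * \<bar>x - y\<bar>}"

lemma poly_lipschitzI:
  assumes "\<And>x y. \<bar>f x - f y\<bar> \<le> C * (1 + \<bar>x\<bar> powr q + \<bar>y\<bar> powr q) * \<bar>x - y\<bar>"
  shows "f \<in> poly_lipschitz q"
proof -
  have "C * (1 + \<bar>x\<bar> powr q + \<bar>y\<bar> powr q) * \<bar>x - y\<bar> \<le> \<bar>C\<bar> * (1 + \<bar>x\<bar> powr q + \<bar>y\<bar> powr q) * \<bar>x - y\<bar>" for x y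
    by (intro mult_right_mono) auto
  then show ?thesis unfolding poly_lipschitz_def
    using order_trans[OF assms] by (intro CollectI exI[of _ "\<bar>C\<bar>"]) auto
qed

lemma poly_lipschitzE:
  assumes "f \<in> poly_lipschitz q"
  obtains C where "0 \<le> C" "\<And>x y. \<bar>f x - f y\<bar> \<le> C * (1 + \<bar>x\<bar> powr q + \<bar>y\<bar> powr q) * \<bar>x - y\<bar>"
  using assms unfolding poly_lipschitz_def by blast

lemma lipschitz_imp_poly_lipschitz:
  assumes "\<And>x y. \<bar>f x - f y\<bar> \<le> L * \<bar>x - y\<bar>"
  shows "f \<in> poly_lipschitz q"
proof (rule poly_lipschitzI)
  fix x y
  have "\<bar>f x - f y\<bar> \<le> \<bar>L\<bar> * \<bar>x - y\<bar>" using assms[of x y]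
    by (smt (verit) abs_ge_self abs_ge_zero mult_right_mono)
  also have "\<dots> \<le> \<bar>L\<bar> * (1 + \<bar>x\<bar> powr q + \<bar>y\<bar> powr q) * \<bar>x - y\<bar>"
    by (intro mult_right_mono) (auto simp: mult_le_cancel_left1)
  finally show "\<bar>f x - f y\<bar> \<le> \<bar>L\<bar> * (1 + \<bar>x\<bar> powr q + \<bar>y\<bar> powr q) * \<bar>x - y\<bar>" .
qed

lemma poly_lipschitz_const: "(\<lambda>_. c) \<in> poly_lipschitz q"
  by (rule lipschitz_imp_poly_lipschitz[of _ 0]) auto

lemma poly_lipschitz_add:
  assumes "f \<in> poly_lipschitz q" "g \<in> poly_lipschitz q"
  shows "(\<lambda>x. f x + g x) \<in> poly_lipschitz q"
proof -
  obtain C where C: "0 \<le> C" "\<And>x y. \<bar>f x - f y\<bar> \<le> C * (1 + \<bar>x\<bar> powr q + \<bar>y\<bar> powr q) * \<bar>x - y\<bar>"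
    by (rule poly_lipschitzE[OF assms(1)]) (rule that)
  obtain D where D: "0 \<le> D" "\<And>x y. \<bar>g x - g y\<bar> \<le> D * (1 + \<bar>x\<bar> powr q + \<bar>y\<bar> powr q) * \<bar>x - y\<bar>"
    by (rule poly_lipschitzE[OF assms(2)]) (rule that)
  show ?thesis
  proof (rule poly_lipschitzI)
    fix x y
    show "\<bar>(f x + g x) - (f y + g y)\<bar> \<le> (C + D) * (1 + \<bar>x\<bar> powr q + \<bar>y\<bar> powr q) * \<bar>x - y\<bar>"
      using C(2)[of x y] D(2)[of x y] unfolding distrib_right[of C D] distrib_right[of "C * _"] by linarith
  qed
qed

lemma poly_lipschitz_lipschitz_comp:
  assumes "f \<in> poly_lipschitz q" "\<And>x y. \<bar>g x - g y\<bar> \<le> L * \<bar>x - y\<bar>"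
  shows "(\<lambda>x. g (f x)) \<in> poly_lipschitz q"
proof -
  obtain C where C: "0 \<le> C" "\<And>x y. \<bar>f x - f y\<bar> \<le> C * (1 + \<bar>x\<bar> powr q + \<bar>y\<bar> powr q) * \<bar>x - y\<bar>"
    by (rule poly_lipschitzE[OF assms(1)]) (rule that)
  show ?thesis
  proof (rule poly_lipschitzI)
    fix x y
    have "\<bar>g (f x) - g (f y)\<bar> \<le> \<bar>L\<bar> * \<bar>f x - f y\<bar>" using assms(2)[of "f x" "f y"]
      by (smt (verit) abs_ge_self abs_ge_zero mult_right_mono)
    also have "\<dots> \<le> \<bar>L\<bar> * (C * (1 + \<bar>x\<bar> powr q + \<bar>y\<bar> powr q) * \<bar>x - y\<bar>)"
      using C by (intro mult_left_mono) auto
    finally show "\<bar>g (f x) - g (f y)\<bar> \<le> (\<bar>L\<bar> * C) * (1 + \<bar>x\<bar> powr q + \<bar>y\<bar> powr q) * \<bar>x - y\<bar>"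
      by (simp add: mult.assoc)
  qed
qed

lemma poly_lipschitz_cmult: "f \<in> poly_lipschitz q \<Longrightarrow> (\<lambda>x. c * f x) \<in> poly_lipschitz q"
  by (rule poly_lipschitz_lipschitz_comp[where g = "\<lambda>x. c * x" and L = "\<bar>c\<bar>"])
     (auto simp flip: abs_mult simp: algebra_simps)

lemma poly_lipschitz_minus: "f \<in> poly_lipschitz q \<Longrightarrow> (\<lambda>x. - f x) \<in> poly_lipschitz q"
  using poly_lipschitz_cmult[of f q "-1"] by simp

lemma poly_lipschitz_diff:
  "f \<in> poly_lipschitz q \<Longrightarrow> g \<in> poly_lipschitz q \<Longrightarrow> (\<lambda>x. f x - g x) \<in> poly_lipschitz q"
  using poly_lipschitz_add[of f q "\<lambda>x. - g x"] poly_lipschitz_minus by fastforce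

lemma poly_lipschitz_abs: "f \<in> poly_lipschitz q \<Longrightarrow> (\<lambda>x. \<bar>f x\<bar>) \<in> poly_lipschitz q"
  by (rule poly_lipschitz_lipschitz_comp[where g = abs and L = 1]) auto

lemma poly_lipschitz_max_const: "f \<in> poly_lipschitz q \<Longrightarrow> (\<lambda>x. max (f x) c) \<in> poly_lipschitz q"
  by (rule poly_lipschitz_lipschitz_comp[where g = "\<lambda>x. max x c" and L = 1]) auto

text \<open>A Lipschitz map grows at most linearly, so substituting it changes the constant but not
  the exponent. It is applied to affine changes of the increment and to the distance from an
  interval.\<close>

lemma poly_lipschitz_comp_lipschitz:
  assumes "f \<in> poly_lipschitz q" "0 \<le> q" "\<And>x y. \<bar>g x - g y\<bar> \<le> L * \<bar>x - y\<bar>"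
  shows "(\<lambda>x. f (g x)) \<in> poly_lipschitz q"
proof -
  obtain C where C: "0 \<le> C" "\<And>x y. \<bar>f x - f y\<bar> \<le> C * (1 + \<bar>x\<bar> powr q + \<bar>y\<bar> powr q) * \<bar>x - y\<bar>"
    by (rule poly_lipschitzE[OF assms(1)]) (rule that)
  define K where "K = 2 powr q * (\<bar>g 0\<bar> powr q + \<bar>L\<bar> powr q)"
  have K: "0 \<le> K" by (auto simp: K_def)
  have L: "\<bar>g x - g y\<bar> \<le> \<bar>L\<bar> * \<bar>x - y\<bar>" for x y using assms(3)[of x y]
    by (smt (verit) abs_ge_self abs_ge_zero mult_right_mono)
  have g: "\<bar>g x\<bar> powr q \<le> K * (1 + \<bar>x\<bar> powr q)" for x
  proof -
    have "\<bar>g x\<bar> powr q \<le> (\<bar>g 0\<bar> + \<bar>L\<bar> * \<bar>x\<bar>) powr q"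
      using L[of x 0] assms(2) by (intro powr_mono2) auto
    also have "\<dots> \<le> 2 powr q * (\<bar>g 0\<bar> powr q + (\<bar>L\<bar> * \<bar>x\<bar>) powr q)"
      using assms(2) by (intro powr_add_le) auto
    also have "\<dots> = 2 powr q * (\<bar>g 0\<bar> powr q + \<bar>L\<bar> powr q * \<bar>x\<bar> powr q)"
      by (simp add: powr_mult)
    also have "\<dots> \<le> K * (1 + \<bar>x\<bar> powr q)"
      by (simp add: K_def algebra_simps)
    finally show ?thesis .
  qed
  show ?thesis
  proof (rule poly_lipschitzI)
    fix x y
    have "\<bar>f (g x) - f (g y)\<bar> \<le> C * (1 + \<bar>g x\<bar> powr q + \<bar>g y\<bar> powr q) * \<bar>g x - g y\<bar>"
      by (rule C)
    also have "\<dots> \<le> C * (1 + K * (1 + \<bar>x\<bar> powr q) + K * (1 + \<bar>y\<bar> powr q)) * (\<bar>L\<bar> * \<bar>x - y\<bar>)"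
      using C K g L by (intro mult_mono add_mono mult_nonneg_nonneg) auto
    also have "\<dots> \<le> C * ((1 + 2 * K) * (1 + \<bar>x\<bar> powr q + \<bar>y\<bar> powr q)) * (\<bar>L\<bar> * \<bar>x - y\<bar>)"
      using C K by (intro mult_right_mono mult_left_mono) (auto simp: algebra_simps)
    finally show "\<bar>f (g x) - f (g y)\<bar>
        \<le> (C * (1 + 2 * K) * \<bar>L\<bar>) * (1 + \<bar>x\<bar> powr q + \<bar>y\<bar> powr q) * \<bar>x - y\<bar>"
      by (simp add: mult_ac)
  qed
qed

lemma poly_lipschitz_affine:
  assumes "f \<in> poly_lipschitz q" "0 \<le> q"
  shows "(\<lambda>x. f (y + a * x)) \<in> poly_lipschitz q"
  by (rule poly_lipschitz_comp_lipschitz[OF assms, where L = "\<bar>a\<bar>"])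
     (auto simp flip: abs_mult simp: algebra_simps)

lemma poly_lipschitz_abs_powr:
  assumes "1 \<le> p"
  shows "(\<lambda>x. \<bar>x\<bar> powr p) \<in> poly_lipschitz (p - 1)"
proof (rule poly_lipschitzI)
  fix x y :: real
  have "\<bar>\<bar>x\<bar> powr p - \<bar>y\<bar> powr p\<bar> \<le> p * max \<bar>x\<bar> \<bar>y\<bar> powr (p - 1) * \<bar>\<bar>x\<bar> - \<bar>y\<bar>\<bar>"
    using assms by (intro abs_powr_diff_le) auto
  also have "\<dots> \<le> p * (1 + \<bar>x\<bar> powr (p - 1) + \<bar>y\<bar> powr (p - 1)) * \<bar>x - y\<bar>"
    using assms by (intro mult_mono) (auto simp: max_def)
  finally show "\<bar>\<bar>x\<bar> powr p - \<bar>y\<bar> powr p\<bar> \<le> p * (1 + \<bar>x\<bar> powr (p - 1) + \<bar>y\<bar> powr (p - 1)) * \<bar>x - y\<bar>" .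
qed

lemma poly_lipschitz_mono:
  assumes "f \<in> poly_lipschitz q" "0 \<le> q" "q \<le> r"
  shows "f \<in> poly_lipschitz r"
proof -
  obtain C where C: "0 \<le> C" "\<And>x y. \<bar>f x - f y\<bar> \<le> C * (1 + \<bar>x\<bar> powr q + \<bar>y\<bar> powr q) * \<bar>x - y\<bar>"
    by (rule poly_lipschitzE[OF assms(1)]) (rule that)
  show ?thesis
  proof (rule poly_lipschitzI)
    fix x y :: real
    have "1 + \<bar>x\<bar> powr q + \<bar>y\<bar> powr q \<le> 3 * (1 + \<bar>x\<bar> powr r + \<bar>y\<bar> powr r)"
      using powr_le_one_add[of "\<bar>x\<bar>" q r] powr_le_one_add[of "\<bar>y\<bar>" q r] assms
        powr_ge_zero[of "\<bar>x\<bar>" r] powr_ge_zero[of "\<bar>y\<bar>" r] unfolding distrib_left by linarith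
    then have "C * (1 + \<bar>x\<bar> powr q + \<bar>y\<bar> powr q) * \<bar>x - y\<bar>
        \<le> C * (3 * (1 + \<bar>x\<bar> powr r + \<bar>y\<bar> powr r)) * \<bar>x - y\<bar>"
      using C by (intro mult_right_mono mult_left_mono) auto
    then show "\<bar>f x - f y\<bar> \<le> (C * 3) * (1 + \<bar>x\<bar> powr r + \<bar>y\<bar> powr r) * \<bar>x - y\<bar>"
      using C(2)[of x y] by (simp add: mult.assoc)
  qed
qed

lemma poly_lipschitz_square:
  assumes "1 \<le> q"
  shows "(\<lambda>x. x\<^sup>2) \<in> poly_lipschitz q"
proof -
  have "(\<lambda>x. \<bar>x\<bar> powr 2) \<in> poly_lipschitz 1" using poly_lipschitz_abs_powr[of 2] by simp
  then have "(\<lambda>x::real. x\<^sup>2) \<in> poly_lipschitz 1" by (simp add: powr_numeral)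
  then show ?thesis using assms by (rule poly_lipschitz_mono[OF _ zero_le_one])
qed

lemma poly_lipschitz_dist_interval_powr:
  assumes "1 \<le> p"
  shows "(\<lambda>x. max (\<bar>x\<bar> - R) 0 powr p) \<in> poly_lipschitz (p - 1)"
proof -
  have "(\<lambda>x. \<bar>max (\<bar>x\<bar> - R) 0\<bar> powr p) \<in> poly_lipschitz (p - 1)"
    using assms
    by (intro poly_lipschitz_comp_lipschitz[OF poly_lipschitz_abs_powr, where L = 1]) auto
  then show ?thesis by simp
qed

lemma poly_lipschitz_growth:
  assumes "f \<in> poly_lipschitz q" "0 \<le> q"
  obtains K where "0 \<le> K" "\<And>x. \<bar>f x\<bar> \<le> K * (1 + \<bar>x\<bar> powr (q + 1))"
proof -
  obtain C where C: "0 \<le> C" "\<And>x y. \<bar>f x - f y\<bar> \<le> C * (1 + \<bar>x\<bar> powr q + \<bar>y\<bar> powr q) * \<bar>x - y\<bar>"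
    by (rule poly_lipschitzE[OF assms(1)]) (rule that)
  have "\<bar>f x\<bar> \<le> (\<bar>f 0\<bar> + 2 * C) * (1 + \<bar>x\<bar> powr (q + 1))" for x
  proof -
    have "\<bar>x\<bar> powr 1 \<le> 1 + \<bar>x\<bar> powr (q + 1)" using assms by (intro powr_le_one_add) auto
    moreover have "\<bar>x\<bar> powr q * \<bar>x\<bar> = \<bar>x\<bar> powr (q + 1)" by (simp add: powr_add)
    ultimately have "(1 + \<bar>x\<bar> powr q) * \<bar>x\<bar> \<le> 2 * (1 + \<bar>x\<bar> powr (q + 1))"
      using powr_ge_zero[of "\<bar>x\<bar>" "q + 1"] by (simp add: distrib_right)
    then have "C * ((1 + \<bar>x\<bar> powr q) * \<bar>x\<bar>) \<le> C * (2 * (1 + \<bar>x\<bar> powr (q + 1)))"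
      using C by (intro mult_left_mono)
    moreover have "\<bar>f 0\<bar> \<le> \<bar>f 0\<bar> * (1 + \<bar>x\<bar> powr (q + 1))" by (simp add: mult_le_cancel_left1)
    moreover have "\<bar>f x - f 0\<bar> \<le> C * ((1 + \<bar>x\<bar> powr q) * \<bar>x\<bar>)"
      using C(2)[of x 0] by (simp add: mult.assoc)
    moreover have "\<bar>f x\<bar> \<le> \<bar>f 0\<bar> + \<bar>f x - f 0\<bar>" by linarith
    ultimately show ?thesis unfolding distrib_right[of _ "2 * C"] by linarith
  qed
  then show thesis using that[of "\<bar>f 0\<bar> + 2 * C"] C by auto
qed

text \<open>The link between functions on the line and the class attached to the expectation space.
  The linear form is at most \<open>\<bar>a\<bar> * n\<close> times the Euclidean norm, and the real
  exponent \<open>q\<close> is rounded up to an integer.\<close>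

lemma C_lLip_poly_lipschitz_linear:
  assumes f: "f \<in> poly_lipschitz q" and q: "0 \<le> q"
  shows "(\<lambda>x. f (a * (\<Sum>i<n. x i))) \<in> C_lLip n"
proof -
  obtain C where C: "0 \<le> C" "\<And>x y. \<bar>f x - f y\<bar> \<le> C * (1 + \<bar>x\<bar> powr q + \<bar>y\<bar> powr q) * \<bar>x - y\<bar>"
    by (rule poly_lipschitzE[OF f]) (rule that)
  define m where "m = nat \<lceil>q\<rceil>"
  have m: "q \<le> real m" by (simp add: m_def) linarith
  define A where "A = \<bar>a\<bar> * real n"
  have A: "0 \<le> A" by (simp add: A_def)
  have lin: "\<bar>a * (\<Sum>i<n. x i)\<bar> \<le> A * L2_set x {..<n}" for x
  proof -
    have "\<bar>\<Sum>i<n. x i\<bar> \<le> (\<Sum>i<n. \<bar>x i\<bar>)" by (rule sum_abs)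
    also have "\<dots> \<le> (\<Sum>i<n. L2_set x {..<n})"
    proof (rule sum_mono)
      fix i assume "i \<in> {..<n}"
      then have "\<bar>x i\<bar> \<le> L2_set (\<lambda>i. \<bar>x i\<bar>) {..<n}" by (intro member_le_L2_set) auto
      then show "\<bar>x i\<bar> \<le> L2_set x {..<n}" by (simp add: L2_set_def)
    qed
    finally have "\<bar>\<Sum>i<n. x i\<bar> \<le> real n * L2_set x {..<n}" by simp
    then show ?thesis unfolding A_def abs_mult mult.assoc by (intro mult_left_mono) auto
  qed
  have pw: "\<bar>a * (\<Sum>i<n. x i)\<bar> powr q \<le> A powr q * (1 + L2_set x {..<n} ^ m)" for x
  proof -
    have "\<bar>a * (\<Sum>i<n. x i)\<bar> powr q \<le> (A * L2_set x {..<n}) powr q"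
      using lin q by (intro powr_mono2) auto
    also have "\<dots> = A powr q * L2_set x {..<n} powr q" by (simp add: powr_mult)
    also have "\<dots> \<le> A powr q * (1 + L2_set x {..<n} ^ m)"
    proof (intro mult_left_mono)
      show "L2_set x {..<n} powr q \<le> 1 + L2_set x {..<n} ^ m"
      \<comment> \<open>\<open>0 powr 0 = 0\<close> whereas \<open>0 ^ 0 = 1\<close>, so exponent 0
        cannot pass through the conversion between the two powers.\<close>
      proof (cases "m = 0")
        case True
        then have "q = 0" using m q by simp
        then show ?thesis using True by simp
      next
        case False
          have "L2_set x {..<n} powr real m = L2_set x {..<n} ^ m"
            using False by (intro powr_realpow') auto
          then show ?thesis
            using powr_le_one_add[of "L2_set x {..<n}" q "real m"] m q by simp
      qed
    qed auto
    finally show ?thesis .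
  qed
  \<comment> \<open>The summand 1 makes the constant strictly positive, as \<open>C_lLip\<close>
    demands.\<close>
  define K where "K = C * (1 + 2 * A powr q) * A + 1"
  have "\<bar>f (a * (\<Sum>i<n. x i)) - f (a * (\<Sum>i<n. y i))\<bar>
      \<le> K * (1 + L2_set x {..<n} ^ m + L2_set y {..<n} ^ m) * L2_set (\<lambda>i. x i - y i) {..<n}" for x y
  proof -
    let ?x = "L2_set x {..<n} ^ m" and ?y = "L2_set y {..<n} ^ m"
    let ?d = "L2_set (\<lambda>i. x i - y i) {..<n}"
    have nn: "0 \<le> ?x" "0 \<le> ?y" by auto
    have d: "\<bar>a * (\<Sum>i<n. x i) - a * (\<Sum>i<n. y i)\<bar> \<le> A * ?d"
      using lin[of "\<lambda>i. x i - y i"] by (simp add: sum_subtractf right_diff_distrib)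
    have "\<bar>f (a * (\<Sum>i<n. x i)) - f (a * (\<Sum>i<n. y i))\<bar>
        \<le> C * (1 + A powr q * (1 + ?x) + A powr q * (1 + ?y)) * (A * ?d)"
      using pw[of x] pw[of y] C(1) A nn d
      by (intro order_trans[OF C(2)] mult_mono add_mono mult_nonneg_nonneg) auto
    also have "\<dots> \<le> C * ((1 + 2 * A powr q) * (1 + ?x + ?y)) * (A * ?d)"
      using C(1) A nn by (intro mult_right_mono mult_left_mono) (auto simp: algebra_simps)
    also have "\<dots> = (C * (1 + 2 * A powr q) * A) * ((1 + ?x + ?y) * ?d)" by (simp add: mult_ac)
    also have "\<dots> \<le> K * ((1 + ?x + ?y) * ?d)"
      using nn by (intro mult_right_mono mult_nonneg_nonneg) (auto simp: K_def)
    finally show ?thesis by (simp add: mult.assoc)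
  qed
  moreover have "0 < K" unfolding K_def using C A by (intro add_nonneg_pos mult_nonneg_nonneg) auto
  ultimately show ?thesis unfolding C_lLip_def by blast
qed

lemma C_lLip_poly_lipschitz:
  assumes "f \<in> poly_lipschitz q" "0 \<le> q"
  shows "(\<lambda>x. f (x 0)) \<in> C_lLip 1"
  using C_lLip_poly_lipschitz_linear[OF assms, of 1 1] by simp

section \<open>Calculus of sublinear expectations\<close>

context sublinear_expectation_space
begin

text \<open>On \<open>H\<close> the functional may be infinite. On this linear subspace it is
  finite, so that \<open>expect\<close> permits ordinary real arithmetic.\<close>

definition integrable_rv :: "('a \<Rightarrow> real) set" where
  "integrable_rv = {X \<in> H. E (\<lambda>\<omega>. \<bar>X \<omega>\<bar>) < \<infinity>}"

definition expect :: "('a \<Rightarrow> real) \<Rightarrow> real" where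
  "expect X = real_of_ereal (E X)"

text \<open>Constants are local Lipschitz functions of zero variables, where both sides of the
  defining inequality vanish.\<close>

lemma H_const: "(\<lambda>_. c) \<in> H"
proof -
  have "(\<lambda>_. c) \<in> C_lLip 0" unfolding C_lLip_def by (auto intro!: exI[of _ 1])
  then show ?thesis using H_C_lLip[of "\<lambda>_. c" 0] by simp
qed

lemma H_poly_lipschitz_sum:
  fixes X :: "nat \<Rightarrow> 'a \<Rightarrow> real"
  assumes "f \<in> poly_lipschitz q" "0 \<le> q" "\<And>i. i < n \<Longrightarrow> X i \<in> H"
  shows "(\<lambda>\<omega>. f (a * (\<Sum>i<n. X i \<omega>))) \<in> H"
  by (rule H_C_lLip[OF C_lLip_poly_lipschitz_linear[OF assms(1,2)], where X = X]) (rule assms(3))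

lemma H_poly_lipschitz:
  assumes "f \<in> poly_lipschitz q" "0 \<le> q" "X \<in> H"
  shows "(\<lambda>\<omega>. f (X \<omega>)) \<in> H"
  using H_poly_lipschitz_sum[OF assms(1,2), of 1 "\<lambda>_. X" 1] assms(3) by (simp add: lessThan_Suc del: sum_constant)

lemma H_minus: "X \<in> H \<Longrightarrow> (\<lambda>\<omega>. - X \<omega>) \<in> H"
  using H_scale[of X "-1"] by simp

lemma H_abs: "X \<in> H \<Longrightarrow> (\<lambda>\<omega>. \<bar>X \<omega>\<bar>) \<in> H"
  by (rule H_poly_lipschitz[of _ 0]) (auto intro: lipschitz_imp_poly_lipschitz[of _ 1])

lemma integrable_rv_H: "X \<in> integrable_rv \<Longrightarrow> X \<in> H"
  by (simp add: integrable_rv_def)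

lemma integrable_rv_bound:
  assumes "X \<in> H" "Y \<in> integrable_rv" "\<And>\<omega>. \<omega> \<in> space M \<Longrightarrow> \<bar>X \<omega>\<bar> \<le> Y \<omega>"
  shows "X \<in> integrable_rv"
proof -
  have "E (\<lambda>\<omega>. \<bar>X \<omega>\<bar>) \<le> E (\<lambda>\<omega>. \<bar>Y \<omega>\<bar>)"
    using assms(1,2) order_trans[OF assms(3) abs_ge_self]
    by (intro E_mono H_abs) (auto simp: integrable_rv_def)
  then show ?thesis using assms by (auto simp: integrable_rv_def)
qed

lemma integrable_rv_const: "(\<lambda>_. c) \<in> integrable_rv"
  by (simp add: integrable_rv_def H_const E_const)

lemma integrable_rv_abs: "X \<in> integrable_rv \<Longrightarrow> (\<lambda>\<omega>. \<bar>X \<omega>\<bar>) \<in> integrable_rv"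
  by (auto simp: integrable_rv_def H_abs)

text \<open>\<open>X\<close> and \<open>- X\<close> both have expectation below that of
  \<open>\<bar>X\<bar>\<close>, and by subadditivity their sum is at least 0; hence neither can be
  \<open>-\<infinity>\<close>.\<close>

lemma E_integrable_rv:
  assumes "X \<in> integrable_rv"
  shows "E X = ereal (expect X)"
proof -
  have H: "X \<in> H" "(\<lambda>\<omega>. - X \<omega>) \<in> H" "(\<lambda>\<omega>. \<bar>X \<omega>\<bar>) \<in> H"
    using assms by (auto simp: integrable_rv_def H_minus H_abs)
  have 1: "E X \<le> E (\<lambda>\<omega>. \<bar>X \<omega>\<bar>)" "E (\<lambda>\<omega>. - X \<omega>) \<le> E (\<lambda>\<omega>. \<bar>X \<omega>\<bar>)"
    using H by (auto intro!: E_mono)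
  have fin: "E X \<noteq> \<infinity>" "E (\<lambda>\<omega>. - X \<omega>) \<noteq> \<infinity>"
    using 1 assms by (auto simp: integrable_rv_def)
  have "E (\<lambda>\<omega>. X \<omega> + - X \<omega>) \<le> E X + E (\<lambda>\<omega>. - X \<omega>)"
    using fin H by (intro E_subadd) auto
  then have "0 \<le> E X + E (\<lambda>\<omega>. - X \<omega>)" using E_const[of 0] by (simp add: zero_ereal_def)
  then have "E X \<noteq> -\<infinity>" using fin by (cases "E X"; cases "E (\<lambda>\<omega>. - X \<omega>)") auto
  then show ?thesis using fin by (cases "E X") (auto simp: expect_def)
qed

lemma integrable_rv_add:
  assumes "X \<in> integrable_rv" "Y \<in> integrable_rv"
  shows "(\<lambda>\<omega>. X \<omega> + Y \<omega>) \<in> integrable_rv"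
proof -
  have XY: "(\<lambda>\<omega>. \<bar>X \<omega>\<bar>) \<in> integrable_rv" "(\<lambda>\<omega>. \<bar>Y \<omega>\<bar>) \<in> integrable_rv"
    using assms by (auto intro: integrable_rv_abs)
  have H: "(\<lambda>\<omega>. X \<omega> + Y \<omega>) \<in> H" "(\<lambda>\<omega>. \<bar>X \<omega>\<bar> + \<bar>Y \<omega>\<bar>) \<in> H"
    using H_add[OF assms[THEN integrable_rv_H]] H_add[OF XY[THEN integrable_rv_H]] by auto
  have "E (\<lambda>\<omega>. \<bar>X \<omega> + Y \<omega>\<bar>) \<le> E (\<lambda>\<omega>. \<bar>X \<omega>\<bar> + \<bar>Y \<omega>\<bar>)"
    using H by (intro E_mono H_abs) auto
  also have "\<dots> \<le> E (\<lambda>\<omega>. \<bar>X \<omega>\<bar>) + E (\<lambda>\<omega>. \<bar>Y \<omega>\<bar>)"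
    using XY E_integrable_rv[OF XY(1)] E_integrable_rv[OF XY(2)] by (intro E_subadd integrable_rv_H) auto
  also have "\<dots> < \<infinity>" using XY by (simp add: E_integrable_rv)
  finally show ?thesis using H by (simp add: integrable_rv_def)
qed

lemma integrable_rv_cmult:
  assumes "X \<in> integrable_rv"
  shows "(\<lambda>\<omega>. c * X \<omega>) \<in> integrable_rv"
proof -
  have X: "(\<lambda>\<omega>. \<bar>X \<omega>\<bar>) \<in> integrable_rv" using assms by (rule integrable_rv_abs)
  have "E (\<lambda>\<omega>. \<bar>c\<bar> * \<bar>X \<omega>\<bar>) = ereal \<bar>c\<bar> * E (\<lambda>\<omega>. \<bar>X \<omega>\<bar>)"
    using X by (intro E_pos_homogeneous) (auto simp: integrable_rv_H)
  then show ?thesis using X assms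
    by (auto simp: integrable_rv_def abs_mult H_scale E_integrable_rv[OF X])
qed

lemma integrable_rv_diff:
  "X \<in> integrable_rv \<Longrightarrow> Y \<in> integrable_rv \<Longrightarrow> (\<lambda>\<omega>. X \<omega> - Y \<omega>) \<in> integrable_rv"
  using integrable_rv_add[of X "\<lambda>\<omega>. -1 * Y \<omega>"] integrable_rv_cmult[of Y "-1"] by simp

lemma expect_const [simp]: "expect (\<lambda>_. c) = c"
  by (simp add: expect_def E_const)

lemma expect_mono:
  assumes "X \<in> integrable_rv" "Y \<in> integrable_rv" "\<And>\<omega>. \<omega> \<in> space M \<Longrightarrow> X \<omega> \<le> Y \<omega>"
  shows "expect X \<le> expect Y"
  using E_mono[of Y X] assms by (auto simp: integrable_rv_H E_integrable_rv)

lemma expect_add_le: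
  assumes "X \<in> integrable_rv" "Y \<in> integrable_rv"
  shows "expect (\<lambda>\<omega>. X \<omega> + Y \<omega>) \<le> expect X + expect Y"
  using E_subadd[of X Y] assms
  by (auto simp: integrable_rv_H E_integrable_rv integrable_rv_add)

lemma expect_cmult:
  assumes "X \<in> integrable_rv" "0 \<le> c"
  shows "expect (\<lambda>\<omega>. c * X \<omega>) = c * expect X"
  using E_pos_homogeneous[of X c] assms
  by (auto simp: integrable_rv_H E_integrable_rv integrable_rv_cmult)

text \<open>Subadditivity gives one inequality; applying it once more to \<open>- c\<close> and
  \<open>c + X\<close> reverses it.\<close>

lemma expect_add_const:
  assumes "X \<in> integrable_rv"
  shows "expect (\<lambda>\<omega>. c + X \<omega>) = c + expect X"
proof (rule antisym)
  show "expect (\<lambda>\<omega>. c + X \<omega>) \<le> c + expect X"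
    using expect_add_le[OF integrable_rv_const[of c] assms] by simp
  show "c + expect X \<le> expect (\<lambda>\<omega>. c + X \<omega>)"
    using expect_add_le[OF integrable_rv_const[of "-c"] integrable_rv_add[OF integrable_rv_const[of c] assms]]
    by simp
qed

text \<open>The substitute for linearity in continuity estimates; it rests on
  \<open>X \<le> Y + \<bar>X - Y\<bar>\<close>.\<close>

lemma expect_diff_le:
  assumes "X \<in> integrable_rv" "Y \<in> integrable_rv"
  shows "\<bar>expect X - expect Y\<bar> \<le> expect (\<lambda>\<omega>. \<bar>X \<omega> - Y \<omega>\<bar>)"
proof -
  have le: "expect X - expect Y \<le> expect (\<lambda>\<omega>. \<bar>X \<omega> - Y \<omega>\<bar>)"
    if "X \<in> integrable_rv" "Y \<in> integrable_rv" for X Y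
  proof -
    have "expect X \<le> expect (\<lambda>\<omega>. Y \<omega> + \<bar>X \<omega> - Y \<omega>\<bar>)"
      using that by (intro expect_mono integrable_rv_add integrable_rv_abs integrable_rv_diff) auto
    also have "\<dots> \<le> expect Y + expect (\<lambda>\<omega>. \<bar>X \<omega> - Y \<omega>\<bar>)"
      using that by (intro expect_add_le integrable_rv_abs integrable_rv_diff)
    finally show ?thesis by simp
  qed
  show ?thesis using le[OF assms] le[OF assms(2,1)] by (simp add: abs_minus_commute abs_le_iff)
qed

lemma integrable_rv_poly_lipschitz:
  assumes "f \<in> poly_lipschitz (p - 1)" "1 \<le> p" "X \<in> H" "E (\<lambda>\<omega>. \<bar>X \<omega>\<bar> powr p) < \<infinity>"
  shows "(\<lambda>\<omega>. f (X \<omega>)) \<in> integrable_rv"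
proof -
  obtain K where K: "0 \<le> K" "\<And>x. \<bar>f x\<bar> \<le> K * (1 + \<bar>x\<bar> powr (p - 1 + 1))"
    using poly_lipschitz_growth[OF assms(1)] assms(2) by auto
  have "(\<lambda>\<omega>. \<bar>X \<omega>\<bar> powr p) \<in> H"
    using assms(2,3) by (intro H_poly_lipschitz[OF poly_lipschitz_abs_powr]) auto
  then have "(\<lambda>\<omega>. \<bar>X \<omega>\<bar> powr p) \<in> integrable_rv" using assms(4) by (simp add: integrable_rv_def)
  then have "(\<lambda>\<omega>. K * (1 + \<bar>X \<omega>\<bar> powr p)) \<in> integrable_rv"
    by (intro integrable_rv_cmult integrable_rv_add integrable_rv_const)
  then show ?thesis
    by (rule integrable_rv_bound[rotated]) (use assms K in \<open>auto intro: H_poly_lipschitz\<close>)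
qed

end

section \<open>The one-step operator and the expectation of functions of sums\<close>

locale centered_iid = sublinear_expectation_space M H E
  for M :: "'a measure" and H :: "('a \<Rightarrow> real) set" and E :: "('a \<Rightarrow> real) \<Rightarrow> ereal" +
  fixes X :: "nat \<Rightarrow> 'a \<Rightarrow> real" and p :: real
  assumes p: "2 \<le> p"
    and iid: "iid_sequence H E X"
    and mean_zero: "E (X 1) = 0" "E (\<lambda>\<omega>. - X 1 \<omega>) = 0"
    and moment: "E (\<lambda>\<omega>. \<bar>X 1 \<omega>\<bar> powr p) < \<infinity>"
begin

text \<open>The exponent \<open>p - 1\<close> allows growth of order \<open>p\<close>, which
  \<open>moment\<close> integrates. The class is mapped into itself by \<open>step_op\<close>, so
  all iterates stay admissible.\<close>

abbreviation D :: "(real \<Rightarrow> real) set" where "D \<equiv> poly_lipschitz (p - 1)"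

definition step_expect :: "(real \<Rightarrow> real) \<Rightarrow> real" where
  "step_expect f = expect (\<lambda>\<omega>. f (X 1 \<omega>))"

definition step_op :: "real \<Rightarrow> (real \<Rightarrow> real) \<Rightarrow> real \<Rightarrow> real" where
  "step_op a f y = step_expect (\<lambda>h. f (y + a * h))"

lemma p_simps: "1 \<le> p" "0 \<le> p - 1" "0 \<le> p" "1 \<le> p - 1" using p by auto

lemma D_affine: "f \<in> D \<Longrightarrow> (\<lambda>h. f (y + a * h)) \<in> D"
  using p_simps by (intro poly_lipschitz_affine)

lemma D_linear: "(\<lambda>x. b * x) \<in> D"
  by (rule lipschitz_imp_poly_lipschitz[where L = "\<bar>b\<bar>"]) (auto simp flip: abs_mult simp: algebra_simps)

lemma D_abs_powr: "1 \<le> r \<Longrightarrow> r \<le> p \<Longrightarrow> (\<lambda>x. \<bar>x\<bar> powr r) \<in> D"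
  using poly_lipschitz_abs_powr by (rule poly_lipschitz_mono) auto

lemma X_H: "1 \<le> i \<Longrightarrow> X i \<in> H"
  using iid by (simp add: iid_sequence_def)

lemma integrable_X1: "f \<in> D \<Longrightarrow> (\<lambda>\<omega>. f (X 1 \<omega>)) \<in> integrable_rv"
  using p_simps moment by (intro integrable_rv_poly_lipschitz X_H) auto

text \<open>\<open>identically_distributed\<close> transfers a value as soon as one side is finite;
  the finite side is index 1.\<close>

lemma E_X:
  assumes "f \<in> D" "1 \<le> i"
  shows "E (\<lambda>\<omega>. f (X i \<omega>)) = ereal (step_expect f)"
proof -
  have "(\<lambda>x. f (x 0)) \<in> C_lLip 1" using assms p_simps by (intro C_lLip_poly_lipschitz) auto
  moreover have "identically_distributed E (X i) (X 1)"
    using iid assms by (simp add: iid_sequence_def)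
  moreover have "E (\<lambda>\<omega>. f (X 1 \<omega>)) = ereal (step_expect f)"
    using integrable_X1[OF assms(1)] by (simp add: E_integrable_rv step_expect_def)
  ultimately show ?thesis unfolding identically_distributed_def by force
qed

lemma integrable_X:
  assumes "f \<in> D" "1 \<le> i"
  shows "(\<lambda>\<omega>. f (X i \<omega>)) \<in> integrable_rv"
  using E_X[OF poly_lipschitz_abs[OF assms(1)] assms(2)] assms p_simps X_H[OF assms(2)]
  by (auto simp: integrable_rv_def intro: H_poly_lipschitz)

lemma step_expect_const [simp]: "step_expect (\<lambda>_. c) = c"
  by (simp add: step_expect_def)

lemma step_expect_mono:
  assumes "f \<in> D" "g \<in> D" "\<And>x. f x \<le> g x"
  shows "step_expect f \<le> step_expect g"
  unfolding step_expect_def using assms by (intro expect_mono integrable_X1) auto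

lemma step_expect_add_le:
  assumes "f \<in> D" "g \<in> D"
  shows "step_expect (\<lambda>x. f x + g x) \<le> step_expect f + step_expect g"
  unfolding step_expect_def using assms by (intro expect_add_le integrable_X1) auto

lemma step_expect_cmult: "f \<in> D \<Longrightarrow> 0 \<le> c \<Longrightarrow> step_expect (\<lambda>x. c * f x) = c * step_expect f"
  unfolding step_expect_def by (intro expect_cmult integrable_X1)

lemma step_expect_add_const: "f \<in> D \<Longrightarrow> step_expect (\<lambda>x. c + f x) = c + step_expect f"
  unfolding step_expect_def by (intro expect_add_const integrable_X1)

lemma step_expect_diff_le:
  "f \<in> D \<Longrightarrow> g \<in> D \<Longrightarrow> \<bar>step_expect f - step_expect g\<bar> \<le> step_expect (\<lambda>x. \<bar>f x - g x\<bar>)"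
  unfolding step_expect_def by (intro expect_diff_le integrable_X1)

text \<open>The functional vanishes on both \<open>x\<close> and \<open>- x\<close>, so positive
  homogeneity reaches slopes of either sign.\<close>

lemma step_expect_linear [simp]: "step_expect (\<lambda>x. b * x) = 0"
proof -
  have id: "(\<lambda>x. x) \<in> D" and neg: "(\<lambda>x. - x) \<in> D"
    using D_linear[of 1] D_linear[of "-1"] by auto
  have "step_expect (\<lambda>x. x) = 0" "step_expect (\<lambda>x. - x) = 0"
    using mean_zero by (auto simp: step_expect_def expect_def)
  then show ?thesis
    using step_expect_cmult[OF id, of b] step_expect_cmult[OF neg, of "-b"] by (cases "0 \<le> b") auto
qed

text \<open>Invariance of the class, needed for iteration. The increment enters the local Lipschitz
  constant only through \<open>\<bar>h\<bar> powr (p - 1)\<close>, whose expectation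
  \<open>m\<close> is available because \<open>1 \<le> p - 1 \<le> p\<close>.\<close>

lemma step_op_D:
  assumes f: "f \<in> D"
  shows "step_op a f \<in> D"
proof -
  obtain C where C: "0 \<le> C"
    "\<And>x y. \<bar>f x - f y\<bar> \<le> C * (1 + \<bar>x\<bar> powr (p - 1) + \<bar>y\<bar> powr (p - 1)) * \<bar>x - y\<bar>"
    by (rule poly_lipschitzE[OF f]) (rule that)
  define q where "q = p - 1"
  define m where "m = step_expect (\<lambda>h. \<bar>h\<bar> powr q)"
  define K where "K = 2 powr q * \<bar>a\<bar> powr q"
  have q: "0 \<le> q" "1 \<le> q" "q \<le> p" using p_simps by (auto simp: q_def)
  have hq: "(\<lambda>h. \<bar>h\<bar> powr q) \<in> D" using q by (intro D_abs_powr)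
  have m: "0 \<le> m" unfolding m_def
    using step_expect_mono[OF poly_lipschitz_const[of 0] hq] by simp
  have K: "0 \<le> K" by (simp add: K_def)
  have pw: "\<bar>y + a * h\<bar> powr q \<le> 2 powr q * \<bar>y\<bar> powr q + K * \<bar>h\<bar> powr q" for y h
  proof -
    have "\<bar>y + a * h\<bar> powr q \<le> (\<bar>y\<bar> + \<bar>a\<bar> * \<bar>h\<bar>) powr q"
      using q by (intro powr_mono2) (auto simp flip: abs_mult)
    also have "\<dots> \<le> 2 powr q * (\<bar>y\<bar> powr q + (\<bar>a\<bar> * \<bar>h\<bar>) powr q)"
      using q by (intro powr_add_le) auto
    finally show ?thesis by (simp add: powr_mult K_def algebra_simps)
  qed
  have "\<bar>step_op a f y - step_op a f z\<bar>
      \<le> (C * (1 + 2 powr q + 2 * K * m)) * (1 + \<bar>y\<bar> powr q + \<bar>z\<bar> powr q) * \<bar>y - z\<bar>" for y z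
  proof -
    define A where "A = 1 + 2 powr q * (\<bar>y\<bar> powr q + \<bar>z\<bar> powr q)"
    have "\<bar>step_op a f y - step_op a f z\<bar> \<le> step_expect (\<lambda>h. \<bar>f (y + a * h) - f (z + a * h)\<bar>)"
      unfolding step_op_def using f by (intro step_expect_diff_le D_affine)
    also have "\<dots> \<le> step_expect (\<lambda>h. (C * \<bar>y - z\<bar>) * (A + (2 * K) * \<bar>h\<bar> powr q))"
    proof (rule step_expect_mono)
      show "(\<lambda>h. \<bar>f (y + a * h) - f (z + a * h)\<bar>) \<in> D"
        using f by (intro poly_lipschitz_abs poly_lipschitz_diff D_affine)
      show "(\<lambda>h. (C * \<bar>y - z\<bar>) * (A + (2 * K) * \<bar>h\<bar> powr q)) \<in> D"
        using hq by (intro poly_lipschitz_cmult poly_lipschitz_add poly_lipschitz_const)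
      fix h
      have "\<bar>f (y + a * h) - f (z + a * h)\<bar>
          \<le> C * (1 + \<bar>y + a * h\<bar> powr q + \<bar>z + a * h\<bar> powr q) * \<bar>y - z\<bar>"
        using C(2)[of "y + a * h" "z + a * h"] by (simp add: q_def)
      also have "\<dots> \<le> C * (A + (2 * K) * \<bar>h\<bar> powr q) * \<bar>y - z\<bar>"
        using pw[of y h] pw[of z h] C(1)
        by (intro mult_right_mono mult_left_mono) (auto simp: A_def algebra_simps)
      finally show "\<bar>f (y + a * h) - f (z + a * h)\<bar> \<le> (C * \<bar>y - z\<bar>) * (A + (2 * K) * \<bar>h\<bar> powr q)"
        by (simp add: mult_ac)
    qed
    also have "\<dots> = (C * \<bar>y - z\<bar>) * (A + (2 * K) * m)"
      using hq C(1) K by (simp add: m_def step_expect_cmult step_expect_add_const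
          poly_lipschitz_add poly_lipschitz_const poly_lipschitz_cmult)
    also have "\<dots> \<le> (C * \<bar>y - z\<bar>) * ((1 + 2 powr q + 2 * K * m) * (1 + \<bar>y\<bar> powr q + \<bar>z\<bar> powr q))"
      using C(1) K m by (intro mult_left_mono) (auto simp: A_def algebra_simps)
    finally show ?thesis by (simp add: mult_ac)
  qed
  then show ?thesis unfolding q_def by (rule poly_lipschitzI)
qed

text \<open>The absolute power of order \<open>p\<close> of a sum is controlled by induction,
  splitting off one summand with \<open>powr_add_le\<close>; all of \<open>D\<close> follows by
  growth.\<close>

lemma integrable_sum:
  assumes "f \<in> D"
  shows "(\<lambda>\<omega>. f (a * (\<Sum>i<k. X (Suc i) \<omega>))) \<in> integrable_rv"
proof -
  have pw: "(\<lambda>\<omega>. \<bar>a * (\<Sum>i<k. X (Suc i) \<omega>)\<bar> powr p) \<in> integrable_rv"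
  proof (induction k)
    case 0
    then show ?case by (simp add: integrable_rv_const)
  next
    case (Suc k)
    have "(\<lambda>\<omega>. \<bar>0 + a * X (Suc k) \<omega>\<bar> powr p) \<in> integrable_rv"
      using p_simps by (intro integrable_X[where f = "\<lambda>x. \<bar>0 + a * x\<bar> powr p"]
          D_affine[where f = "\<lambda>x. \<bar>x\<bar> powr p"] D_abs_powr) auto
    then have i: "(\<lambda>\<omega>. 2 powr p * (\<bar>a * (\<Sum>i<k. X (Suc i) \<omega>)\<bar> powr p + \<bar>a * X (Suc k) \<omega>\<bar> powr p)) \<in> integrable_rv"
      using Suc by (intro integrable_rv_cmult integrable_rv_add) auto
    show ?case
    proof (rule integrable_rv_bound[OF _ i])
      show "(\<lambda>\<omega>. \<bar>a * (\<Sum>i<Suc k. X (Suc i) \<omega>)\<bar> powr p) \<in> H"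
        using p_simps X_H by (intro H_poly_lipschitz_sum[OF poly_lipschitz_abs_powr]) auto
      fix \<omega>
      have "\<bar>a * (\<Sum>i<Suc k. X (Suc i) \<omega>)\<bar> powr p
          \<le> (\<bar>a * (\<Sum>i<k. X (Suc i) \<omega>)\<bar> + \<bar>a * X (Suc k) \<omega>\<bar>) powr p"
        using p_simps by (intro powr_mono2) (auto simp: distrib_left)
      also have "\<dots> \<le> 2 powr p * (\<bar>a * (\<Sum>i<k. X (Suc i) \<omega>)\<bar> powr p + \<bar>a * X (Suc k) \<omega>\<bar> powr p)"
        using p_simps by (intro powr_add_le) auto
      finally show "\<bar>\<bar>a * (\<Sum>i<Suc k. X (Suc i) \<omega>)\<bar> powr p\<bar>
          \<le> 2 powr p * (\<bar>a * (\<Sum>i<k. X (Suc i) \<omega>)\<bar> powr p + \<bar>a * X (Suc k) \<omega>\<bar> powr p)"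
        by simp
    qed
  qed
  have aS: "(\<lambda>\<omega>. a * (\<Sum>i<k. X (Suc i) \<omega>)) \<in> H"
    using X_H by (intro H_poly_lipschitz_sum[of "\<lambda>x. x" 0] lipschitz_imp_poly_lipschitz[of _ 1]) auto
  show ?thesis
    using assms p_simps pw
    by (intro integrable_rv_poly_lipschitz[OF _ _ aS]) (auto simp: integrable_rv_def)
qed

text \<open>Independence evaluates the last increment first, with the partial sum frozen; the inner
  expectation is \<open>step_op a f\<close> at the partial sum. This function and its analogue for
  \<open>\<bar>f\<bar>\<close> lie in \<open>D\<close> again, which supplies the membership and
  integrability conditions in \<open>indep_vector\<close>.\<close>

lemma expect_sum_Suc:
  assumes f: "f \<in> D"
  shows "expect (\<lambda>\<omega>. f (a * (\<Sum>i<Suc k. X (Suc i) \<omega>))) = expect (\<lambda>\<omega>. step_op a f (a * (\<Sum>i<k. X (Suc i) \<omega>)))"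
\<comment> \<open>Independence is assumed from the second variable on. With no earlier variable the
  claim is the definition of \<open>step_op\<close>.\<close>
proof (cases "k = 0")
  case True
  then show ?thesis by (simp add: step_op_def step_expect_def)
next
  case False
  let ?s = "\<lambda>x::nat \<Rightarrow> real. a * (\<Sum>i<k. x i)"
  define \<phi> where "\<phi> = (\<lambda>x. f (a * (\<Sum>i<k + 1. x i)))"
  have \<phi>: "\<phi> \<in> C_lLip (k + 1)" unfolding \<phi>_def using f p_simps(2) by (rule C_lLip_poly_lipschitz_linear)
  have app: "\<phi> (vec_append k x (\<lambda>_. z)) = f (?s x + a * z)" for x z
    by (simp add: \<phi>_def vec_append_def distrib_left)
  have fa: "(\<lambda>x. \<bar>f x\<bar>) \<in> D" using f by (rule poly_lipschitz_abs)
  have E1: "E (\<lambda>\<omega>. f (y + a * X (Suc k) \<omega>)) = ereal (step_op a f y)" for y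
    using E_X[OF D_affine[OF f], of "Suc k"] by (simp add: step_op_def)
  have E2: "E (\<lambda>\<omega>. \<bar>f (y + a * X (Suc k) \<omega>)\<bar>) = ereal (step_op a (\<lambda>x. \<bar>f x\<bar>) y)" for y
    using E_X[OF D_affine[OF fa], of "Suc k"] by (simp add: step_op_def)
  have int: "(\<lambda>\<omega>. step_op a f (?s (\<lambda>i. X (i + 1) \<omega>))) \<in> integrable_rv"
    "(\<lambda>\<omega>. step_op a (\<lambda>x. \<bar>f x\<bar>) (?s (\<lambda>i. X (i + 1) \<omega>))) \<in> integrable_rv"
    using integrable_sum[OF step_op_D[OF f]] integrable_sum[OF step_op_D[OF fa]] by simp_all
  have "indep_vector H E 1 (\<lambda>_. X (k + 1)) k (\<lambda>j. X (j + 1))"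
    using iid False by (simp add: iid_sequence_def)
  then have "E (\<lambda>\<omega>. \<phi> (vec_append k (\<lambda>i. X (i + 1) \<omega>) (\<lambda>j. X (k + 1) \<omega>)))
      = E (\<lambda>\<omega>. step_op a f (?s (\<lambda>i. X (i + 1) \<omega>)))"
    unfolding indep_vector_def Let_def
    by (elim conjE) (drule bspec[OF _ \<phi>], use int in \<open>simp add: app E1 E2 integrable_rv_def\<close>)
  then have "E (\<lambda>\<omega>. f (a * (\<Sum>i<Suc k. X (Suc i) \<omega>))) = E (\<lambda>\<omega>. step_op a f (a * (\<Sum>i<k. X (Suc i) \<omega>)))"
    by (simp add: app distrib_left)
  then show ?thesis by (simp add: expect_def)
qed

lemma step_op_funpow_D: "f \<in> D \<Longrightarrow> (step_op a ^^ k) f \<in> D"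
  by (induction k) (auto intro: step_op_D)

lemma expect_sum:
  "f \<in> D \<Longrightarrow> expect (\<lambda>\<omega>. f (a * (\<Sum>i<k. X (Suc i) \<omega>))) = (step_op a ^^ k) f 0"
proof (induction k arbitrary: f)
  case (Suc k)
  have "expect (\<lambda>\<omega>. f (a * (\<Sum>i<Suc k. X (Suc i) \<omega>)))
      = expect (\<lambda>\<omega>. step_op a f (a * (\<Sum>i<k. X (Suc i) \<omega>)))"
    by (rule expect_sum_Suc[OF Suc.prems])
  also have "\<dots> = (step_op a ^^ k) (step_op a f) 0"
    by (rule Suc.IH[OF step_op_D[OF Suc.prems]])
  finally show ?case by (simp add: funpow_swap1)
qed simp

lemma D_square: "(\<lambda>x. x\<^sup>2) \<in> D"
  using p_simps by (intro poly_lipschitz_square)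

lemma step_op_mono:
  "f \<in> D \<Longrightarrow> g \<in> D \<Longrightarrow> (\<And>x. f x \<le> g x) \<Longrightarrow> step_op a f y \<le> step_op a g y"
  unfolding step_op_def by (rule step_expect_mono[OF D_affine D_affine])

lemma step_op_add_cmult_le:
  assumes "f \<in> D" "g \<in> D" "0 \<le> c"
  shows "step_op a (\<lambda>x. f x + c * g x) y \<le> step_op a f y + c * step_op a g y"
proof -
  have "step_op a (\<lambda>x. f x + c * g x) y
      \<le> step_expect (\<lambda>h. f (y + a * h)) + step_expect (\<lambda>h. c * g (y + a * h))"
    unfolding step_op_def
    by (rule step_expect_add_le[OF D_affine[OF assms(1)] poly_lipschitz_cmult[OF D_affine[OF assms(2)]]])
  then show ?thesis using assms by (simp add: step_op_def step_expect_cmult D_affine)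
qed

text \<open>The form in which centering is used: the slope \<open>b\<close> is arbitrary and leaves
  no trace in the conclusion.\<close>

lemma step_op_le:
  assumes "f \<in> D" "g \<in> D" "\<And>h. f (y + a * h) \<le> c + b * h + g h"
  shows "step_op a f y \<le> c + step_expect g"
proof -
  have D: "(\<lambda>h. c + b * h) \<in> D" by (intro poly_lipschitz_add poly_lipschitz_const D_linear)
  have "step_op a f y \<le> step_expect (\<lambda>h. (c + b * h) + g h)"
    unfolding step_op_def using assms(3)
    by (rule step_expect_mono[OF D_affine[OF assms(1)] poly_lipschitz_add[OF D assms(2)]])
  also have "\<dots> \<le> step_expect (\<lambda>h. c + b * h) + step_expect g"
    using assms D by (intro step_expect_add_le)
  also have "step_expect (\<lambda>h. c + b * h) = c"
    by (simp add: step_expect_add_const D_linear)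
  finally show ?thesis .
qed

subsection \<open>Uniform integrability of the normalized sums\<close>

lemma D_dist_interval: "(\<lambda>x. max (\<bar>x\<bar> - R) 0 powr p) \<in> D"
  using p_simps by (intro poly_lipschitz_dist_interval_powr)

lemma scaled_square: "0 < n \<Longrightarrow> (1 / sqrt (real n) * h)\<^sup>2 = h\<^sup>2 / real n"
  by (simp add: power_mult_distrib power_divide)

text \<open>Since \<open>n \<ge> 1\<close> and \<open>p \<ge> 2\<close>, the factor
  \<open>n powr (p / 2)\<close> is at least \<open>n\<close>.\<close>

lemma scaled_powr_le:
  assumes "0 < n"
  shows "\<bar>1 / sqrt (real n) * h\<bar> powr p \<le> \<bar>h\<bar> powr p / real n"
proof -
  have "real n = sqrt (real n) powr 2" using assms by (simp add: powr_numeral)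
  also have "\<dots> \<le> sqrt (real n) powr p" using assms p by (intro powr_mono) auto
  finally have "\<bar>h\<bar> powr p / sqrt (real n) powr p \<le> \<bar>h\<bar> powr p / real n"
    using assms by (intro divide_left_mono) auto
  then show ?thesis using assms by (simp add: abs_mult powr_divide)
qed

text \<open>Discrete Gronwall argument: one step multiplies the expectation of \<open>1 + \<bar>y\<bar>\<^sup>p\<close> by at most \<open>1 + c/n\<close>.\<close>

lemma expect_dist_interval_le:
  obtains K where "0 \<le> K" "\<And>R n. 2 \<le> R \<Longrightarrow> 0 < n \<Longrightarrow>
    expect (\<lambda>\<omega>. max (\<bar>1 / sqrt (real n) * (\<Sum>i<n. X (Suc i) \<omega>)\<bar> - R) 0 powr p)
    \<le> K * (1 / R\<^sup>2 + real n * step_expect (\<lambda>h. max (\<bar>1 / sqrt (real n) * h\<bar> powr p - 1 / 2) 0))"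
proof -
  obtain C where C: "0 \<le> C"
    "\<And>R y. 2 \<le> R \<Longrightarrow> \<exists>b. \<forall>h. max (\<bar>y + h\<bar> - R) 0 powr p \<le> max (\<bar>y\<bar> - R) 0 powr p + b * h
       + C * (1 + \<bar>y\<bar> powr p) * (4 / R\<^sup>2 * (h\<^sup>2 + \<bar>h\<bar> powr p) + 2 * max (\<bar>h\<bar> powr p - 1 / 2) 0)"
    "\<And>y. \<exists>b. \<forall>h. \<bar>y + h\<bar> powr p \<le> \<bar>y\<bar> powr p + b * h
       + C * (1 + \<bar>y\<bar> powr p) * (h\<^sup>2 + \<bar>h\<bar> powr p)"
    by (rule dist_interval_powr_step[OF p]) (rule that)
  define m where "m = step_expect (\<lambda>h. h\<^sup>2 + \<bar>h\<bar> powr p)"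
  define V where "V = (\<lambda>y::real. 1 + \<bar>y\<bar> powr p)"
  have Dm: "(\<lambda>h. h\<^sup>2 + \<bar>h\<bar> powr p) \<in> D"
    using p_simps by (intro poly_lipschitz_add D_square D_abs_powr) auto
  have VD: "V \<in> D" unfolding V_def
    using p_simps by (intro poly_lipschitz_add poly_lipschitz_const D_abs_powr) auto
  have V: "1 \<le> V y" for y by (simp add: V_def)
  have m: "0 \<le> m" unfolding m_def
    using step_expect_mono[OF poly_lipschitz_const[of 0] Dm] by simp
  define c where "c = C * m"
  have c: "0 \<le> c" using C m by (simp add: c_def)

  have bound: "expect (\<lambda>\<omega>. max (\<bar>1 / sqrt (real n) * (\<Sum>i<n. X (Suc i) \<omega>)\<bar> - R) 0 powr p)
      \<le> (exp c * C * (4 * m + 2)) * (1 / R\<^sup>2 + real n * step_expect (\<lambda>h. max (\<bar>1 / sqrt (real n) * h\<bar> powr p - 1 / 2) 0))"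
    if R: "2 \<le> R" and n: "0 < n" for R and n :: nat
  proof -
    define a where "a = 1 / sqrt (real n)"
    define f where "f = (\<lambda>x. max (\<bar>x\<bar> - R) 0 powr p)"
    define t where "t = step_expect (\<lambda>h. max (\<bar>a * h\<bar> powr p - 1 / 2) 0)"
    \<comment> \<open>Chosen so that one step raises \<open>f\<close> by at most
      \<open>\<eta> / n * V\<close>, as \<open>Tf\<close> shows. The tail \<open>t\<close> carries
      no factor \<open>1 / n\<close> of its own, hence \<open>real n * t\<close>.\<close>
    define \<eta> where "\<eta> = C * (4 / R\<^sup>2 * m + 2 * (real n * t))"
    have fD: "f \<in> D" unfolding f_def by (rule D_dist_interval)
    have tD: "(\<lambda>h. max (\<bar>a * h\<bar> powr p - 1 / 2) 0) \<in> D"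
    proof -
      have "(\<lambda>h. \<bar>0 + a * h\<bar> powr p - 1 / 2) \<in> D"
        using p_simps by (intro poly_lipschitz_diff poly_lipschitz_const D_affine[where f = "\<lambda>h. \<bar>h\<bar> powr p"] D_abs_powr) auto
      then show ?thesis using poly_lipschitz_max_const by fastforce
    qed
    have t: "0 \<le> t" unfolding t_def
      using step_expect_mono[OF poly_lipschitz_const[of 0] tD] by simp
    have \<eta>: "0 \<le> \<eta>" unfolding \<eta>_def using C(1) m t by simp
    have scaled: "(a * h)\<^sup>2 + \<bar>a * h\<bar> powr p \<le> (h\<^sup>2 + \<bar>h\<bar> powr p) / real n" for h
      unfolding a_def scaled_square[OF n] add_divide_distrib using scaled_powr_le[OF n, of h] by simp
    have TV: "step_op a V y \<le> (1 + c / real n) * V y" for y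
    proof -
      obtain b where b: "\<And>h. \<bar>y + h\<bar> powr p \<le> \<bar>y\<bar> powr p + b * h + C * (1 + \<bar>y\<bar> powr p) * (h\<^sup>2 + \<bar>h\<bar> powr p)"
        using C(3) by blast
      have "step_op a V y \<le> V y + step_expect (\<lambda>h. (C * V y / real n) * (h\<^sup>2 + \<bar>h\<bar> powr p))"
      proof (rule step_op_le[OF VD])
        show "(\<lambda>h. (C * V y / real n) * (h\<^sup>2 + \<bar>h\<bar> powr p)) \<in> D" by (rule poly_lipschitz_cmult[OF Dm])
        fix h
        have "C * V y * ((a * h)\<^sup>2 + \<bar>a * h\<bar> powr p) \<le> C * V y * ((h\<^sup>2 + \<bar>h\<bar> powr p) / real n)"
          using C(1) V[of y] scaled by (intro mult_left_mono mult_nonneg_nonneg) auto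
        then show "V (y + a * h) \<le> V y + (b * a) * h + (C * V y / real n) * (h\<^sup>2 + \<bar>h\<bar> powr p)"
          using b[of "a * h"] by (simp add: V_def mult.assoc)
      qed
      also have "step_expect (\<lambda>h. (C * V y / real n) * (h\<^sup>2 + \<bar>h\<bar> powr p)) = C * V y / real n * m"
        unfolding m_def using C(1) V[of y] by (intro step_expect_cmult Dm) auto
      also have "V y + C * V y / real n * m = (1 + c / real n) * V y"
        using n by (simp add: c_def field_simps)
      finally show ?thesis .
    qed
    have Tf: "step_op a f y \<le> f y + \<eta> / real n * V y" for y
    proof -
      obtain b where b: "\<And>h. max (\<bar>y + h\<bar> - R) 0 powr p \<le> max (\<bar>y\<bar> - R) 0 powr p + b * h
         + C * (1 + \<bar>y\<bar> powr p) * (4 / R\<^sup>2 * (h\<^sup>2 + \<bar>h\<bar> powr p) + 2 * max (\<bar>h\<bar> powr p - 1 / 2) 0)"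
        using C(2)[OF R] by blast
      define g1 where "g1 = (\<lambda>h::real. C * V y * (4 / R\<^sup>2) / real n * (h\<^sup>2 + \<bar>h\<bar> powr p))"
      define g2 where "g2 = (\<lambda>h. C * V y * 2 * max (\<bar>a * h\<bar> powr p - 1 / 2) 0)"
      have g: "g1 \<in> D" "g2 \<in> D" unfolding g1_def g2_def
        by (intro poly_lipschitz_cmult Dm tD)+
      have "step_op a f y \<le> f y + step_expect (\<lambda>h. g1 h + g2 h)"
      proof (rule step_op_le[OF fD poly_lipschitz_add[OF g]])
        fix h
        have "C * V y * (4 / R\<^sup>2) * ((a * h)\<^sup>2 + \<bar>a * h\<bar> powr p) \<le> C * V y * (4 / R\<^sup>2) * ((h\<^sup>2 + \<bar>h\<bar> powr p) / real n)"
          using C(1) V[of y] scaled by (intro mult_left_mono mult_nonneg_nonneg) auto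
        then have le_g1: "C * V y * (4 / R\<^sup>2) * ((a * h)\<^sup>2 + \<bar>a * h\<bar> powr p) \<le> g1 h" by (simp add: g1_def)
        have "f (y + a * h) \<le> f y + b * (a * h)
            + C * V y * (4 / R\<^sup>2 * ((a * h)\<^sup>2 + \<bar>a * h\<bar> powr p) + 2 * max (\<bar>a * h\<bar> powr p - 1 / 2) 0)"
          unfolding f_def V_def by (rule b)
        also have "\<dots> = f y + (b * a) * h + (C * V y * (4 / R\<^sup>2) * ((a * h)\<^sup>2 + \<bar>a * h\<bar> powr p) + g2 h)"
          unfolding g2_def by (simp only: distrib_left mult.assoc)
        also have "\<dots> \<le> f y + (b * a) * h + (g1 h + g2 h)"
          by (intro add_left_mono add_right_mono le_g1)
        finally show "f (y + a * h) \<le> f y + (b * a) * h + (g1 h + g2 h)" .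
      qed
      also have "\<dots> \<le> f y + (step_expect g1 + step_expect g2)"
        by (intro add_left_mono step_expect_add_le g)
      also have "step_expect g1 = C * V y * (4 / R\<^sup>2) / real n * m"
        unfolding g1_def m_def using C(1) V[of y] by (intro step_expect_cmult Dm) auto
      also have "step_expect g2 = C * V y * 2 * t"
        unfolding g2_def t_def using C(1) V[of y] by (intro step_expect_cmult tD) auto
      also have "f y + (C * V y * (4 / R\<^sup>2) / real n * m + C * V y * 2 * t) = f y + \<eta> / real n * V y"
        using n by (simp add: \<eta>_def field_simps)
      finally show ?thesis by simp
    qed
    \<comment> \<open>Each step expands the accumulated error by \<open>1 + c / n\<close>
      (\<open>TV\<close>) and adds a new \<open>\<eta> / n * V\<close> (\<open>Tf\<close>). Bounding
      all \<open>k\<close> contributions by the same power of \<open>1 + c / n\<close> gives the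
      product form.\<close>
    have Tk: "(step_op a ^^ k) f y \<le> f y + real k * (\<eta> / real n) * (1 + c / real n) ^ k * V y" for k y
    proof (induction k arbitrary: y)
      case (Suc k)
      define \<kappa> where "\<kappa> = real k * (\<eta> / real n) * (1 + c / real n) ^ k"
      have \<kappa>: "0 \<le> \<kappa>" using \<eta> c by (simp add: \<kappa>_def)
      have "(step_op a ^^ Suc k) f y = step_op a ((step_op a ^^ k) f) y" by simp
      also have "\<dots> \<le> step_op a (\<lambda>x. f x + \<kappa> * V x) y"
        using Suc.IH fD VD
        by (intro step_op_mono step_op_funpow_D poly_lipschitz_add poly_lipschitz_cmult) (auto simp: \<kappa>_def)
      also have "\<dots> \<le> step_op a f y + \<kappa> * step_op a V y"
        using fD VD \<kappa> by (intro step_op_add_cmult_le)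
      also have "\<dots> \<le> (f y + \<eta> / real n * V y) + \<kappa> * ((1 + c / real n) * V y)"
        using Tf TV \<kappa> by (intro add_mono mult_left_mono)
      also have "\<dots> = f y + (\<eta> / real n * 1 + \<kappa> * (1 + c / real n)) * V y" by (simp add: algebra_simps)
      also have "\<dots> \<le> f y + (\<eta> / real n * (1 + c / real n) ^ Suc k + \<kappa> * (1 + c / real n)) * V y"
        using \<eta> c V[of y]
        by (intro add_left_mono mult_right_mono add_right_mono mult_left_mono one_le_power) auto
      also have "\<eta> / real n * (1 + c / real n) ^ Suc k + \<kappa> * (1 + c / real n)
          = real (Suc k) * (\<eta> / real n) * (1 + c / real n) ^ Suc k"
      proof -
        have "e * (q * P) + r * e * P * q = (1 + r) * e * (q * P)" for e q P r :: real
          by (simp add: algebra_simps)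
        then show ?thesis unfolding \<kappa>_def power_Suc of_nat_Suc .
      qed
      finally show ?case .
    qed (simp add: V_def)
    have "expect (\<lambda>\<omega>. f (a * (\<Sum>i<n. X (Suc i) \<omega>))) = (step_op a ^^ n) f 0"
      by (rule expect_sum[OF fD])
    also have "\<dots> \<le> f 0 + real n * (\<eta> / real n) * (1 + c / real n) ^ n * V 0" by (rule Tk)
    \<comment> \<open>The walk starts at the origin, where \<open>f\<close> is 0 and
      \<open>V\<close> is 1.\<close>
    also have "\<dots> = \<eta> * (1 + c / real n) ^ n" using n R p by (simp add: f_def V_def)
    also have "\<dots> \<le> \<eta> * exp c"
    proof (intro mult_left_mono \<eta> exp_ge_one_plus_x_over_n_power_n n)
      show "- real n \<le> c" using c by linarith
    qed
    also have "\<dots> = exp c * C * (4 / R\<^sup>2 * m + 2 * (real n * t))" by (simp add: \<eta>_def)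
    also have "\<dots> \<le> exp c * C * ((4 * m + 2) * (1 / R\<^sup>2 + real n * t))"
    proof (rule mult_left_mono)
      have "(4 * m + 2) * (1 / R\<^sup>2 + real n * t)
          = 4 / R\<^sup>2 * m + 2 * (real n * t) + (2 / R\<^sup>2 + 4 * (m * (real n * t)))"
        by (simp add: distrib_left distrib_right add_divide_distrib)
      moreover have "0 \<le> 2 / R\<^sup>2 + 4 * (m * (real n * t))" using m t by simp
      ultimately show "4 / R\<^sup>2 * m + 2 * (real n * t) \<le> (4 * m + 2) * (1 / R\<^sup>2 + real n * t)" by linarith
    qed (use C(1) in simp)
    finally show ?thesis unfolding f_def a_def t_def by (simp only: mult.assoc)
  qed
  have "0 \<le> exp c * C * (4 * m + 2)" using C(1) m by simp
  from that[OF this bound] show thesis .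
qed

text \<open>If \<open>\<bar>x\<bar> > 2 * R\<close> then
  \<open>\<bar>x\<bar> \<le> 2 * (\<bar>x\<bar> - R)\<close>. Doubling the radius therefore turns
  the power of the distance into a bound for the excess of the power, at the cost of
  \<open>2 powr p\<close>.\<close>

lemma expect_tail_le:
  obtains K where "0 \<le> K" "\<And>R n. 2 \<le> R \<Longrightarrow> 0 < n \<Longrightarrow>
    expect (\<lambda>\<omega>. max (\<bar>1 / sqrt (real n) * (\<Sum>i<n. X (Suc i) \<omega>)\<bar> powr p - (2 * R) powr p) 0)
    \<le> K * (1 / R\<^sup>2 + real n * step_expect (\<lambda>h. max (\<bar>1 / sqrt (real n) * h\<bar> powr p - 1 / 2) 0))"
proof -
  obtain K where K: "0 \<le> K" "\<And>R n. 2 \<le> R \<Longrightarrow> 0 < n \<Longrightarrow>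
    expect (\<lambda>\<omega>. max (\<bar>1 / sqrt (real n) * (\<Sum>i<n. X (Suc i) \<omega>)\<bar> - R) 0 powr p)
    \<le> K * (1 / R\<^sup>2 + real n * step_expect (\<lambda>h. max (\<bar>1 / sqrt (real n) * h\<bar> powr p - 1 / 2) 0))"
    by (rule expect_dist_interval_le) (rule that)
  have pw: "max (\<bar>x\<bar> powr p - (2 * R) powr p) 0 \<le> 2 powr p * max (\<bar>x\<bar> - R) 0 powr p" if "2 \<le> R" for x R :: real
  proof (cases "\<bar>x\<bar> \<le> 2 * R")
    case True
    then have "\<bar>x\<bar> powr p \<le> (2 * R) powr p" using p_simps by (intro powr_mono2) auto
    then show ?thesis by simp
  next
    case False
    then have "\<bar>x\<bar> powr p \<le> (2 * (\<bar>x\<bar> - R)) powr p" using p_simps by (intro powr_mono2) auto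
    also have "\<dots> = 2 powr p * (\<bar>x\<bar> - R) powr p" by (rule powr_mult)
    finally have "\<bar>x\<bar> powr p \<le> 2 powr p * (\<bar>x\<bar> - R) powr p" .
    moreover have "0 \<le> (2 * R) powr p" by simp
    ultimately have "\<bar>x\<bar> powr p - (2 * R) powr p \<le> 2 powr p * (\<bar>x\<bar> - R) powr p" by linarith
    then show ?thesis using False that by simp
  qed
  have tD: "(\<lambda>x. max (\<bar>x\<bar> powr p - (2 * R) powr p) 0) \<in> D" for R :: real
    using p_simps by (intro poly_lipschitz_max_const poly_lipschitz_diff poly_lipschitz_const D_abs_powr) auto
  have "expect (\<lambda>\<omega>. max (\<bar>1 / sqrt (real n) * (\<Sum>i<n. X (Suc i) \<omega>)\<bar> powr p - (2 * R) powr p) 0)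
    \<le> 2 powr p * K * (1 / R\<^sup>2 + real n * step_expect (\<lambda>h. max (\<bar>1 / sqrt (real n) * h\<bar> powr p - 1 / 2) 0))"
    if "2 \<le> R" "0 < n" for R n
  proof -
    let ?Z = "\<lambda>\<omega>. 1 / sqrt (real n) * (\<Sum>i<n. X (Suc i) \<omega>)"
    have "expect (\<lambda>\<omega>. max (\<bar>?Z \<omega>\<bar> powr p - (2 * R) powr p) 0) \<le> expect (\<lambda>\<omega>. 2 powr p * max (\<bar>?Z \<omega>\<bar> - R) 0 powr p)"
      using pw[OF that(1)]
      by (intro expect_mono integrable_sum[OF tD] integrable_rv_cmult integrable_sum[OF D_dist_interval])
    also have "\<dots> = 2 powr p * expect (\<lambda>\<omega>. max (\<bar>?Z \<omega>\<bar> - R) 0 powr p)"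
      by (intro expect_cmult integrable_sum[OF D_dist_interval]) auto
    also have "\<dots> \<le> 2 powr p * (K * (1 / R\<^sup>2 + real n * step_expect (\<lambda>h. max (\<bar>1 / sqrt (real n) * h\<bar> powr p - 1 / 2) 0)))"
      using K(2)[OF that] by (rule mult_left_mono) simp
    finally show ?thesis by (simp only: mult.assoc)
  qed
  then show thesis using that[of "2 powr p * K"] K(1) by simp
qed

subsection \<open>The dynamic programming operator on bounded Lipschitz functions\<close>

definition upper_var :: real where "upper_var = step_expect (\<lambda>x. x\<^sup>2)"
definition lower_var :: real where "lower_var = - step_expect (\<lambda>x. - x\<^sup>2)"

text \<open>The origin of the equation: \<open>G_fun\<close> is the expectation of a quadratic
  increment. Only nonnegative factors can be pulled out, so the sign of \<beta> decides which of the
  two variances appears.\<close>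

lemma step_expect_cmult_square: "step_expect (\<lambda>x. \<beta> / 2 * x\<^sup>2) = G_fun lower_var upper_var \<beta>"
proof (cases "0 \<le> \<beta>")
  case True
  then show ?thesis using step_expect_cmult[OF D_square, of "\<beta> / 2"] by (simp add: G_fun_def upper_var_def)
next
  case False
  then show ?thesis using step_expect_cmult[OF poly_lipschitz_minus[OF D_square], of "- \<beta> / 2"]
    by (simp add: G_fun_def lower_var_def)
qed

lemma D_square_tail: "(\<lambda>h. max (h\<^sup>2 - c) 0) \<in> D"
  by (intro poly_lipschitz_max_const poly_lipschitz_diff poly_lipschitz_const D_square)

lemma scaled_square_tail:
  assumes "0 < n"
  shows "max ((1 / sqrt (real n) * h)\<^sup>2 - d) 0 = max (h\<^sup>2 - real n * d) 0 / real n"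
  unfolding scaled_square[OF assms] using assms by (simp add: max_def field_simps)

lemma G_fun_scale: "0 < r \<Longrightarrow> G_fun vl vu (\<alpha> / r) = G_fun vl vu \<alpha> / r"
  by (simp add: G_fun_def max_def field_simps)

section \<open>Consistency of the scheme with the equation\<close>

text \<open>The majorant must hold for every \<open>h\<close>, near and far; its tail term gives the
  room that is needed far away. Scaling moves the threshold from \<open>d\<close> to
  \<open>n * d\<close>, so its contribution is o(1/n) once the truncated second moments tend to
  0.\<close>

lemma step_op_consistent_upper:
  assumes f: "f \<in> D" and n: "0 < n" and K: "0 \<le> K"
    and le: "\<And>h. f (y + h) - c \<le> b * h + \<alpha> / 2 * h\<^sup>2 + K * max (h\<^sup>2 - d) 0"
  shows "step_op (1 / sqrt (real n)) f y - c
    \<le> (G_fun lower_var upper_var \<alpha> + K * step_expect (\<lambda>h. max (h\<^sup>2 - real n * d) 0)) / real n"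
proof -
  let ?a = "1 / sqrt (real n)"
  define g1 where "g1 = (\<lambda>h::real. (\<alpha> / real n) / 2 * h\<^sup>2)"
  define g2 where "g2 = (\<lambda>h. (K / real n) * max (h\<^sup>2 - real n * d) 0)"
  have g: "g1 \<in> D" "g2 \<in> D" unfolding g1_def g2_def
    by (intro poly_lipschitz_cmult D_square D_square_tail)+
  have "step_op ?a f y \<le> c + step_expect (\<lambda>h. g1 h + g2 h)"
  proof (rule step_op_le[OF f poly_lipschitz_add[OF g]])
    fix h
    show "f (y + ?a * h) \<le> c + (b * ?a) * h + (g1 h + g2 h)"
      using le[of "?a * h"] unfolding scaled_square_tail[OF n] unfolding scaled_square[OF n] by (simp add: g1_def g2_def)
  qed
  also have "\<dots> \<le> c + (step_expect g1 + step_expect g2)"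
    by (intro add_left_mono step_expect_add_le g)
  also have "step_expect g1 = G_fun lower_var upper_var \<alpha> / real n"
    unfolding g1_def step_expect_cmult_square using n by (simp add: G_fun_scale)
  also have "step_expect g2 = (K / real n) * step_expect (\<lambda>h. max (h\<^sup>2 - real n * d) 0)"
    unfolding g2_def using K by (intro step_expect_cmult D_square_tail) auto
  finally show ?thesis by (simp add: add_divide_distrib)
qed

text \<open>The functional is not odd, so this is no instance of the upper estimate for
  \<open>- f\<close>. The quadratic term is isolated on the smaller side and subadditivity is
  applied to its majorant, which produces the conjugate nonlinearity
  \<open>- G (- \<alpha>)\<close>.\<close>

lemma step_op_consistent_lower:
  assumes f: "f \<in> D" and n: "0 < n" and K: "0 \<le> K"
    and le: "\<And>h. - f (y + h) - c \<le> b * h + \<alpha> / 2 * h\<^sup>2 + K * max (h\<^sup>2 - d) 0"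
  shows "- step_op (1 / sqrt (real n)) f y - c
    \<le> (- G_fun lower_var upper_var (- \<alpha>) + K * step_expect (\<lambda>h. max (h\<^sup>2 - real n * d) 0)) / real n"
proof -
  let ?a = "1 / sqrt (real n)"
  define g1 where "g1 = (\<lambda>h::real. ((- \<alpha>) / real n) / 2 * h\<^sup>2)"
  define g2 where "g2 = (\<lambda>h. (K / real n) * max (h\<^sup>2 - real n * d) 0)"
  define l where "l = (\<lambda>h. c + (b * ?a) * h)"
  define fa where "fa = (\<lambda>h. f (y + ?a * h))"
  have "g1 \<in> D" "g2 \<in> D" unfolding g1_def g2_def
    by (intro poly_lipschitz_cmult D_square D_square_tail)+
  moreover have "l \<in> D" unfolding l_def
    by (intro poly_lipschitz_add poly_lipschitz_const D_linear)
  moreover have "fa \<in> D" unfolding fa_def using f by (rule D_affine)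
  ultimately have D: "g1 \<in> D" "g2 \<in> D" "l \<in> D" "fa \<in> D" .
  have "step_expect g1 \<le> step_expect (\<lambda>h. l h + (fa h + g2 h))"
  proof (rule step_expect_mono)
    fix h
    show "g1 h \<le> l h + (fa h + g2 h)"
      using le[of "?a * h"] unfolding scaled_square_tail[OF n] unfolding scaled_square[OF n]
      by (simp add: g1_def g2_def l_def fa_def)
  qed (intro D poly_lipschitz_add)+
  also have "\<dots> \<le> step_expect l + step_expect (\<lambda>h. fa h + g2 h)"
    by (intro step_expect_add_le poly_lipschitz_add D)
  also have "\<dots> \<le> step_expect l + (step_expect fa + step_expect g2)"
    by (intro add_left_mono step_expect_add_le D)
  also have "step_expect l = c" unfolding l_def by (simp only: step_expect_add_const[OF D_linear] step_expect_linear add_0_right)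
  also have "step_expect fa = step_op ?a f y" by (simp add: fa_def step_op_def)
  also have "step_expect g2 = (K / real n) * step_expect (\<lambda>h. max (h\<^sup>2 - real n * d) 0)"
    unfolding g2_def using K by (intro step_expect_cmult D_square_tail) auto
  also have "step_expect g1 = G_fun lower_var upper_var (- \<alpha>) / real n"
    unfolding g1_def step_expect_cmult_square using n by (subst G_fun_scale) auto
  finally show ?thesis by (simp add: add_divide_distrib diff_divide_distrib)
qed

lemma lipschitz_D: "L-lipschitz_on UNIV f \<Longrightarrow> f \<in> D" for f :: "real \<Rightarrow> real"
  by (rule lipschitz_imp_poly_lipschitz[where L = L]) (auto simp: lipschitz_on_def dist_real_def)

lemma abs_step_op_diff_le:
  assumes "f \<in> D" "g \<in> D" "\<And>h. \<bar>f (y + a * h) - A\<bar> \<le> c + b * h + g h"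
  shows "\<bar>step_op a f y - A\<bar> \<le> c + step_expect g"
proof -
  have D: "(\<lambda>x. \<bar>f x - A\<bar>) \<in> D"
    using assms(1) by (intro poly_lipschitz_abs poly_lipschitz_diff poly_lipschitz_const)
  have "\<bar>step_op a f y - A\<bar> \<le> step_op a (\<lambda>x. \<bar>f x - A\<bar>) y"
    using step_expect_diff_le[OF D_affine[OF assms(1), of y a] poly_lipschitz_const[of A]]
    by (simp add: step_op_def)
  also have "\<dots> \<le> c + step_expect g" by (rule step_op_le[OF D assms(2,3)])
  finally show ?thesis .
qed

section \<open>Bounds, Lipschitz constants and time regularity of the iterates\<close>

lemma step_op_bounded:
  assumes "f \<in> D" "\<And>x. \<bar>f x\<bar> \<le> B"
  shows "\<bar>step_op a f x\<bar> \<le> B"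
  using abs_step_op_diff_le[OF assms(1) poly_lipschitz_const[of 0], of x a 0 B 0] assms(2) by simp

lemma step_op_lipschitz:
  assumes "L-lipschitz_on UNIV f"
  shows "L-lipschitz_on UNIV (step_op a f)"
proof (rule lipschitz_onI)
  fix y z :: real
  have f: "f \<in> D" using assms by (rule lipschitz_D)
  have "\<bar>step_op a f y - step_op a f z\<bar> \<le> step_expect (\<lambda>h. \<bar>f (y + a * h) - f (z + a * h)\<bar>)"
    unfolding step_op_def using f by (intro step_expect_diff_le D_affine)
  also have "\<dots> \<le> step_expect (\<lambda>_. L * \<bar>y - z\<bar>)"
  proof (rule step_expect_mono)
    show "\<bar>f (y + a * h) - f (z + a * h)\<bar> \<le> L * \<bar>y - z\<bar>" for h
      using lipschitz_onD[OF assms, of "y + a * h" "z + a * h"] by (simp add: dist_real_def)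
    show "(\<lambda>h. \<bar>f (y + a * h) - f (z + a * h)\<bar>) \<in> D"
      by (intro poly_lipschitz_abs poly_lipschitz_diff D_affine f)
  qed (rule poly_lipschitz_const)
  finally show "dist (step_op a f y) (step_op a f z) \<le> L * dist y z" by (simp add: dist_real_def)
qed (use assms in \<open>auto simp: lipschitz_on_def\<close>)

lemma step_op_funpow_bounded:
  "f \<in> D \<Longrightarrow> (\<And>x. \<bar>f x\<bar> \<le> B) \<Longrightarrow> \<bar>(step_op a ^^ k) f x\<bar> \<le> B"
  by (induction k arbitrary: x) (auto intro: step_op_bounded step_op_funpow_D)

lemma step_op_funpow_lipschitz: "L-lipschitz_on UNIV f \<Longrightarrow> L-lipschitz_on UNIV ((step_op a ^^ k) f)"
  by (induction k) (auto intro: step_op_lipschitz)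

text \<open>A parabola around \<open>x\<close> rises by only \<open>\<beta> * upper_var / n\<close>
  per step, because the cross term \<open>2 * (y - x) * h\<close> is centered.\<close>

lemma step_op_funpow_diff_le:
  assumes f: "f \<in> D" and n: "0 < n" and \<beta>: "0 \<le> \<beta>" and le: "\<And>y. \<bar>f y - A\<bar> \<le> \<gamma> + \<beta> * (y - x)\<^sup>2"
  shows "\<bar>(step_op (1 / sqrt (real n)) ^^ k) f y - A\<bar> \<le> \<gamma> + \<beta> * ((y - x)\<^sup>2 + real k / real n * upper_var)"
proof (induction k arbitrary: y)
  case 0
  then show ?case using le by simp
next
  case (Suc k)
  let ?a = "1 / sqrt (real n)"
  define c where "c = \<gamma> + \<beta> * ((y - x)\<^sup>2 + real k / real n * upper_var)"
  have "\<bar>step_op ?a ((step_op ?a ^^ k) f) y - A\<bar> \<le> c + step_expect (\<lambda>h. \<beta> / real n * h\<^sup>2)"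
  proof (rule abs_step_op_diff_le[OF step_op_funpow_D[OF f] poly_lipschitz_cmult[OF D_square]])
    fix h
    have e: "(y + ?a * h - x)\<^sup>2 = (y - x)\<^sup>2 + 2 * (y - x) * ?a * h + (?a * h)\<^sup>2"
      by (simp add: power2_eq_square algebra_simps)
    have "\<bar>(step_op ?a ^^ k) f (y + ?a * h) - A\<bar> \<le> \<gamma> + \<beta> * ((y + ?a * h - x)\<^sup>2 + real k / real n * upper_var)"
      by (rule Suc.IH)
    also have "\<dots> = c + (\<beta> * 2 * (y - x) * ?a) * h + \<beta> / real n * h\<^sup>2"
      unfolding e c_def scaled_square[OF n] by (simp add: algebra_simps)
    finally show "\<bar>(step_op ?a ^^ k) f (y + ?a * h) - A\<bar> \<le> c + (\<beta> * 2 * (y - x) * ?a) * h + \<beta> / real n * h\<^sup>2" .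
  qed
  also have "step_expect (\<lambda>h. \<beta> / real n * h\<^sup>2) = \<beta> / real n * upper_var"
    unfolding upper_var_def using \<beta> by (intro step_expect_cmult D_square) auto
  also have "c + \<beta> / real n * upper_var = \<gamma> + \<beta> * ((y - x)\<^sup>2 + real (Suc k) / real n * upper_var)"
    using n by (simp add: c_def field_simps)
  finally show ?case by simp
qed

text \<open>For every \<open>s > 0\<close> a function with Lipschitz constant \<open>L\<close> stays
  within \<open>L * s + L / s * (y - x)\<^sup>2\<close> of its value at \<open>x\<close>.
  Propagating this parabola over \<open>k - l\<close> steps costs elapsed time times
  \<open>L / s * upper_var\<close>.\<close>

lemma step_op_funpow_time_continuity:
  assumes f: "L-lipschitz_on UNIV f" and n: "0 < n" and lk: "l \<le> k"
  shows "\<bar>(step_op (1 / sqrt (real n)) ^^ k) f x - (step_op (1 / sqrt (real n)) ^^ l) f x\<bar>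
    \<le> L * (1 + upper_var) * sqrt ((real k - real l) / real n)"
proof (cases "k = l")
  case False
  let ?T = "step_op (1 / sqrt (real n))"
  define g where "g = (?T ^^ l) f"
  define j where "j = k - l"
  \<comment> \<open>This \<open>s\<close>, the root of the elapsed time, makes both parts of the
    bound proportional to \<open>s\<close>.\<close>
  define s where "s = sqrt (real j / real n)"
  have j: "0 < j" "real j = real k - real l" using False lk by (auto simp: j_def)
  have s: "0 < s" "s\<^sup>2 = real j / real n" using j n by (auto simp: s_def)
  have g: "L-lipschitz_on UNIV g" unfolding g_def by (rule step_op_funpow_lipschitz[OF f])
  have L: "0 \<le> L" using f by (simp add: lipschitz_on_def)
  have "\<bar>g y - g x\<bar> \<le> L * s + (L / s) * (y - x)\<^sup>2" for y
  proof -
    have "\<bar>y - x\<bar> * s \<le> s\<^sup>2 + (y - x)\<^sup>2"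
    proof -
      have "0 \<le> \<bar>y - x\<bar> * s" using s(1) by simp
      moreover have "2 * \<bar>y - x\<bar> * s = 2 * (\<bar>y - x\<bar> * s)" by simp
      ultimately show ?thesis using sum_squares_bound[of "\<bar>y - x\<bar>" s] by (simp only: power2_abs)
    qed
    then have "\<bar>y - x\<bar> \<le> s + (y - x)\<^sup>2 / s" using s(1) by (simp add: field_simps power2_eq_square)
    then have "L * \<bar>y - x\<bar> \<le> L * (s + (y - x)\<^sup>2 / s)" using L by (rule mult_left_mono)
    then show ?thesis using lipschitz_onD[OF g, of y x] by (simp add: dist_real_def distrib_left)
  qed
  then have "\<bar>(?T ^^ j) g x - g x\<bar> \<le> L * s + (L / s) * ((x - x)\<^sup>2 + real j / real n * upper_var)"
    using L s(1) by (intro step_op_funpow_diff_le lipschitz_D[OF g] n) auto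
  also have "\<dots> = L * (1 + upper_var) * s" using s(1) unfolding s(2)[symmetric] by (simp add: field_simps power2_eq_square)
  also have "(?T ^^ j) g = (?T ^^ k) f"
    using lk by (simp add: g_def j_def flip: funpow_add[THEN fun_cong, unfolded o_def])
  finally show ?thesis by (simp add: g_def s_def j(2))
qed simp

end

section \<open>Limits of monotone schemes\<close>

text \<open>The scheme lives on a discrete time grid, so only the space variable calls for a
  compactness argument.\<close>

lemma ex_max_finite_times_compact:
  fixes F :: "'i \<Rightarrow> real \<Rightarrow> real"
  assumes "finite A" "A \<noteq> {}" "compact I" "I \<noteq> {}" "\<And>k. k \<in> A \<Longrightarrow> continuous_on I (F k)"
  obtains k y where "k \<in> A" "y \<in> I" "\<And>k' y'. k' \<in> A \<Longrightarrow> y' \<in> I \<Longrightarrow> F k' y' \<le> F k y"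
proof -
  have "\<forall>k\<in>A. \<exists>y\<in>I. \<forall>y'\<in>I. F k y' \<le> F k y"
    using continuous_attains_sup[OF assms(3,4) assms(5)] by blast
  then obtain Y where Y: "\<And>k. k \<in> A \<Longrightarrow> Y k \<in> I" "\<And>k y'. k \<in> A \<Longrightarrow> y' \<in> I \<Longrightarrow> F k y' \<le> F k (Y k)"
    by metis
  have "Max ((\<lambda>k. F k (Y k)) ` A) \<in> (\<lambda>k. F k (Y k)) ` A"
    using assms by (intro Max_in) auto
  then obtain k where k: "k \<in> A" "Max ((\<lambda>k. F k (Y k)) ` A) = F k (Y k)" by auto
  have "F k' y' \<le> F k (Y k)" if "k' \<in> A" "y' \<in> I" for k' y'
  proof -
    have "F k' (Y k') \<le> Max ((\<lambda>k. F k (Y k)) ` A)" using assms that by (intro Max_ge) auto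
    then show ?thesis using Y(2)[OF that] k by simp
  qed
  then show thesis using that k Y by blast
qed

lemma second_order_upper_bound:
  fixes f f' f'' :: "real \<Rightarrow> real"
  assumes "\<And>z. (f has_real_derivative f' z) (at z)" "\<And>z. (f' has_real_derivative f'' z) (at z)"
    and bound: "\<And>z. \<bar>z - y\<bar> \<le> \<bar>h\<bar> \<Longrightarrow> f'' z \<le> A"
  shows "f (y + h) \<le> f y + f' y * h + A / 2 * h\<^sup>2"
proof (cases "h = 0")
  case False
  define diff where "diff = (\<lambda>m::nat. if m = 0 then f else if m = 1 then f' else f'')"
  have "\<exists>t. (if y + h < y then y + h < t \<and> t < y else y < t \<and> t < y + h) \<and>
     f (y + h) = (\<Sum>m<2. diff m y / fact m * (y + h - y) ^ m) + diff 2 t / fact 2 * (y + h - y) ^ 2"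
  proof (rule Taylor[where a = "y - \<bar>h\<bar>" and b = "y + \<bar>h\<bar>"])
    show "\<forall>m t. m < 2 \<and> y - \<bar>h\<bar> \<le> t \<and> t \<le> y + \<bar>h\<bar> \<longrightarrow> (diff m has_real_derivative diff (Suc m) t) (at t)"
      using assms by (auto simp: diff_def less_2_cases_iff)
  qed (use False in \<open>auto simp: diff_def\<close>)
  then obtain t where t: "if y + h < y then y + h < t \<and> t < y else y < t \<and> t < y + h"
    "f (y + h) = f y + f' y * h + f'' t / 2 * h\<^sup>2"
    by (auto simp: diff_def lessThan_Suc numeral_2_eq_2)
  have "f'' t \<le> A" using t(1) by (intro bound) (auto split: if_splits)
  then have "f'' t / 2 * h\<^sup>2 \<le> A / 2 * h\<^sup>2" by (intro mult_right_mono) auto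
  then show ?thesis using t by simp
qed simp

lemma tendsto_continuous_half_plane:
  assumes "continuous_on ({0<..} \<times> UNIV) (\<lambda>(t, x). f t x)" "0 < (t::real)"
    "(s \<longlongrightarrow> t) F" "(y \<longlongrightarrow> (x::real)) F"
  shows "((\<lambda>j. f (s j) (y j)) \<longlongrightarrow> f t x) F"
proof -
  have "open ({0::real<..} \<times> (UNIV :: real set))" by (intro open_Times) auto
  then have "isCont (\<lambda>(t, x). f t x) (t, x)"
    using assms by (auto simp: continuous_on_eq_continuous_at)
  from isCont_tendsto_compose[OF this tendsto_Pair[OF assms(3,4)]] show ?thesis by simp
qed

lemma strict_local_max_test:
  assumes "C12_test \<psi> \<psi>t \<psi>x \<psi>xx"
  shows "C12_test (\<lambda>s y. \<psi> s y + ((s - t0)\<^sup>2 + (y - x0) ^ 4)) (\<lambda>s y. \<psi>t s y + 2 * (s - t0))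
    (\<lambda>s y. \<psi>x s y + 4 * (y - x0) ^ 3) (\<lambda>s y. \<psi>xx s y + 12 * (y - x0)\<^sup>2)"
  using assms unfolding C12_test_def
  by (auto intro!: derivative_eq_intros continuous_intros simp: case_prod_unfold)

lemma nat_floor_mult_divide_tendsto:
  fixes n :: "nat \<Rightarrow> nat"
  assumes t: "0 \<le> t" and n: "filterlim (\<lambda>j. real (n j)) at_top sequentially"
  shows "(\<lambda>j. real (nat \<lfloor>t * real (n j)\<rfloor>) / real (n j)) \<longlonglongrightarrow> t"
proof (rule tendsto_sandwich)
  have pos: "\<forall>\<^sub>F j in sequentially. 0 < real (n j)"
    using n unfolding filterlim_at_top_dense by (rule spec)
  show "\<forall>\<^sub>F j in sequentially. t - 1 / real (n j) \<le> real (nat \<lfloor>t * real (n j)\<rfloor>) / real (n j)"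
    using pos
  proof eventually_elim
    case (elim j)
    have "t * real (n j) - 1 \<le> real (nat \<lfloor>t * real (n j)\<rfloor>)" by linarith
    then have "(t * real (n j) - 1) / real (n j) \<le> real (nat \<lfloor>t * real (n j)\<rfloor>) / real (n j)"
      using elim by (intro divide_right_mono) auto
    then show ?case using elim by (simp add: diff_divide_distrib)
  qed
  show "\<forall>\<^sub>F j in sequentially. real (nat \<lfloor>t * real (n j)\<rfloor>) / real (n j) \<le> t"
    using pos
  proof eventually_elim
    case (elim j)
    have "0 \<le> t * real (n j)" using t by simp
    then have "real (nat \<lfloor>t * real (n j)\<rfloor>) \<le> t * real (n j)" by linarith
    then show ?case using elim by (simp add: divide_le_eq)
  qed
  have "(\<lambda>j. 1 / real (n j)) \<longlonglongrightarrow> 0"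
    using n by (rule tendsto_divide_0[OF tendsto_const filterlim_at_top_imp_at_infinity])
  then show "(\<lambda>j. t - 1 / real (n j)) \<longlonglongrightarrow> t" using tendsto_diff[OF tendsto_const] by fastforce
qed simp

lemma filterlim_real_strict_mono:
  "strict_mono (r :: nat \<Rightarrow> nat) \<Longrightarrow> filterlim (\<lambda>j. real (r j)) at_top sequentially"
  using filterlim_compose[OF filterlim_real_sequentially filterlim_subseq] .

text \<open>\<open>U n k x\<close> is the scheme with time step \<open>1/n\<close> at time \<open>k/n\<close>.  The test function touching \<open>v\<close> from
  above is made strict by adding \<open>(s - t0)\<^sup>2 + (y - x0)\<^sup>4\<close>, which leaves its relevant derivatives at
  \<open>(t0, x0)\<close> unchanged.  Maxima over the time grid and a compact interval then exist for every \<open>n\<close>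
  and accumulate at \<open>(t0, x0)\<close>.  Far from the maximum only the bound \<open>B\<close> is available; there the
  tail term in \<open>step\<close> absorbs the difference.\<close>

lemma scheme_limit_subsolution:
  fixes U :: "nat \<Rightarrow> nat \<Rightarrow> real \<Rightarrow> real" and N :: "nat \<Rightarrow> nat"
  assumes N: "strict_mono N"
    and bnd: "\<And>n k x. \<bar>U n k x\<bar> \<le> B"
    and cont: "\<And>n k. continuous_on UNIV (U n k)"
    and conv: "\<And>q k y t x. strict_mono q \<Longrightarrow> 0 < t \<Longrightarrow>
      (\<lambda>j. real (k j) / real (N (q j))) \<longlonglongrightarrow> t \<Longrightarrow> y \<longlonglongrightarrow> x \<Longrightarrow>
      (\<lambda>j. U (N (q j)) (k j) (y j)) \<longlonglongrightarrow> v t x"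
    and step: "\<And>n k y c b \<alpha> K d. 0 < n \<Longrightarrow> 0 \<le> K \<Longrightarrow> 0 < d \<Longrightarrow>
      (\<And>h. U n k (y + h) - c \<le> b * h + \<alpha> / 2 * h\<^sup>2 + K * max (h\<^sup>2 - d) 0) \<Longrightarrow>
      U n (Suc k) y - c \<le> (G \<alpha> + K * \<tau> (real n * d)) / real n"
    and tau: "(\<tau> \<longlongrightarrow> 0) at_top"
    and G: "\<And>a. isCont G a"
  shows "viscosity_subsolution G v"
  unfolding viscosity_subsolution_def
proof (intro allI impI)
  fix \<psi> \<psi>t \<psi>x \<psi>xx t0 x0
  assume test: "C12_test \<psi> \<psi>t \<psi>x \<psi>xx" and t0: "(0::real) < t0"
    and ev: "\<forall>\<^sub>F (s, y) in nhds (t0, x0). v s y - \<psi> s y \<le> v t0 x0 - \<psi> t0 x0"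
  define \<theta> where "\<theta> = (\<lambda>s y. \<psi> s y + ((s - t0)\<^sup>2 + (y - x0) ^ 4))"
  define \<theta>t where "\<theta>t = (\<lambda>s y. \<psi>t s y + 2 * (s - t0))"
  define \<theta>x where "\<theta>x = (\<lambda>s y. \<psi>x s y + 4 * (y - x0) ^ 3)"
  define \<theta>xx where "\<theta>xx = (\<lambda>s y. \<psi>xx s y + 12 * (y - x0)\<^sup>2)"
  have C12: "C12_test \<theta> \<theta>t \<theta>x \<theta>xx"
    unfolding \<theta>_def \<theta>t_def \<theta>x_def \<theta>xx_def by (rule strict_local_max_test[OF test])
  then have der: "\<And>s y. 0 < s \<Longrightarrow> ((\<lambda>s. \<theta> s y) has_real_derivative \<theta>t s y) (at s)"
    "\<And>s y. 0 < s \<Longrightarrow> (\<theta> s has_real_derivative \<theta>x s y) (at y)"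
    "\<And>s y. 0 < s \<Longrightarrow> (\<theta>x s has_real_derivative \<theta>xx s y) (at y)"
    and con: "continuous_on ({0<..} \<times> UNIV) (\<lambda>(s, y). \<theta> s y)"
    "continuous_on ({0<..} \<times> UNIV) (\<lambda>(s, y). \<theta>t s y)"
    "continuous_on ({0<..} \<times> UNIV) (\<lambda>(s, y). \<theta>x s y)"
    "continuous_on ({0<..} \<times> UNIV) (\<lambda>(s, y). \<theta>xx s y)"
    by (auto simp: C12_test_def)
  have at0: "\<theta> t0 x0 = \<psi> t0 x0" "\<theta>t t0 x0 = \<psi>t t0 x0" "\<theta>xx t0 x0 = \<psi>xx t0 x0"
    by (auto simp: \<theta>_def \<theta>t_def \<theta>xx_def)

  obtain d where d: "0 < d"
    "\<And>s y. dist (s, y) (t0, x0) < d \<Longrightarrow> v s y - \<psi> s y \<le> v t0 x0 - \<psi> t0 x0"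
    using ev unfolding eventually_nhds_metric by auto
  \<comment> \<open>\<open>d / 3\<close> puts the closed square inside the ball of radius
    \<open>d\<close>, because \<open>2 * \<rho> < d\<close>; \<open>t0 / 2\<close> keeps all times
    positive.\<close>
  define \<rho> where "\<rho> = min (d / 3) (t0 / 2)"
  have \<rho>: "0 < \<rho>" "\<rho> < t0" using d t0 by (auto simp: \<rho>_def)
  have loc: "v s y - \<psi> s y \<le> v t0 x0 - \<psi> t0 x0" if "\<bar>s - t0\<bar> \<le> \<rho>" "\<bar>y - x0\<bar> \<le> \<rho>" for s y
  proof (rule d(2))
    have "dist (s, y) (t0, x0) \<le> \<bar>s - t0\<bar> + \<bar>y - x0\<bar>"
      unfolding dist_Pair_Pair dist_real_def by (rule sqrt_sum_squares_le_sum_abs[THEN order_trans]) simp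
    also have "\<dots> < d" using that d by (simp add: \<rho>_def)
    finally show "dist (s, y) (t0, x0) < d" .
  qed
  define I where "I = {x0 - \<rho>..x0 + \<rho>}"
  have I: "y \<in> I \<longleftrightarrow> \<bar>y - x0\<bar> \<le> \<rho>" for y by (auto simp: I_def)
  define Q where "Q = {t0 - \<rho>..t0 + \<rho>} \<times> I"
  have Q: "compact Q" "Q \<subseteq> {0<..} \<times> UNIV"
    using \<rho> by (auto simp: Q_def I_def intro!: compact_Times)
  have QI: "(s, y) \<in> Q \<longleftrightarrow> \<bar>s - t0\<bar> \<le> \<rho> \<and> \<bar>y - x0\<bar> \<le> \<rho>" for s y by (auto simp: Q_def I_def)
  have N_top: "filterlim (\<lambda>j. real (N j)) at_top sequentially"
    using filterlim_compose[OF filterlim_real_sequentially filterlim_subseq[OF N]] .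
  note floor_conv = nat_floor_mult_divide_tendsto[OF less_imp_le[OF t0]]

  let ?k0 = "\<lambda>j. nat \<lfloor>t0 * real (N j)\<rfloor>"
  have "\<forall>\<^sub>F j in sequentially. dist (real (?k0 j) / real (N j)) t0 < \<rho>"
    using floor_conv[OF N_top] \<rho>(1) by (rule tendstoD)
  moreover have "\<forall>\<^sub>F j in sequentially. 0 < real (N j)"
    using N_top unfolding filterlim_at_top_dense by (rule spec)
  ultimately have "\<forall>\<^sub>F j in sequentially. \<bar>real (?k0 j) / real (N j) - t0\<bar> < \<rho> \<and> 0 < N j"
    by eventually_elim (auto simp: dist_real_def)
  \<comment> \<open>From \<open>J\<close> on the grid has a time within \<rho> of \<open>t0\<close>.
    Shifting all indices by \<open>J\<close> makes the maximum below exist at every index.\<close>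
  then obtain J where J: "\<And>j. J \<le> j \<Longrightarrow> \<bar>real (?k0 j) / real (N j) - t0\<bar> < \<rho>" "\<And>j. J \<le> j \<Longrightarrow> 0 < N j"
    by (auto simp: eventually_sequentially)

  define opt where "opt = (\<lambda>j k y. \<bar>real k / real (N (j + J)) - t0\<bar> \<le> \<rho> \<and> y \<in> I \<and>
      (\<forall>k' y'. \<bar>real k' / real (N (j + J)) - t0\<bar> \<le> \<rho> \<longrightarrow> y' \<in> I \<longrightarrow>
        U (N (j + J)) k' y' - \<theta> (real k' / real (N (j + J))) y'
        \<le> U (N (j + J)) k y - \<theta> (real k / real (N (j + J))) y))"
  have "\<exists>k y. opt j k y" for j
  proof -
    let ?n = "N (j + J)"
    define A where "A = {k. \<bar>real k / real ?n - t0\<bar> \<le> \<rho>}"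
    have n: "0 < ?n" using J(2)[of "j + J"] by simp
    have "A \<subseteq> {..nat \<lceil>(t0 + \<rho>) * real ?n\<rceil>}"
    proof
      fix k assume "k \<in> A"
      then have "real k / real ?n \<le> t0 + \<rho>" by (auto simp: A_def)
      then have "real k \<le> (t0 + \<rho>) * real ?n" using n by (simp add: divide_le_eq)
      then show "k \<in> {..nat \<lceil>(t0 + \<rho>) * real ?n\<rceil>}" unfolding atMost_iff by linarith
    qed
    then have "finite A" by (rule finite_subset) simp
    moreover have "?k0 (j + J) \<in> A" using J(1)[of "j + J"] by (simp add: A_def)
    moreover have "continuous_on I (\<lambda>y. U ?n k y - \<theta> (real k / real ?n) y)" if "k \<in> A" for k
    proof -
      have "0 < real k / real ?n" using that \<rho> unfolding A_def by simp
      then have "continuous_on I (\<theta> (real k / real ?n))"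
        by (intro continuous_at_imp_continuous_on ballI DERIV_isCont[OF der(2)])
      then show ?thesis by (intro continuous_intros continuous_on_subset[OF cont]) auto
    qed
    moreover have "compact I" "I \<noteq> {}" using \<rho> by (auto simp: I_def)
    ultimately obtain k y where "k \<in> A" "y \<in> I" "\<And>k' y'. k' \<in> A \<Longrightarrow> y' \<in> I \<Longrightarrow>
        U ?n k' y' - \<theta> (real k' / real ?n) y' \<le> U ?n k y - \<theta> (real k / real ?n) y"
      using ex_max_finite_times_compact[of A I "\<lambda>k y. U ?n k y - \<theta> (real k / real ?n) y"] by blast
    then show ?thesis unfolding A_def opt_def by blast
  qed
  then obtain kk yy where "\<And>j. opt j (kk j) (yy j)" by metis
  then have kk: "\<bar>real (kk j) / real (N (j + J)) - t0\<bar> \<le> \<rho>" "yy j \<in> I"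
    and kk_max: "\<bar>real k' / real (N (j + J)) - t0\<bar> \<le> \<rho> \<Longrightarrow> y' \<in> I \<Longrightarrow>
        U (N (j + J)) k' y' - \<theta> (real k' / real (N (j + J))) y'
        \<le> U (N (j + J)) (kk j) (yy j) - \<theta> (real (kk j) / real (N (j + J))) (yy j)" for j k' y'
    unfolding opt_def by blast+
  have "\<forall>j. (real (kk j) / real (N (j + J)), yy j) \<in> Q" using kk by (auto simp: QI I)
  then obtain l q where lq: "l \<in> Q" "strict_mono q"
    "((\<lambda>j. (real (kk j) / real (N (j + J)), yy j)) \<circ> q) \<longlonglongrightarrow> l"
    using compact_imp_seq_compact[OF Q(1)] by (elim seq_compactE)
  obtain t1 x1 where l: "l = (t1, x1)" by (cases l)
  define n where "n = (\<lambda>j. N (q j + J))"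
  define k where "k = (\<lambda>j. kk (q j))"
  define y where "y = (\<lambda>j. yy (q j))"
  define s where "s = (\<lambda>j. real (k j) / real (n j))"
  have s1: "s \<longlonglongrightarrow> t1" and y1: "y \<longlonglongrightarrow> x1"
    using tendsto_fst[OF lq(3)] tendsto_snd[OF lq(3)] by (auto simp: s_def k_def n_def y_def l o_def)
  have box1: "\<bar>t1 - t0\<bar> \<le> \<rho>" "\<bar>x1 - x0\<bar> \<le> \<rho>" using lq(1) by (auto simp: l QI)
  have t1: "0 < t1" using box1 \<rho> by linarith
  have q': "strict_mono (\<lambda>j. q j + J)" using lq(2) by (simp add: strict_mono_def)
  have n_top: "filterlim (\<lambda>j. real (n j)) at_top sequentially"
    unfolding n_def using filterlim_compose[OF N_top filterlim_subseq[OF q']] .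
  have n_pos: "0 < n j" for j using J(2) by (simp add: n_def)
  have box: "\<bar>s j - t0\<bar> \<le> \<rho>" "y j \<in> I" for j
    using kk by (auto simp: s_def k_def n_def y_def)
  have maxi: "U (n j) k' y' - \<theta> (real k' / real (n j)) y' \<le> U (n j) (k j) (y j) - \<theta> (s j) (y j)"
    if "\<bar>real k' / real (n j) - t0\<bar> \<le> \<rho>" "y' \<in> I" for j k' y'
    using kk_max[of k' "q j" y'] that by (simp add: s_def k_def n_def y_def)
  have inv_n: "(\<lambda>j. 1 / real (n j)) \<longlonglongrightarrow> 0"
    using n_top by (rule tendsto_divide_0[OF tendsto_const filterlim_at_top_imp_at_infinity])

  \<comment> \<open>The maximum is at least the value at \<open>x0\<close> and the grid time next to
    \<open>t0\<close>. Passing to the limit and comparing with the local maximality of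
    \<open>v - \<psi>\<close> forces the added penalty to vanish at \<open>(t1, x1)\<close>.\<close>
  have t1x1: "t1 = t0" "x1 = x0"
  proof -
    let ?k = "\<lambda>j. nat \<lfloor>t0 * real (n j)\<rfloor>"
    have x0: "x0 \<in> I" using \<rho> by (simp add: I)
    have c0: "(\<lambda>j. real (?k j) / real (n j)) \<longlonglongrightarrow> t0" by (rule floor_conv[OF n_top])
    have "(\<lambda>j. U (n j) (?k j) x0 - \<theta> (real (?k j) / real (n j)) x0) \<longlonglongrightarrow> v t0 x0 - \<theta> t0 x0"
      using conv[OF q' t0 c0[unfolded n_def] tendsto_const, of x0]
      by (intro tendsto_diff tendsto_continuous_half_plane[OF con(1) t0 c0 tendsto_const]) (simp add: n_def)
    moreover have "(\<lambda>j. U (n j) (k j) (y j) - \<theta> (s j) (y j)) \<longlonglongrightarrow> v t1 x1 - \<theta> t1 x1"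
      using conv[OF q' t1 s1[unfolded s_def n_def] y1]
      by (intro tendsto_diff tendsto_continuous_half_plane[OF con(1) t1 s1 y1]) (simp add: n_def)
    moreover have "U (n j) (?k j) x0 - \<theta> (real (?k j) / real (n j)) x0 \<le> U (n j) (k j) (y j) - \<theta> (s j) (y j)" for j
      using J(1)[of "q j + J"] x0 by (intro maxi) (auto simp: n_def)
    ultimately have "v t0 x0 - \<theta> t0 x0 \<le> v t1 x1 - \<theta> t1 x1"
      by (intro LIMSEQ_le) auto
    then have "(t1 - t0)\<^sup>2 + (x1 - x0) ^ 4 \<le> 0"
      using loc[OF box1] by (simp add: at0 \<theta>_def)
    moreover have "0 \<le> (t1 - t0)\<^sup>2" "0 \<le> (x1 - x0) ^ 4" by auto
    ultimately have "(t1 - t0)\<^sup>2 = 0" "(x1 - x0) ^ 4 = 0" by linarith+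
    then show "t1 = t0" "x1 = x0" by auto
  qed
  note s0 = s1[unfolded t1x1] and y0 = y1[unfolded t1x1]
  \<comment> \<open>\<open>r j\<close> is the grid time one step before the maximum, from which the
    scheme passes to \<open>s j\<close>.\<close>
  define r where "r = (\<lambda>j. s j - 1 / real (n j))"
  have r0: "r \<longlonglongrightarrow> t0" unfolding r_def using tendsto_diff[OF s0 inv_n] by simp

  define a where "a = \<psi>xx t0 x0"
  have "bounded ((\<lambda>(s, y). \<theta> s y) ` Q)" "bounded ((\<lambda>(s, y). \<theta>x s y) ` Q)"
    using Q con by (auto intro!: compact_imp_bounded compact_continuous_image intro: continuous_on_subset)
  then obtain C0 C1 where C01: "\<And>z. z \<in> Q \<Longrightarrow> \<bar>(\<lambda>(s, y). \<theta> s y) z\<bar> \<le> C0" "\<And>z. z \<in> Q \<Longrightarrow> \<bar>(\<lambda>(s, y). \<theta>x s y) z\<bar> \<le> C1"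
    unfolding bounded_iff by fastforce
  have C0: "\<bar>\<theta> s y\<bar> \<le> C0" and C1: "\<bar>\<theta>x s y\<bar> \<le> C1" if "\<bar>s - t0\<bar> \<le> \<rho>" "\<bar>y - x0\<bar> \<le> \<rho>" for s y
    using C01[of "(s, y)"] that by (auto simp: QI)

  have claim: "\<psi>t t0 x0 \<le> G (a + \<epsilon>) + \<epsilon>" if \<epsilon>: "0 < \<epsilon>" for \<epsilon>
  proof -
    have "(\<lambda>z. \<theta>xx (fst z) (snd z)) \<midarrow>(t0, x0)\<rightarrow> \<theta>xx t0 x0"
      by (intro tendsto_continuous_half_plane[OF con(4) t0]) (auto intro!: tendsto_eq_intros)
    then have "\<forall>\<^sub>F z in at (t0, x0). \<theta>xx (fst z) (snd z) < a + \<epsilon>"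
      using \<epsilon> by (intro order_tendstoD) (auto simp: at0 a_def)
    moreover have "(\<lambda>z. \<theta>t (fst z) (snd z)) \<midarrow>(t0, x0)\<rightarrow> \<theta>t t0 x0"
      by (intro tendsto_continuous_half_plane[OF con(2) t0]) (auto intro!: tendsto_eq_intros)
    then have "\<forall>\<^sub>F z in at (t0, x0). \<psi>t t0 x0 - \<epsilon> < \<theta>t (fst z) (snd z)"
      using \<epsilon> by (intro order_tendstoD) (auto simp: at0)
    ultimately have "\<forall>\<^sub>F z in at (t0, x0). \<theta>xx (fst z) (snd z) < a + \<epsilon> \<and> \<psi>t t0 x0 - \<epsilon> < \<theta>t (fst z) (snd z)"
      by (rule eventually_conj)
    then have "\<forall>\<^sub>F z in nhds (t0, x0). \<theta>xx (fst z) (snd z) < a + \<epsilon> \<and> \<psi>t t0 x0 - \<epsilon> < \<theta>t (fst z) (snd z)"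
      using \<epsilon> by (auto simp: eventually_nhds_conv_at at0 a_def)
    then obtain d1 where d1: "0 < d1" "\<And>s y. dist (s, y) (t0, x0) < d1 \<Longrightarrow>
        \<theta>xx s y < a + \<epsilon> \<and> \<psi>t t0 x0 - \<epsilon> < \<theta>t s y"
      unfolding eventually_nhds_metric by auto
    define \<delta> where "\<delta> = min (d1 / 6) (\<rho> / 2)"
    have \<delta>: "0 < \<delta>" "2 * \<delta> \<le> \<rho>" using d1 \<rho> by (auto simp: \<delta>_def)
    have near: "\<theta>xx s y < a + \<epsilon>" "\<psi>t t0 x0 - \<epsilon> < \<theta>t s y"
      if "\<bar>s - t0\<bar> \<le> 2 * \<delta>" "\<bar>y - x0\<bar> \<le> 2 * \<delta>" for s y
    proof -
      have "dist (s, y) (t0, x0) \<le> \<bar>s - t0\<bar> + \<bar>y - x0\<bar>"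
        unfolding dist_Pair_Pair dist_real_def by (rule sqrt_sum_squares_le_sum_abs[THEN order_trans]) simp
      also have "\<dots> < d1" using that d1 by (simp add: \<delta>_def)
      finally show "\<theta>xx s y < a + \<epsilon>" "\<psi>t t0 x0 - \<epsilon> < \<theta>t s y" using d1(2) by auto
    qed
    \<comment> \<open>For \<open>\<bar>h\<bar> \<ge> \<delta>\<close> the three summands pay for the
      oscillation of \<open>U\<close> and \<theta>, for the slope and for the quadratic term. The
      factor 2 is due to
      \<open>h\<^sup>2 - \<delta>\<^sup>2 / 2 \<ge> h\<^sup>2 / 2\<close>.\<close>
    define K where "K = 2 * ((2 * B + 2 * C0) / \<delta>\<^sup>2 + C1 / \<delta> + \<bar>a + \<epsilon>\<bar> / 2)"
    have B: "0 \<le> B" using bnd[of 0 0 0] by linarith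
    have C: "0 \<le> C0" "0 \<le> C1" using C0[of t0 x0] C1[of t0 x0] \<rho> by auto
    have K: "0 \<le> K" unfolding K_def using B C \<delta> by (intro mult_nonneg_nonneg add_nonneg_nonneg divide_nonneg_nonneg) auto
    have "\<forall>\<^sub>F j in sequentially. dist (s j) t0 < \<delta>" "\<forall>\<^sub>F j in sequentially. dist (r j) t0 < \<delta>"
      "\<forall>\<^sub>F j in sequentially. dist (y j) x0 < \<delta>"
      using tendstoD[OF s0 \<delta>(1)] tendstoD[OF r0 \<delta>(1)] tendstoD[OF y0 \<delta>(1)] .
    then have "\<forall>\<^sub>F j in sequentially. \<psi>t t0 x0 - \<epsilon> \<le> G (a + \<epsilon>) + K * \<tau> (real (n j) * (\<delta>\<^sup>2 / 2))"
    proof eventually_elim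
      case (elim j)
      then have sj: "\<bar>s j - t0\<bar> < \<delta>" and rj: "\<bar>r j - t0\<bar> < \<delta>" and yj: "\<bar>y j - x0\<bar> < \<delta>"
        by (auto simp: dist_real_def)
      have pos: "0 < s j" "0 < r j" using sj rj \<delta> \<rho> by linarith+
      have nj: "0 < real (n j)" using n_pos[of j] by simp
      have kj: "k j \<noteq> 0" using pos by (intro notI) (simp add: s_def)
      then have r_eq: "r j = real (k j - 1) / real (n j)"
        using nj by (simp add: r_def s_def of_nat_diff field_simps)
      \<comment> \<open>With this centre value, maximality bounds \<open>U\<close> at the previous
        time minus \<open>c\<close> by the spatial increment of \<theta> at time \<open>r j\<close>,
        while \<open>U\<close> at the maximum minus \<open>c\<close> is exactly the time increment
        of \<theta>.\<close>
      define c where "c = U (n j) (k j) (y j) - \<theta> (s j) (y j) + \<theta> (r j) (y j)"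
      have "U (n j) (k j - 1) (y j + h) - c
          \<le> \<theta>x (r j) (y j) * h + (a + \<epsilon>) / 2 * h\<^sup>2 + K * max (h\<^sup>2 - \<delta>\<^sup>2 / 2) 0" for h
      proof (cases "\<bar>h\<bar> < \<delta>")
        case True
        have "U (n j) (k j - 1) (y j + h) - \<theta> (r j) (y j + h) \<le> U (n j) (k j) (y j) - \<theta> (s j) (y j)"
          using maxi[of "k j - 1" j "y j + h"] rj yj True \<delta> by (simp add: r_eq I)
        moreover have "\<theta> (r j) (y j + h) \<le> \<theta> (r j) (y j) + \<theta>x (r j) (y j) * h + (a + \<epsilon>) / 2 * h\<^sup>2"
        proof (rule second_order_upper_bound)
          show "\<theta>xx (r j) z \<le> a + \<epsilon>" if "\<bar>z - y j\<bar> \<le> \<bar>h\<bar>" for z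
            using rj yj True that \<delta> by (intro less_imp_le near) auto
        qed (use pos der in auto)
        moreover have "0 \<le> K * max (h\<^sup>2 - \<delta>\<^sup>2 / 2) 0" using K by simp
        ultimately show ?thesis unfolding c_def by linarith
      next
        case False
        then have h: "\<delta> \<le> \<bar>h\<bar>" by simp
        have h2: "\<delta>\<^sup>2 \<le> h\<^sup>2" using power_mono[OF h, of 2] \<delta> by simp
        have "\<bar>\<theta> (s j) (y j)\<bar> \<le> C0" "\<bar>\<theta> (r j) (y j)\<bar> \<le> C0" "\<bar>\<theta>x (r j) (y j)\<bar> \<le> C1"
          using sj rj yj \<delta> by (auto intro!: C0 C1)
        moreover have "\<bar>U (n j) (k j - 1) (y j + h)\<bar> \<le> B" "\<bar>U (n j) (k j) (y j)\<bar> \<le> B" by (rule bnd)+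
        ultimately have 1: "U (n j) (k j - 1) (y j + h) - c \<le> 2 * B + 2 * C0" and
          c1: "\<bar>\<theta>x (r j) (y j)\<bar> \<le> C1" unfolding c_def by linarith+
        have 2: "2 * B + 2 * C0 \<le> (2 * B + 2 * C0) / \<delta>\<^sup>2 * h\<^sup>2"
          using mult_left_mono[OF h2, of "2 * B + 2 * C0"] \<delta> B C by (simp add: field_simps)
        have 3: "- (\<theta>x (r j) (y j) * h) \<le> C1 / \<delta> * h\<^sup>2"
        proof -
          have "- (\<theta>x (r j) (y j) * h) \<le> \<bar>\<theta>x (r j) (y j)\<bar> * \<bar>h\<bar>" by (metis abs_ge_minus_self abs_mult)
          also have "\<dots> \<le> C1 * \<bar>h\<bar>" using c1 by (intro mult_right_mono) auto
          also have "\<dots> \<le> C1 * (h\<^sup>2 / \<delta>)"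
          proof (intro mult_left_mono C(2))
            have "\<bar>h\<bar> * \<delta> \<le> \<bar>h\<bar> * \<bar>h\<bar>" using h by (intro mult_left_mono) auto
            then show "\<bar>h\<bar> \<le> h\<^sup>2 / \<delta>" using \<delta> by (simp add: field_simps power2_eq_square)
          qed
          finally show ?thesis by simp
        qed
        have 4: "- ((a + \<epsilon>) / 2 * h\<^sup>2) \<le> \<bar>a + \<epsilon>\<bar> / 2 * h\<^sup>2"
          by (metis abs_ge_minus_self abs_divide abs_numeral minus_mult_left minus_divide_left mult_right_mono zero_le_power2)
        have "K * (h\<^sup>2 / 2) \<le> K * max (h\<^sup>2 - \<delta>\<^sup>2 / 2) 0"
        proof (intro mult_left_mono K)
          show "h\<^sup>2 / 2 \<le> max (h\<^sup>2 - \<delta>\<^sup>2 / 2) 0" using h2 by linarith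
        qed
        moreover have "K * (h\<^sup>2 / 2) = (2 * B + 2 * C0) / \<delta>\<^sup>2 * h\<^sup>2 + C1 / \<delta> * h\<^sup>2 + \<bar>a + \<epsilon>\<bar> / 2 * h\<^sup>2"
          unfolding K_def by (simp only: distrib_right mult.assoc) (simp add: distrib_left mult_ac)
        ultimately show ?thesis using 1 2 3 4 by linarith
      qed
      then have "U (n j) (Suc (k j - 1)) (y j) - c \<le> (G (a + \<epsilon>) + K * \<tau> (real (n j) * (\<delta>\<^sup>2 / 2))) / real (n j)"
        using K \<delta> n_pos by (intro step) auto
      then have up: "\<theta> (s j) (y j) - \<theta> (r j) (y j) \<le> (G (a + \<epsilon>) + K * \<tau> (real (n j) * (\<delta>\<^sup>2 / 2))) / real (n j)"
        using kj by (simp add: c_def)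
      have "r j < s j" using nj by (simp add: r_def)
      \<comment> \<open>As \<open>s j - r j = 1 / n j\<close>, the mean value theorem turns the
        bound on the time increment into one on a time derivative.\<close>
      then obtain \<sigma> where \<sigma>: "r j < \<sigma>" "\<sigma> < s j" "\<theta> (s j) (y j) - \<theta> (r j) (y j) = (s j - r j) * \<theta>t \<sigma> (y j)"
        using MVT2[of "r j" "s j" "\<lambda>s. \<theta> s (y j)" "\<lambda>s. \<theta>t s (y j)"] der(1) pos by force
      have "\<psi>t t0 x0 - \<epsilon> < \<theta>t \<sigma> (y j)" using \<sigma> sj rj yj \<delta> by (intro near) auto
      moreover have "\<theta>t \<sigma> (y j) \<le> G (a + \<epsilon>) + K * \<tau> (real (n j) * (\<delta>\<^sup>2 / 2))"
        using up \<sigma>(3) nj by (simp add: r_def divide_le_cancel)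
      ultimately show ?case by simp
    qed
    moreover have "(\<lambda>j. G (a + \<epsilon>) + K * \<tau> (real (n j) * (\<delta>\<^sup>2 / 2))) \<longlonglongrightarrow> G (a + \<epsilon>) + K * 0"
    proof (intro tendsto_intros filterlim_compose[OF tau])
      show "filterlim (\<lambda>j. real (n j) * (\<delta>\<^sup>2 / 2)) at_top sequentially"
        using n_top \<delta> by (intro filterlim_at_top_mult_tendsto_pos[OF tendsto_const]) auto
    qed
    ultimately have "\<psi>t t0 x0 - \<epsilon> \<le> G (a + \<epsilon>) + K * 0"
      by (intro tendsto_lowerbound) auto
    then show ?thesis by simp
  qed
  \<comment> \<open>Continuity of \<open>G\<close> removes the margin \<epsilon> left in both
    derivatives.\<close>
  have "((\<lambda>\<epsilon>. G (a + \<epsilon>) + \<epsilon>) \<longlongrightarrow> G (a + 0) + 0) (at_right 0)"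
    using G by (intro tendsto_intros isCont_tendsto_compose[of _ G]) auto
  moreover have "\<forall>\<^sub>F \<epsilon> in at_right 0. \<psi>t t0 x0 \<le> G (a + \<epsilon>) + \<epsilon>"
    using claim by (auto simp: eventually_at_right_field intro!: exI[of _ 1])
  ultimately have "\<psi>t t0 x0 \<le> G (a + 0) + 0"
    by (intro tendsto_lowerbound[of "\<lambda>\<epsilon>. G (a + \<epsilon>) + \<epsilon>" _ "at_right 0"]) auto
  then show "\<psi>t t0 x0 - G (\<psi>xx t0 x0) \<le> 0" by (simp add: a_def)
qed

text \<open>Reflecting \<open>v\<close> and the test functions exchanges the two notions and
  replaces \<open>G\<close> by its conjugate, so a single limit theorem for subsolutions covers both
  halves.\<close>

lemma viscosity_supersolution_iff:
  "viscosity_supersolution G v \<longleftrightarrow> viscosity_subsolution (\<lambda>\<alpha>. - G (- \<alpha>)) (\<lambda>t x. - v t x)"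
proof -
  have neg: "C12_test (\<lambda>t x. - \<psi> t x) (\<lambda>t x. - \<psi>t t x) (\<lambda>t x. - \<psi>x t x) (\<lambda>t x. - \<psi>xx t x)"
    if "C12_test \<psi> \<psi>t \<psi>x \<psi>xx" for \<psi> \<psi>t \<psi>x \<psi>xx
    using that unfolding C12_test_def
    by (auto intro!: derivative_intros continuous_intros simp: case_prod_unfold)
  show ?thesis
  proof
    assume super: "viscosity_supersolution G v"
    show "viscosity_subsolution (\<lambda>\<alpha>. - G (- \<alpha>)) (\<lambda>t x. - v t x)"
      unfolding viscosity_subsolution_def
    proof (intro allI impI)
      fix \<psi> \<psi>t \<psi>x \<psi>xx t x
      assume "C12_test \<psi> \<psi>t \<psi>x \<psi>xx" "0 < t"
        "\<forall>\<^sub>F (s, y) in nhds (t, x). - v s y - \<psi> s y \<le> - v t x - \<psi> t x"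
      then show "\<psi>t t x - - G (- \<psi>xx t x) \<le> 0"
        using super[unfolded viscosity_supersolution_def, rule_format, OF neg, of \<psi> \<psi>t \<psi>x \<psi>xx t x]
        by (simp add: algebra_simps)
    qed
  next
    assume sub: "viscosity_subsolution (\<lambda>\<alpha>. - G (- \<alpha>)) (\<lambda>t x. - v t x)"
    show "viscosity_supersolution G v"
      unfolding viscosity_supersolution_def
    proof (intro allI impI)
      fix \<psi> \<psi>t \<psi>x \<psi>xx t x
      assume "C12_test \<psi> \<psi>t \<psi>x \<psi>xx" "0 < t"
        "\<forall>\<^sub>F (s, y) in nhds (t, x). v t x - \<psi> t x \<le> v s y - \<psi> s y"
      then show "0 \<le> \<psi>t t x - G (\<psi>xx t x)"
        using sub[unfolded viscosity_subsolution_def, rule_format, OF neg, of \<psi> \<psi>t \<psi>x \<psi>xx t x]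
        by (simp add: algebra_simps)
    qed
  qed
qed

section \<open>Compactness of the family of schemes\<close>

lemma scheme_modulus:
  fixes U :: "nat \<Rightarrow> nat \<Rightarrow> real \<Rightarrow> real"
  assumes lip: "\<And>n k x y. \<bar>U n k x - U n k y\<bar> \<le> L * \<bar>x - y\<bar>"
    and time: "\<And>n k l x. 0 < n \<Longrightarrow> l \<le> k \<Longrightarrow> \<bar>U n k x - U n l x\<bar> \<le> K * sqrt ((real k - real l) / real n)"
    and n: "0 < n"
  shows "\<bar>U n k x - U n l y\<bar> \<le> L * \<bar>x - y\<bar> + K * sqrt \<bar>real k / real n - real l / real n\<bar>"
proof -
  have "\<bar>U n k y - U n l y\<bar> \<le> K * sqrt \<bar>real k / real n - real l / real n\<bar>"
  proof (cases "l \<le> k")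
    case True
    then have "(real k - real l) / real n = \<bar>real k / real n - real l / real n\<bar>"
      by (simp add: diff_divide_distrib[symmetric])
    then show ?thesis using time[OF n True, of y] by simp
  next
    case False
    then have "(real l - real k) / real n = \<bar>real k / real n - real l / real n\<bar>"
      by (simp add: diff_divide_distrib[symmetric] abs_if divide_less_0_iff minus_divide_left)
    then show ?thesis using time[OF n, of k l y] False by (simp add: abs_minus_commute)
  qed
  then show ?thesis using lip[of n k x y] by linarith
qed

text \<open>An Arzela-Ascoli argument for functions on grids that change with \<open>n\<close>: a
  diagonal subsequence converges at the points of a countable dense set, and the common modulus
  extends this to all points. Convergence is stated along further subsequences and moving points
  because the maximizers in the viscosity argument move.\<close>

lemma scheme_convergent_subsequence:
  fixes U :: "nat \<Rightarrow> nat \<Rightarrow> real \<Rightarrow> real" and r :: "nat \<Rightarrow> nat"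
  assumes r: "strict_mono r"
    and bnd: "\<And>n k x. \<bar>U n k x\<bar> \<le> B"
    and lip: "\<And>n k x y. \<bar>U n k x - U n k y\<bar> \<le> L * \<bar>x - y\<bar>"
    and time: "\<And>n k l x. 0 < n \<Longrightarrow> l \<le> k \<Longrightarrow> \<bar>U n k x - U n l x\<bar> \<le> K * sqrt ((real k - real l) / real n)"
  obtains s :: "nat \<Rightarrow> nat" and v where "strict_mono s"
    "\<And>q k y t x. strict_mono q \<Longrightarrow> 0 \<le> t \<Longrightarrow>
      (\<lambda>j. real (k j) / real (r (s (q j)))) \<longlonglongrightarrow> t \<Longrightarrow> y \<longlonglongrightarrow> x \<Longrightarrow>
      (\<lambda>j. U (r (s (q j))) (k j) (y j)) \<longlonglongrightarrow> v t x"
    "\<And>t t' x x'. 0 \<le> t \<Longrightarrow> 0 \<le> t' \<Longrightarrow> \<bar>v t x - v t' x'\<bar> \<le> L * \<bar>x - x'\<bar> + K * sqrt \<bar>t - t'\<bar>"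
proof -
  define w where "w = (\<lambda>n t x. U n (nat \<lfloor>t * real n\<rfloor>) x)"
  define S where "S = ((\<rat> \<inter> {0..}) \<times> \<rat> :: (real \<times> real) set)"
  have "countable S" unfolding S_def by (intro countable_SIGMA countable_Int1 countable_rat)
  then obtain s where s: "strict_mono (s :: nat \<Rightarrow> nat)"
    "\<And>z. z \<in> S \<Longrightarrow> \<exists>l. (\<lambda>j. w (r (s j)) (fst z) (snd z)) \<longlonglongrightarrow> l"
    by (rule function_convergent_subsequence[of S "\<lambda>j z. w (r j) (fst z) (snd z)" B])
       (auto simp: w_def bnd)
  have rs: "strict_mono (\<lambda>j. r (s j))" using strict_mono_o[OF r s(1)] by (simp add: o_def)
  have rs_pos: "\<forall>\<^sub>F j in sequentially. 0 < r (s (q j))" if "strict_mono q" for q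
    using filterlim_real_strict_mono[OF strict_mono_o[OF rs that]]
    unfolding filterlim_at_top_dense by (auto simp: o_def dest!: spec[of _ 0])
  have bound: "(\<lambda>j. L * \<bar>y j - y' j\<bar> + K * sqrt \<bar>a j - a' j\<bar>) \<longlonglongrightarrow> L * \<bar>x - x'\<bar> + K * sqrt \<bar>t - t'\<bar>"
    if "y \<longlonglongrightarrow> x" "y' \<longlonglongrightarrow> x'" "a \<longlonglongrightarrow> t" "a' \<longlonglongrightarrow> t'" for y y' a a' x x' t t'
    using that by (intro tendsto_intros)
  note close = scheme_modulus[of U L K, OF lip time]
  have floor: "(\<lambda>j. real (nat \<lfloor>t * real (r (s (q j)))\<rfloor>) / real (r (s (q j)))) \<longlonglongrightarrow> t"
    if "0 \<le> t" "strict_mono q" for t q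
    using nat_floor_mult_divide_tendsto[OF that(1), of "\<lambda>j. r (s (q j))"]
      filterlim_real_strict_mono[OF strict_mono_o[OF rs that(2)]] by (simp add: o_def)
  have id: "strict_mono (\<lambda>j::nat. j)" by (simp add: strict_mono_def)
  have conv: "convergent (\<lambda>j. w (r (s j)) t x)" if t: "0 \<le> t" for t x
  proof (rule Cauchy_convergent, rule metric_CauchyI)
    fix e :: real assume e: "0 < e"
    have "\<exists>t' x'. (t', x') \<in> S \<and> L * \<bar>x - x'\<bar> + K * sqrt \<bar>t - t'\<bar> < e / 3"
    proof -
      \<comment> \<open>Either term of the modulus becomes at most \<open>e / 12\<close>, so their
        sum stays below \<open>e / 3\<close>; the added 1 avoids division by 0.\<close>
      define \<delta> where "\<delta> = min (e / (12 * (\<bar>L\<bar> + 1))) ((e / (12 * (\<bar>K\<bar> + 1)))\<^sup>2)"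
      have \<delta>: "0 < \<delta>" using e by (simp add: \<delta>_def)
      have cancel: "(\<bar>a\<bar> + 1) * (e / (12 * (\<bar>a\<bar> + 1))) = e / 12" for a :: real
      proof -
        have "c * (e / (12 * c)) = e / 12" if "c \<noteq> 0" for c using that by simp
        moreover have "\<bar>a\<bar> + 1 \<noteq> 0" by linarith
        ultimately show ?thesis by blast
      qed
      \<comment> \<open>Taking \<open>t'\<close> above \<open>t\<close> keeps it nonnegative and
        hence in the time range of \<open>S\<close>.\<close>
      obtain t' where t': "t' \<in> \<rat>" "t < t'" "t' < t + \<delta>" using Rats_dense_in_real[of t "t + \<delta>"] \<delta> by auto
      obtain x' where x': "x' \<in> \<rat>" "x < x'" "x' < x + \<delta>" using Rats_dense_in_real[of x "x + \<delta>"] \<delta> by auto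
      have "L * \<bar>x - x'\<bar> \<le> (\<bar>L\<bar> + 1) * (e / (12 * (\<bar>L\<bar> + 1)))"
        using x' by (intro mult_mono) (auto simp: \<delta>_def)
      then have 1: "L * \<bar>x - x'\<bar> \<le> e / 12" by (simp only: cancel)
      have "sqrt \<bar>t - t'\<bar> \<le> sqrt ((e / (12 * (\<bar>K\<bar> + 1)))\<^sup>2)"
        using t' by (intro real_sqrt_le_mono) (auto simp: \<delta>_def)
      also have "\<dots> = e / (12 * (\<bar>K\<bar> + 1))" using e by simp
      finally have "K * sqrt \<bar>t - t'\<bar> \<le> (\<bar>K\<bar> + 1) * (e / (12 * (\<bar>K\<bar> + 1)))"
        by (intro mult_mono) auto
      then have 2: "K * sqrt \<bar>t - t'\<bar> \<le> e / 12" by (simp only: cancel)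
      have "(t', x') \<in> S" using t' x' t by (simp add: S_def)
      then show ?thesis using 1 2 e by (intro exI[of _ t'] exI[of _ x']) auto
    qed
    then obtain t' x' where tx': "(t', x') \<in> S" "L * \<bar>x - x'\<bar> + K * sqrt \<bar>t - t'\<bar> < e / 3" by blast
    have t'0: "0 \<le> t'" using tx' by (simp add: S_def)
    have "(\<lambda>j. L * \<bar>x - x'\<bar> + K * sqrt \<bar>real (nat \<lfloor>t * real (r (s j))\<rfloor>) / real (r (s j))
        - real (nat \<lfloor>t' * real (r (s j))\<rfloor>) / real (r (s j))\<bar>) \<longlonglongrightarrow> L * \<bar>x - x'\<bar> + K * sqrt \<bar>t - t'\<bar>"
      using floor[OF t id] floor[OF t'0 id] by (intro bound tendsto_const)
    then have "\<forall>\<^sub>F j in sequentially. L * \<bar>x - x'\<bar> + K * sqrt \<bar>real (nat \<lfloor>t * real (r (s j))\<rfloor>) / real (r (s j))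
        - real (nat \<lfloor>t' * real (r (s j))\<rfloor>) / real (r (s j))\<bar> < e / 3"
      using tx'(2) by (rule order_tendstoD)
    with rs_pos[OF id] have "\<forall>\<^sub>F j in sequentially. \<bar>w (r (s j)) t x - w (r (s j)) t' x'\<bar> < e / 3"
      unfolding w_def by eventually_elim (rule le_less_trans[OF close])
    then obtain N1 where N1: "\<And>j. N1 \<le> j \<Longrightarrow> \<bar>w (r (s j)) t x - w (r (s j)) t' x'\<bar> < e / 3"
      by (auto simp: eventually_sequentially)
    have "Cauchy (\<lambda>j. w (r (s j)) t' x')" using s(2)[OF tx'(1)] by (auto intro: LIMSEQ_imp_Cauchy)
    from metric_CauchyD[OF this, of "e / 3"] e obtain N2 where
      N2: "\<And>i j. N2 \<le> i \<Longrightarrow> N2 \<le> j \<Longrightarrow> dist (w (r (s i)) t' x') (w (r (s j)) t' x') < e / 3" by auto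
    have "dist (w (r (s i)) t x) (w (r (s j)) t x) < e" if "max N1 N2 \<le> i" "max N1 N2 \<le> j" for i j
    proof -
      have "N1 \<le> i" "N1 \<le> j" "N2 \<le> i" "N2 \<le> j" using that by auto
      then show ?thesis using N1[of i] N1[of j] N2[of i j] unfolding dist_real_def by linarith
    qed
    then show "\<exists>M. \<forall>m\<ge>M. \<forall>n\<ge>M. dist (w (r (s m)) t x) (w (r (s n)) t x) < e" by blast
  qed
  define v where "v = (\<lambda>t x. lim (\<lambda>j. w (r (s j)) t x))"
  have v: "(\<lambda>j. w (r (s j)) t x) \<longlonglongrightarrow> v t x" if "0 \<le> t" for t x
    using conv[OF that] by (simp add: v_def convergent_LIMSEQ_iff)
  show thesis
  proof (rule that[OF s(1)])
    fix q :: "nat \<Rightarrow> nat" and k :: "nat \<Rightarrow> nat" and y :: "nat \<Rightarrow> real" and t x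
    assume q: "strict_mono q" and t: "0 \<le> t" and k: "(\<lambda>j. real (k j) / real (r (s (q j)))) \<longlonglongrightarrow> t" and y: "y \<longlonglongrightarrow> x"
    have "(\<lambda>j. U (r (s (q j))) (k j) (y j) - w (r (s (q j))) t x) \<longlonglongrightarrow> 0"
    proof (rule Lim_null_comparison)
      show "\<forall>\<^sub>F j in sequentially. norm (U (r (s (q j))) (k j) (y j) - w (r (s (q j))) t x)
          \<le> L * \<bar>y j - x\<bar> + K * sqrt \<bar>real (k j) / real (r (s (q j))) - real (nat \<lfloor>t * real (r (s (q j)))\<rfloor>) / real (r (s (q j)))\<bar>"
        using rs_pos[OF q] by eventually_elim (simp add: w_def close)
      show "(\<lambda>j. L * \<bar>y j - x\<bar> + K * sqrt \<bar>real (k j) / real (r (s (q j))) - real (nat \<lfloor>t * real (r (s (q j)))\<rfloor>) / real (r (s (q j)))\<bar>) \<longlonglongrightarrow> 0"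
        using bound[OF y tendsto_const k floor[OF t q], of x] by simp
    qed
    moreover have "(\<lambda>j. w (r (s (q j))) t x) \<longlonglongrightarrow> v t x"
      using LIMSEQ_subseq_LIMSEQ[OF v[OF t] q] by (simp add: o_def)
    ultimately show "(\<lambda>j. U (r (s (q j))) (k j) (y j)) \<longlonglongrightarrow> v t x"
      using tendsto_add by fastforce
  next
    fix t t' x x' :: real assume t: "0 \<le> t" "0 \<le> t'"
    have "(\<lambda>j. \<bar>w (r (s j)) t x - w (r (s j)) t' x'\<bar>) \<longlonglongrightarrow> \<bar>v t x - v t' x'\<bar>"
      by (intro tendsto_intros v t)
    moreover have "\<forall>\<^sub>F j in sequentially. \<bar>w (r (s j)) t x - w (r (s j)) t' x'\<bar>
        \<le> L * \<bar>x - x'\<bar> + K * sqrt \<bar>real (nat \<lfloor>t * real (r (s j))\<rfloor>) / real (r (s j))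
          - real (nat \<lfloor>t' * real (r (s j))\<rfloor>) / real (r (s j))\<bar>"
      using rs_pos[OF id] by eventually_elim (simp add: w_def close)
    ultimately show "\<bar>v t x - v t' x'\<bar> \<le> L * \<bar>x - x'\<bar> + K * sqrt \<bar>t - t'\<bar>"
      using bound[OF tendsto_const tendsto_const floor[OF t(1) id] floor[OF t(2) id], of x x']
      by (intro tendsto_le[OF trivial_limit_sequentially])
  qed
qed

section \<open>The central limit theorem\<close>

lemma not_tendsto_subseq:
  fixes f :: "nat \<Rightarrow> 'b::metric_space"
  assumes "\<not> f \<longlonglongrightarrow> l"
  obtains e r where "0 < e" "strict_mono (r :: nat \<Rightarrow> nat)" "\<forall>j. e \<le> dist (f (r j)) l"
proof -
  obtain e where e: "0 < e" "\<And>N. \<exists>n\<ge>N. e \<le> dist (f n) l"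
    using assms unfolding lim_sequentially by (meson not_less)
  then have inf: "infinite {n. e \<le> dist (f n) l}"
    unfolding infinite_nat_iff_unbounded_le by auto
  show thesis
    using that[OF e(1) strict_mono_enumerate[OF inf]] enumerate_in_set[OF inf] by auto
qed

lemma continuous_on_half_plane_of_modulus:
  fixes v :: "real \<Rightarrow> real \<Rightarrow> real"
  assumes "\<And>t t' x x'. 0 \<le> t \<Longrightarrow> 0 \<le> t' \<Longrightarrow> \<bar>v t x - v t' x'\<bar> \<le> L * \<bar>x - x'\<bar> + K * sqrt \<bar>t - t'\<bar>"
  shows "continuous_on ({0..} \<times> UNIV) (\<lambda>(t, x). v t x)"
  unfolding continuous_on_def
proof
  fix z0 :: "real \<times> real" assume z0: "z0 \<in> {0..} \<times> UNIV"
  let ?F = "at z0 within {0..} \<times> UNIV"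
  have "((\<lambda>z. (case z of (t, x) \<Rightarrow> v t x) - (case z0 of (t, x) \<Rightarrow> v t x)) \<longlongrightarrow> 0) ?F"
  proof (rule Lim_null_comparison)
    show "\<forall>\<^sub>F z in ?F. norm ((case z of (t, x) \<Rightarrow> v t x) - (case z0 of (t, x) \<Rightarrow> v t x))
        \<le> L * \<bar>snd z - snd z0\<bar> + K * sqrt \<bar>fst z - fst z0\<bar>"
      unfolding eventually_at_filter
      using z0 assms by (intro always_eventually) (auto simp: case_prod_unfold)
    have "((\<lambda>z. L * \<bar>snd z - snd z0\<bar> + K * sqrt \<bar>fst z - fst z0\<bar>) \<longlongrightarrow>
        L * \<bar>snd z0 - snd z0\<bar> + K * sqrt \<bar>fst z0 - fst z0\<bar>) ?F"
      by (intro tendsto_intros)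
    then show "((\<lambda>z. L * \<bar>snd z - snd z0\<bar> + K * sqrt \<bar>fst z - fst z0\<bar>) \<longlongrightarrow> 0) ?F" by simp
  qed
  then show "((\<lambda>(t, x). v t x) \<longlongrightarrow> (case z0 of (t, x) \<Rightarrow> v t x)) ?F" by (rule LIM_zero_cancel)
qed

lemma isCont_G_fun: "isCont (G_fun vl vu) a"
  unfolding G_fun_def by (intro continuous_intros) auto

section \<open>Approximation by bounded Lipschitz functions\<close>

text \<open>A Weierstrass polynomial on \<open>[-r, r]\<close>, composed with the projection to that
  interval, is Lipschitz on the whole line. The conclusion with an existential point records that
  each value of \<psi> is close to a value of \<phi> on the interval, so that growth of \<phi>
  bounds \<psi>.\<close>

lemma clamped_polynomial_approximation:
  fixes \<phi> :: "real \<Rightarrow> real"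
  assumes "continuous_on UNIV \<phi>" "0 < \<epsilon>" "0 \<le> r"
  obtains \<psi> L where "L-lipschitz_on UNIV \<psi>" "\<And>x. \<exists>y. \<bar>y\<bar> \<le> r \<and> \<bar>\<phi> y - \<psi> x\<bar> \<le> \<epsilon>"
    "\<And>x. \<bar>x\<bar> \<le> r \<Longrightarrow> \<bar>\<phi> x - \<psi> x\<bar> \<le> \<epsilon>"
proof -
  let ?I = "{- r..r}"
  obtain g where g: "real_polynomial_function g" "\<And>x. x \<in> ?I \<Longrightarrow> \<bar>\<phi> x - g x\<bar> < \<epsilon>"
    using Stone_Weierstrass_real_polynomial_function[of ?I \<phi> \<epsilon>] continuous_on_subset[OF assms(1)] assms(2) by auto
  obtain g' where g': "real_polynomial_function g'" "\<And>x. (g has_real_derivative g' x) (at x)"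
    using has_real_derivative_polynomial_function[OF g(1)] by metis
  have "continuous_on ?I g'"
    using has_real_derivative_polynomial_function[OF g'(1)]
    by (blast intro: continuous_at_imp_continuous_on DERIV_isCont)
  then have "bounded (g' ` ?I)" by (intro compact_imp_bounded compact_continuous_image) auto
  then obtain L where L: "\<forall>x\<in>?I. \<bar>g' x\<bar> \<le> L" unfolding bounded_iff by auto
  have "\<bar>g' 0\<bar> \<le> L" using L assms(3) by simp
  then have L0: "0 \<le> L" by linarith
  define c where "c = (\<lambda>x::real. max (- r) (min r x))"
  have c: "\<bar>c x\<bar> \<le> r" "\<bar>c x - c y\<bar> \<le> \<bar>x - y\<bar>" "\<bar>x\<bar> \<le> r \<Longrightarrow> c x = x" for x y
    using assms(3) by (auto simp: c_def)
  have cI: "c x \<in> ?I" for x using c(1)[of x] by auto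
  show thesis
  proof (rule that[of L "\<lambda>x. g (c x)"])
    show "L-lipschitz_on UNIV (\<lambda>x. g (c x))"
    proof (rule lipschitz_onI[OF _ L0])
      fix x y :: real
      have "norm (g (c x) - g (c y)) \<le> L * norm (c x - c y)"
        by (rule field_differentiable_bound[of ?I g g' L])
           (use L cI g'(2) in \<open>auto intro: has_field_derivative_at_within\<close>)
      also have "\<dots> \<le> L * \<bar>x - y\<bar>" using L0 c(2) by (auto intro: mult_left_mono)
      finally show "dist (g (c x)) (g (c y)) \<le> L * dist x y" by (simp add: dist_real_def)
    qed
    show "\<exists>y. \<bar>y\<bar> \<le> r \<and> \<bar>\<phi> y - g (c x)\<bar> \<le> \<epsilon>" for x
      using c(1)[of x] g(2)[OF cI[of x]] by (intro exI[of _ "c x"]) auto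
    show "\<bar>\<phi> x - g (c x)\<bar> \<le> \<epsilon>" if "\<bar>x\<bar> \<le> r" for x
      using c(3)[OF that] g(2)[OF cI[of x]] by auto
  qed
qed

lemma bounded_lipschitz_approximation:
  fixes \<phi> :: "real \<Rightarrow> real" and p :: real
  assumes cont: "continuous_on UNIV \<phi>" and growth: "\<And>x. \<bar>\<phi> x\<bar> \<le> C * (1 + \<bar>x\<bar> powr p)"
    and \<epsilon>: "0 < \<epsilon>" and R: "1 \<le> R" and p: "1 \<le> p"
  obtains \<psi> L where "L-lipschitz_on UNIV \<psi>" "bounded (range \<psi>)"
    "\<And>x. \<bar>\<phi> x - \<psi> x\<bar> \<le> \<epsilon> + 8 * C * max (\<bar>x\<bar> powr p - R powr p) 0"
proof -
  have C: "0 \<le> C" using growth[of 0] p by simp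
  \<comment> \<open>Then \<open>r powr p = 2 * R powr p\<close>, and outside \<open>[-r, r]\<close>
    the excess \<open>\<bar>x\<bar> powr p - R powr p\<close> is at least half of
    \<open>\<bar>x\<bar> powr p\<close>; it can absorb both \<phi> and \<psi>.\<close>
  define r where "r = 2 powr (1 / p) * R"
  have rp: "r powr p = 2 * R powr p" using p by (simp add: r_def powr_mult powr_powr)
  have r: "0 \<le> r" "1 \<le> R powr p" using R p by (auto simp: r_def intro: ge_one_powr_ge_zero)
  obtain \<psi> L where \<psi>: "L-lipschitz_on UNIV \<psi>" "\<And>x. \<exists>y. \<bar>y\<bar> \<le> r \<and> \<bar>\<phi> y - \<psi> x\<bar> \<le> \<epsilon>"
    "\<And>x. \<bar>x\<bar> \<le> r \<Longrightarrow> \<bar>\<phi> x - \<psi> x\<bar> \<le> \<epsilon>"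
    by (rule clamped_polynomial_approximation[OF cont \<epsilon> r(1)]) (rule that)
  have \<psi>_bound: "\<bar>\<psi> x\<bar> \<le> \<epsilon> + C * (1 + 2 * R powr p)" for x
  proof -
    obtain y where y: "\<bar>y\<bar> \<le> r" "\<bar>\<phi> y - \<psi> x\<bar> \<le> \<epsilon>" using \<psi>(2) by blast
    have "\<bar>y\<bar> powr p \<le> r powr p" using y p by (intro powr_mono2) auto
    then have "C * (1 + \<bar>y\<bar> powr p) \<le> C * (1 + 2 * R powr p)"
      using C unfolding rp by (intro mult_left_mono) auto
    then show ?thesis using growth[of y] y(2) by linarith
  qed
  show thesis
  proof (rule that[OF \<psi>(1)])
    show "bounded (range \<psi>)" using \<psi>_bound by (auto simp: bounded_iff)
    fix x
    show "\<bar>\<phi> x - \<psi> x\<bar> \<le> \<epsilon> + 8 * C * max (\<bar>x\<bar> powr p - R powr p) 0"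
    proof (cases "\<bar>x\<bar> \<le> r")
      case True
      have "0 \<le> 8 * C * max (\<bar>x\<bar> powr p - R powr p) 0" using C by simp
      then show ?thesis using \<psi>(3)[OF True] by linarith
    next
      case False
      then have "r powr p \<le> \<bar>x\<bar> powr p" using r p by (intro powr_mono2) auto
      then have x: "2 * R powr p \<le> \<bar>x\<bar> powr p" unfolding rp .
      have "\<bar>\<phi> x - \<psi> x\<bar> \<le> C * (1 + \<bar>x\<bar> powr p) + (\<epsilon> + C * (1 + 2 * R powr p))"
        using growth[of x] \<psi>_bound[of x] by linarith
      also have "\<dots> = \<epsilon> + C * (2 + \<bar>x\<bar> powr p + 2 * R powr p)" by (simp add: algebra_simps)
      also have "C * (2 + \<bar>x\<bar> powr p + 2 * R powr p) \<le> C * (8 * max (\<bar>x\<bar> powr p - R powr p) 0)"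
      proof (intro mult_left_mono C)
        \<comment> \<open>The right side exceeds the left by at least \<open>4 * b - 2 > 0\<close>;
          this is the source of the constant 8.\<close>
        have "2 + a + 2 * b \<le> 8 * (a - b)" if "2 * b \<le> a" "1 \<le> b" for a b :: real
          using that by (simp add: algebra_simps)
        from this[OF x r(2)] have "2 + \<bar>x\<bar> powr p + 2 * R powr p \<le> 8 * (\<bar>x\<bar> powr p - R powr p)" .
        also have "\<dots> \<le> 8 * max (\<bar>x\<bar> powr p - R powr p) 0" by (rule mult_left_mono) auto
        finally show "2 + \<bar>x\<bar> powr p + 2 * R powr p \<le> 8 * max (\<bar>x\<bar> powr p - R powr p) 0" .
      qed
      finally show ?thesis by simp
    qed
  qed
qed

text \<open>\<open>F\<close> is squeezed between \<open>W - Y\<close> and \<open>W + Y\<close>,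
  which lie in \<open>H\<close>: the latter competes in the infimum, and the former lies below every
  competitor.\<close>

lemma (in sublinear_expectation_space) ext_expectation_close:
  assumes W: "W \<in> integrable_rv" and Y: "Y \<in> integrable_rv"
    and le: "\<And>\<omega>. \<omega> \<in> space M \<Longrightarrow> \<bar>F \<omega> - W \<omega>\<bar> \<le> Y \<omega>"
  shows "\<bar>ext_expectation M H E F\<bar> \<noteq> \<infinity>"
    and "\<bar>real_of_ereal (ext_expectation M H E F) - expect W\<bar> \<le> expect Y"
proof -
  let ?e = "ext_expectation M H E F"
  have WY: "(\<lambda>\<omega>. W \<omega> + Y \<omega>) \<in> integrable_rv" "(\<lambda>\<omega>. W \<omega> - Y \<omega>) \<in> integrable_rv"
    using W Y by (auto intro: integrable_rv_add integrable_rv_diff)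
  have "?e \<le> E (\<lambda>\<omega>. W \<omega> + Y \<omega>)" unfolding ext_expectation_def
  proof (rule INF_lower)
    have "F \<omega> \<le> W \<omega> + Y \<omega>" if "\<omega> \<in> space M" for \<omega> using le[OF that] by linarith
    then show "(\<lambda>\<omega>. W \<omega> + Y \<omega>) \<in> {Z \<in> H. \<forall>\<omega>\<in>space M. F \<omega> \<le> Z \<omega>}"
      using WY(1) by (auto simp: integrable_rv_H)
  qed
  also have "\<dots> \<le> ereal (expect W + expect Y)"
    using expect_add_le[OF W Y] by (simp add: E_integrable_rv[OF WY(1)])
  finally have upper: "?e \<le> ereal (expect W + expect Y)" .
  have "expect W \<le> expect (\<lambda>\<omega>. (W \<omega> - Y \<omega>) + Y \<omega>)" by simp
  also have "\<dots> \<le> expect (\<lambda>\<omega>. W \<omega> - Y \<omega>) + expect Y" by (rule expect_add_le[OF WY(2) Y])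
  finally have "ereal (expect W - expect Y) \<le> E (\<lambda>\<omega>. W \<omega> - Y \<omega>)"
    by (simp add: E_integrable_rv[OF WY(2)])
  also have "\<dots> \<le> ?e" unfolding ext_expectation_def
  proof (rule INF_greatest)
    fix Z assume Z: "Z \<in> {Z \<in> H. \<forall>\<omega>\<in>space M. F \<omega> \<le> Z \<omega>}"
    show "E (\<lambda>\<omega>. W \<omega> - Y \<omega>) \<le> E Z"
    proof (rule E_mono)
      fix \<omega> assume "\<omega> \<in> space M"
      then show "W \<omega> - Y \<omega> \<le> Z \<omega>" using le[of \<omega>] Z by fastforce
    qed (use Z WY(2) in \<open>auto simp: integrable_rv_H\<close>)
  qed
  finally have lower: "ereal (expect W - expect Y) \<le> ?e" .
  show "\<bar>?e\<bar> \<noteq> \<infinity>" using upper lower by (cases ?e) auto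
  show "\<bar>real_of_ereal ?e - expect W\<bar> \<le> expect Y" using upper lower by (cases ?e) auto
qed

context centered_iid
begin

section \<open>Identification of the limit and passage to power growth\<close>

lemma clt_bounded_lipschitz:
  assumes tail: "((\<lambda>c. step_expect (\<lambda>h. max (h\<^sup>2 - c) 0)) \<longlongrightarrow> 0) at_top"
    and lip: "L-lipschitz_on UNIV \<phi>" and bnd: "bounded (range \<phi>)"
    and u: "unique_viscosity_solution (G_fun lower_var upper_var) \<phi> u"
  shows "(\<lambda>n. expect (\<lambda>\<omega>. \<phi> (1 / sqrt (real n) * (\<Sum>i<n. X (Suc i) \<omega>)))) \<longlonglongrightarrow> u 1 0"
proof (rule ccontr)
  define U where "U = (\<lambda>n k. (step_op (1 / sqrt (real n)) ^^ k) \<phi>)"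
  define K where "K = L * (1 + upper_var)"
  obtain B where B: "\<And>x. \<bar>\<phi> x\<bar> \<le> B" using bnd by (auto simp: bounded_iff)
  have D: "\<phi> \<in> D" using lip by (rule lipschitz_D)
  have U_D: "U n k \<in> D" for n k unfolding U_def using D by (rule step_op_funpow_D)
  have U_lip: "L-lipschitz_on UNIV (U n k)" for n k unfolding U_def using lip by (rule step_op_funpow_lipschitz)
  have U_bnd: "\<bar>U n k x\<bar> \<le> B" for n k x unfolding U_def using D B by (rule step_op_funpow_bounded)
  have U_Suc: "U n (Suc k) = step_op (1 / sqrt (real n)) (U n k)" for n k by (simp add: U_def)
  have U_diff: "\<bar>U n k x - U n k y\<bar> \<le> L * \<bar>x - y\<bar>" for n k x y
    using lipschitz_onD[OF U_lip, of x y n k] by (simp add: dist_real_def)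
  have U_time: "\<bar>U n k x - U n l x\<bar> \<le> K * sqrt ((real k - real l) / real n)" if "0 < n" "l \<le> k" for n k l x
    unfolding U_def K_def by (rule step_op_funpow_time_continuity[OF lip that])
  have U_cont: "continuous_on UNIV (U n k)" for n k using U_lip by (rule lipschitz_on_continuous_on)

  define f where "f = (\<lambda>n. expect (\<lambda>\<omega>. \<phi> (1 / sqrt (real n) * (\<Sum>i<n. X (Suc i) \<omega>))))"
  assume "\<not> ?thesis"
  then have "\<not> f \<longlonglongrightarrow> u 1 0" unfolding f_def .
  then obtain e r where e: "0 < e" and r: "strict_mono (r :: nat \<Rightarrow> nat)" and far: "\<forall>j. e \<le> dist (f (r j)) (u 1 0)"
    by (rule not_tendsto_subseq) (rule that)
  obtain s v where s: "strict_mono (s :: nat \<Rightarrow> nat)"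
    and conv: "\<And>q k y t x. strict_mono q \<Longrightarrow> 0 \<le> t \<Longrightarrow>
      (\<lambda>j. real (k j) / real (r (s (q j)))) \<longlonglongrightarrow> t \<Longrightarrow> y \<longlonglongrightarrow> x \<Longrightarrow>
      (\<lambda>j. U (r (s (q j))) (k j) (y j)) \<longlonglongrightarrow> v t x"
    and modulus: "\<And>t t' x x'. 0 \<le> t \<Longrightarrow> 0 \<le> t' \<Longrightarrow> \<bar>v t x - v t' x'\<bar> \<le> L * \<bar>x - x'\<bar> + K * sqrt \<bar>t - t'\<bar>"
    by (rule scheme_convergent_subsequence[of r U B L K, OF r U_bnd U_diff U_time], assumption, assumption) (rule that)
  have rs: "strict_mono (\<lambda>j. r (s j))" using strict_mono_o[OF r s] by (simp add: o_def)
  have id: "strict_mono (\<lambda>j::nat. j)" by (simp add: strict_mono_def)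
  have rs_top: "filterlim (\<lambda>j. real (r (s j))) at_top sequentially" by (rule filterlim_real_strict_mono[OF rs])
  have v_lim: "(\<lambda>j. U (r (s j)) (nat \<lfloor>t * real (r (s j))\<rfloor>) x) \<longlonglongrightarrow> v t x" if "0 \<le> t" for t x
    by (rule conv[OF id that nat_floor_mult_divide_tendsto[OF that rs_top] tendsto_const])
  have v_bnd: "\<bar>v t x\<bar> \<le> B" if "0 \<le> t" for t x
    by (rule tendsto_upperbound[OF tendsto_rabs[OF v_lim[OF that]] always_eventually]) (auto simp: U_bnd)

  have "viscosity_subsolution (G_fun lower_var upper_var) v"
  proof (rule scheme_limit_subsolution[OF rs U_bnd U_cont])
    show "(\<lambda>j. U (r (s (q j))) (k j) (y j)) \<longlonglongrightarrow> v t x"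
      if "strict_mono q" "0 < t" "(\<lambda>j. real (k j) / real (r (s (q j)))) \<longlonglongrightarrow> t" "y \<longlonglongrightarrow> x" for q k y t x
      using that by (intro conv) auto
    show "U n (Suc k) y - c \<le> (G_fun lower_var upper_var \<alpha> + K * step_expect (\<lambda>h. max (h\<^sup>2 - real n * d) 0)) / real n"
      if "0 < n" "0 \<le> K" "\<And>h. U n k (y + h) - c \<le> b * h + \<alpha> / 2 * h\<^sup>2 + K * max (h\<^sup>2 - d) 0" for n k y c b \<alpha> K d
      unfolding U_Suc using that by (rule step_op_consistent_upper[OF U_D])
  qed (use tail isCont_G_fun in auto)
  moreover have "viscosity_supersolution (G_fun lower_var upper_var) v"
    unfolding viscosity_supersolution_iff
  proof (rule scheme_limit_subsolution[where U = "\<lambda>n k x. - U n k x" and B = B, OF rs])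
    show "(\<lambda>j. - U (r (s (q j))) (k j) (y j)) \<longlonglongrightarrow> - v t x"
      if "strict_mono q" "0 < t" "(\<lambda>j. real (k j) / real (r (s (q j)))) \<longlonglongrightarrow> t" "y \<longlonglongrightarrow> x" for q k y t x
      using that by (intro tendsto_minus conv) auto
    show "- U n (Suc k) y - c \<le> (- G_fun lower_var upper_var (- \<alpha>) + K * step_expect (\<lambda>h. max (h\<^sup>2 - real n * d) 0)) / real n"
      if "0 < n" "0 \<le> K" "\<And>h. - U n k (y + h) - c \<le> b * h + \<alpha> / 2 * h\<^sup>2 + K * max (h\<^sup>2 - d) 0" for n k y c b \<alpha> K d
      unfolding U_Suc using that by (rule step_op_consistent_lower[OF U_D])
    show "isCont (\<lambda>\<alpha>. - G_fun lower_var upper_var (- \<alpha>)) a" for a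
      unfolding G_fun_def by (intro continuous_intros) auto
  qed (use tail U_bnd U_cont in \<open>auto intro: continuous_intros\<close>)
  moreover have "continuous_on ({0..} \<times> UNIV) (\<lambda>(t, x). v t x)"
    using modulus by (rule continuous_on_half_plane_of_modulus)
  moreover have "v 0 x = \<phi> x" for x
    using LIMSEQ_unique[OF v_lim[of 0 x]] by (simp add: U_def)
  ultimately have "viscosity_solution (G_fun lower_var upper_var) \<phi> v"
    by (simp add: viscosity_solution_def)
  moreover have "polynomial_growth v"
    unfolding polynomial_growth_def
  proof (intro allI impI exI ballI)
    fix T t x :: real assume "t \<in> {0..T}"
    then have "\<bar>v t x\<bar> \<le> B" by (intro v_bnd) auto
    moreover have "0 \<le> B" using B[of 0] by linarith
    ultimately show "\<bar>v t x\<bar> \<le> B * (1 + \<bar>x\<bar> ^ 0)" by simp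
  qed
  \<comment> \<open>The limit found along a subsequence is pinned down by uniqueness, so it does not
    depend on that subsequence.\<close>
  ultimately have vu: "v 1 0 = u 1 0"
    using u by (simp add: unique_viscosity_solution_def)
  \<comment> \<open>At time 1 the floor is exact: the scheme after \<open>n\<close> steps, evaluated
    at 0, is the expectation of \<phi> at the normalized sum.\<close>
  have "(\<lambda>j. U (r (s j)) (r (s j)) 0) \<longlonglongrightarrow> v 1 0"
    using v_lim[of 1 0] by simp
  then have "\<forall>\<^sub>F j in sequentially. dist (U (r (s j)) (r (s j)) 0) (u 1 0) < e"
    using e unfolding vu by (rule tendstoD)
  then obtain j where "dist (U (r (s j)) (r (s j)) 0) (u 1 0) < e"
    by (auto simp: eventually_sequentially)
  moreover have "U (r (s j)) (r (s j)) 0 = f (r (s j))"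
    unfolding f_def U_def expect_sum[OF D] ..
  ultimately show False using far[rule_format, of "s j"] by simp
qed

text \<open>Beyond the bounded Lipschitz case it remains to exclude a loss of mass of order
  \<open>p\<close> at infinity. For the sums this is \<open>expect_tail_le\<close> together with
  \<open>tail_p\<close>; for \<xi> it comes from its moments.\<close>

lemma clt_power_growth:
  assumes tail: "((\<lambda>c. step_expect (\<lambda>h. max (h\<^sup>2 - c) 0)) \<longlongrightarrow> 0) at_top"
    and tail_p: "(\<lambda>n. real n * step_expect (\<lambda>h. max (\<bar>1 / sqrt (real n) * h\<bar> powr p - 1 / 2) 0)) \<longlonglongrightarrow> 0"
    and space': "sublinear_expectation_space M' H' E'"
    and \<xi>: "G_normal H' E' \<xi> lower_var upper_var" "\<And>k::nat. E' (\<lambda>\<omega>. \<bar>\<xi> \<omega>\<bar> ^ k) < \<infinity>"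
    and \<phi>: "continuous_on UNIV \<phi>" "\<And>x. \<bar>\<phi> x\<bar> \<le> C * (1 + \<bar>x\<bar> powr p)"
  shows "(\<lambda>n. ext_expectation M H E (\<lambda>\<omega>. \<phi> (1 / sqrt (real n) * (\<Sum>i<n. X (Suc i) \<omega>))))
    \<longlonglongrightarrow> ext_expectation M' H' E' (\<lambda>\<omega>. \<phi> (\<xi> \<omega>))"
proof -
  interpret N: sublinear_expectation_space M' H' E' by (rule space')
  define Z where "Z = (\<lambda>n \<omega>. 1 / sqrt (real n) * (\<Sum>i<n. X (Suc i) \<omega>))"
  define \<Phi> where "\<Phi> = (\<lambda>R x. max (\<bar>x\<bar> powr p - (2 * R) powr p) 0 :: real)"
  define a where "a = (\<lambda>n. ext_expectation M H E (\<lambda>\<omega>. \<phi> (Z n \<omega>)))"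
  define b where "b = ext_expectation M' H' E' (\<lambda>\<omega>. \<phi> (\<xi> \<omega>))"
  have C: "0 \<le> C" using \<phi>(2)[of 0] p by simp
  have \<xi>H: "\<xi> \<in> H'" using \<xi>(1) by (simp add: G_normal_def)
  \<comment> \<open>Order \<open>2 * p\<close> yields a decay rate: if
    \<open>\<bar>x\<bar> > 2 * R\<close> then \<open>\<bar>x\<bar> powr p \<ge> R\<close>, and so
    \<open>\<bar>x\<bar> powr p \<le> \<bar>x\<bar> powr (2 * p) / R\<close>. Rounding up reaches
    the integer moments of the hypothesis.\<close>
  define m where "m = nat \<lceil>2 * p\<rceil>"
  have m: "2 * p \<le> real m" by (simp add: m_def) linarith
  have pow_m: "x powr (2 * p) \<le> 1 + x ^ m" if "0 \<le> x" for x :: real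
    using powr_le_one_add[OF that, of "2 * p" "real m"] m p that by (simp add: powr_realpow')
  have \<xi>m: "(\<lambda>\<omega>. \<bar>\<xi> \<omega>\<bar> ^ m) \<in> N.integrable_rv"
  proof -
    have "m \<noteq> 0" using m p by auto
    then have "\<bar>\<xi> \<omega>\<bar> ^ m = \<bar>\<xi> \<omega>\<bar> powr real m" for \<omega> by (simp add: powr_realpow')
    moreover have "(\<lambda>\<omega>. \<bar>\<xi> \<omega>\<bar> powr real m) \<in> H'"
      using m p by (intro N.H_poly_lipschitz[OF poly_lipschitz_abs_powr] \<xi>H) auto
    ultimately show ?thesis using \<xi>(2)[of m] by (simp add: N.integrable_rv_def)
  qed
  have \<xi>D: "(\<lambda>\<omega>. f (\<xi> \<omega>)) \<in> N.integrable_rv" if "f \<in> D" for f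
  proof (rule N.integrable_rv_poly_lipschitz[OF that _ \<xi>H])
    have H: "(\<lambda>\<omega>. \<bar>\<xi> \<omega>\<bar> powr p) \<in> H'"
      using p_simps by (intro N.H_poly_lipschitz[OF poly_lipschitz_abs_powr] \<xi>H) auto
    have i: "(\<lambda>\<omega>. 2 + \<bar>\<xi> \<omega>\<bar> ^ m) \<in> N.integrable_rv"
      using \<xi>m by (intro N.integrable_rv_add N.integrable_rv_const)
    have "(\<lambda>\<omega>. \<bar>\<xi> \<omega>\<bar> powr p) \<in> N.integrable_rv"
    proof (rule N.integrable_rv_bound[OF H i])
      fix \<omega>
      have "\<bar>\<xi> \<omega>\<bar> powr p \<le> 1 + \<bar>\<xi> \<omega>\<bar> powr (2 * p)" using p by (intro powr_le_one_add) auto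
      then show "\<bar>\<bar>\<xi> \<omega>\<bar> powr p\<bar> \<le> 2 + \<bar>\<xi> \<omega>\<bar> ^ m" using pow_m[of "\<bar>\<xi> \<omega>\<bar>"] by simp
    qed
    then show "E' (\<lambda>\<omega>. \<bar>\<xi> \<omega>\<bar> powr p) < \<infinity>" by (simp add: N.integrable_rv_def)
  qed (use p in simp)
  have ZD: "(\<lambda>\<omega>. f (Z n \<omega>)) \<in> integrable_rv" if "f \<in> D" for f n
    unfolding Z_def by (rule integrable_sum[OF that])
  have \<Phi>D: "\<Phi> R \<in> D" for R
    unfolding \<Phi>_def using p_simps by (intro poly_lipschitz_max_const poly_lipschitz_diff poly_lipschitz_const D_abs_powr) auto

  define \<mu> where "\<mu> = N.expect (\<lambda>\<omega>. 1 + \<bar>\<xi> \<omega>\<bar> ^ m)"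
  have \<xi>_tail: "N.expect (\<lambda>\<omega>. \<Phi> R (\<xi> \<omega>)) \<le> 1 / R * \<mu>" if R: "2 \<le> R" for R
  proof -
    have "\<Phi> R x \<le> 1 / R * (1 + \<bar>x\<bar> ^ m)" for x
    proof (cases "\<bar>x\<bar> powr p \<le> (2 * R) powr p")
      case True
      then show ?thesis using R by (simp add: \<Phi>_def)
    next
      case False
      have "R \<le> (2 * R) powr 1" using R by simp
      also have "\<dots> \<le> (2 * R) powr p" using R p by (intro powr_mono) auto
      finally have "R \<le> \<bar>x\<bar> powr p" using False by simp
      then have "R * \<bar>x\<bar> powr p \<le> \<bar>x\<bar> powr p * \<bar>x\<bar> powr p" by (intro mult_right_mono) auto
      also have "\<dots> = \<bar>x\<bar> powr (2 * p)" by (simp flip: powr_add)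
      also have "\<dots> \<le> 1 + \<bar>x\<bar> ^ m" by (rule pow_m) simp
      finally have "\<bar>x\<bar> powr p \<le> 1 / R * (1 + \<bar>x\<bar> ^ m)" using R by (simp add: field_simps)
      moreover have "\<Phi> R x \<le> \<bar>x\<bar> powr p" by (simp add: \<Phi>_def)
      ultimately show ?thesis by linarith
    qed
    then have "N.expect (\<lambda>\<omega>. \<Phi> R (\<xi> \<omega>)) \<le> N.expect (\<lambda>\<omega>. 1 / R * (1 + \<bar>\<xi> \<omega>\<bar> ^ m))"
      by (intro N.expect_mono \<xi>D[OF \<Phi>D] N.integrable_rv_cmult N.integrable_rv_add N.integrable_rv_const \<xi>m)
    also have "\<dots> = 1 / R * \<mu>" unfolding \<mu>_def
      using R by (intro N.expect_cmult N.integrable_rv_add N.integrable_rv_const \<xi>m) auto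
    finally show ?thesis .
  qed
  define \<tau> where "\<tau> = (\<lambda>n. real n * step_expect (\<lambda>h. max (\<bar>1 / sqrt (real n) * h\<bar> powr p - 1 / 2) 0))"
  obtain K where K: "0 \<le> K" "\<And>R n. 2 \<le> R \<Longrightarrow> 0 < n \<Longrightarrow>
    expect (\<lambda>\<omega>. max (\<bar>1 / sqrt (real n) * (\<Sum>i<n. X (Suc i) \<omega>)\<bar> powr p - (2 * R) powr p) 0)
    \<le> K * (1 / R\<^sup>2 + real n * step_expect (\<lambda>h. max (\<bar>1 / sqrt (real n) * h\<bar> powr p - 1 / 2) 0))"
    by (rule expect_tail_le) (rule that)
  have Z_tail: "expect (\<lambda>\<omega>. \<Phi> R (Z n \<omega>)) \<le> K * (1 / R\<^sup>2 + \<tau> n)" if "2 \<le> R" "0 < n" for R n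
    unfolding \<Phi>_def Z_def \<tau>_def by (rule K(2)[OF that])

  have approx: "\<exists>\<psi>. (\<lambda>n. expect (\<lambda>\<omega>. \<psi> (Z n \<omega>))) \<longlonglongrightarrow> N.expect (\<lambda>\<omega>. \<psi> (\<xi> \<omega>)) \<and>
      (\<forall>n. \<bar>a n\<bar> \<noteq> \<infinity> \<and> \<bar>real_of_ereal (a n) - expect (\<lambda>\<omega>. \<psi> (Z n \<omega>))\<bar> \<le> \<epsilon> + 8 * C * expect (\<lambda>\<omega>. \<Phi> R (Z n \<omega>))) \<and>
      \<bar>b\<bar> \<noteq> \<infinity> \<and> \<bar>real_of_ereal b - N.expect (\<lambda>\<omega>. \<psi> (\<xi> \<omega>))\<bar> \<le> \<epsilon> + 8 * C * N.expect (\<lambda>\<omega>. \<Phi> R (\<xi> \<omega>))"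
    if \<epsilon>: "0 < \<epsilon>" and R: "2 \<le> R" for \<epsilon> R
  proof -
    have R1: "1 \<le> 2 * R" using R by simp
    obtain \<psi> L where \<psi>: "L-lipschitz_on UNIV \<psi>" "bounded (range \<psi>)"
      "\<And>x. \<bar>\<phi> x - \<psi> x\<bar> \<le> \<epsilon> + 8 * C * max (\<bar>x\<bar> powr p - (2 * R) powr p) 0"
      by (rule bounded_lipschitz_approximation[OF \<phi> \<epsilon> R1 p_simps(1)]) (rule that)
    have close: "\<bar>\<phi> x - \<psi> x\<bar> \<le> \<epsilon> + 8 * C * \<Phi> R x" for x unfolding \<Phi>_def by (rule \<psi>(3))
    have \<psi>D: "\<psi> \<in> D" using \<psi>(1) by (rule lipschitz_D)
    have "unique_viscosity_solution (G_fun lower_var upper_var) \<psi>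
        (\<lambda>t x. real_of_ereal (E' (\<lambda>\<omega>. \<psi> (x + sqrt t * \<xi> \<omega>))))"
      using \<xi>(1) \<psi>(1,2) unfolding G_normal_def by blast
    from clt_bounded_lipschitz[OF tail \<psi>(1,2) this]
    have lim: "(\<lambda>n. expect (\<lambda>\<omega>. \<psi> (Z n \<omega>))) \<longlonglongrightarrow> N.expect (\<lambda>\<omega>. \<psi> (\<xi> \<omega>))"
      by (simp add: Z_def N.expect_def)
    have an: "\<bar>a n\<bar> \<noteq> \<infinity> \<and> \<bar>real_of_ereal (a n) - expect (\<lambda>\<omega>. \<psi> (Z n \<omega>))\<bar> \<le> \<epsilon> + 8 * C * expect (\<lambda>\<omega>. \<Phi> R (Z n \<omega>))" for n
    proof -
      have i: "(\<lambda>\<omega>. 8 * C * \<Phi> R (Z n \<omega>)) \<in> integrable_rv" by (intro integrable_rv_cmult ZD \<Phi>D)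
      have "expect (\<lambda>\<omega>. \<epsilon> + 8 * C * \<Phi> R (Z n \<omega>)) = \<epsilon> + 8 * C * expect (\<lambda>\<omega>. \<Phi> R (Z n \<omega>))"
        using C by (simp add: expect_add_const[OF i] expect_cmult[OF ZD[OF \<Phi>D]])
      then show ?thesis
        using ext_expectation_close[OF ZD[OF \<psi>D, of n] integrable_rv_add[OF integrable_rv_const[of \<epsilon>] i] close]
        by (simp add: a_def)
    qed
    have bn: "\<bar>b\<bar> \<noteq> \<infinity> \<and> \<bar>real_of_ereal b - N.expect (\<lambda>\<omega>. \<psi> (\<xi> \<omega>))\<bar> \<le> \<epsilon> + 8 * C * N.expect (\<lambda>\<omega>. \<Phi> R (\<xi> \<omega>))"
    proof -
      have i: "(\<lambda>\<omega>. 8 * C * \<Phi> R (\<xi> \<omega>)) \<in> N.integrable_rv" by (intro N.integrable_rv_cmult \<xi>D \<Phi>D)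
      have "N.expect (\<lambda>\<omega>. \<epsilon> + 8 * C * \<Phi> R (\<xi> \<omega>)) = \<epsilon> + 8 * C * N.expect (\<lambda>\<omega>. \<Phi> R (\<xi> \<omega>))"
        using C by (simp add: N.expect_add_const[OF i] N.expect_cmult[OF \<xi>D[OF \<Phi>D]])
      then show ?thesis
        using N.ext_expectation_close[OF \<xi>D[OF \<psi>D] N.integrable_rv_add[OF N.integrable_rv_const[of \<epsilon>] i] close]
        by (simp add: b_def)
    qed
    show ?thesis
      by (intro exI[of _ \<psi>] conjI allI lim an[THEN conjunct1] an[THEN conjunct2] bn[THEN conjunct1] bn[THEN conjunct2])
  qed

  \<comment> \<open>One instance of \<open>approx\<close>, with arbitrary parameters, shows all
    values to be finite before the argument passes to real numbers.\<close>
  obtain \<psi>0 where \<psi>0: "\<forall>n. \<bar>a n\<bar> \<noteq> \<infinity> \<and>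
      \<bar>real_of_ereal (a n) - expect (\<lambda>\<omega>. \<psi>0 (Z n \<omega>))\<bar> \<le> 1 + 8 * C * expect (\<lambda>\<omega>. \<Phi> 2 (Z n \<omega>))"
    and fin_b: "\<bar>b\<bar> \<noteq> \<infinity>"
    using approx[OF zero_less_one order_refl] by (elim exE conjE) (rule that)
  have fin_a: "\<bar>a n\<bar> \<noteq> \<infinity>" for n by (rule \<psi>0[THEN spec, THEN conjunct1])
  have "(\<lambda>n. real_of_ereal (a n)) \<longlonglongrightarrow> real_of_ereal b"
  proof (rule tendstoI)
    \<comment> \<open>The budget: less than \<open>3 * \<eta> / 8\<close> for approximating
      \<open>a n\<close>, and less than \<open>\<eta> / 4\<close> each for the bounded Lipschitz
      limit and for \<open>b\<close>.\<close>
    fix \<eta> :: real assume \<eta>: "0 < \<eta>"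
    have "((\<lambda>R. 8 * C * (K * (1 / R\<^sup>2))) \<longlongrightarrow> 8 * C * (K * 0)) at_top"
      by (intro tendsto_intros) (real_asymp)
    then have "\<forall>\<^sub>F R in at_top. 8 * C * (K * (1 / R\<^sup>2)) < \<eta> / 8"
      by (rule order_tendstoD) (use \<eta> in simp)
    moreover have "((\<lambda>R. 8 * C * (1 / R * \<mu>)) \<longlongrightarrow> 8 * C * (0 * \<mu>)) at_top"
      by (intro tendsto_intros) (real_asymp)
    then have "\<forall>\<^sub>F R in at_top. 8 * C * (1 / R * \<mu>) < \<eta> / 8"
      by (rule order_tendstoD) (use \<eta> in simp)
    ultimately have "\<forall>\<^sub>F R::real in at_top. 8 * C * (K * (1 / R\<^sup>2)) < \<eta> / 8 \<and> 8 * C * (1 / R * \<mu>) < \<eta> / 8 \<and> 2 \<le> R"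
      using eventually_ge_at_top[of "2::real"] by eventually_elim auto
    then obtain R :: real where R: "8 * C * (K * (1 / R\<^sup>2)) < \<eta> / 8" "8 * C * (1 / R * \<mu>) < \<eta> / 8" "2 \<le> R"
      using eventually_happens'[OF trivial_limit_at_top_linorder] by blast
    obtain \<psi> where \<psi>: "(\<lambda>n. expect (\<lambda>\<omega>. \<psi> (Z n \<omega>))) \<longlonglongrightarrow> N.expect (\<lambda>\<omega>. \<psi> (\<xi> \<omega>))"
      "\<And>n. \<bar>real_of_ereal (a n) - expect (\<lambda>\<omega>. \<psi> (Z n \<omega>))\<bar> \<le> \<eta> / 8 + 8 * C * expect (\<lambda>\<omega>. \<Phi> R (Z n \<omega>))"
      "\<bar>real_of_ereal b - N.expect (\<lambda>\<omega>. \<psi> (\<xi> \<omega>))\<bar> \<le> \<eta> / 8 + 8 * C * N.expect (\<lambda>\<omega>. \<Phi> R (\<xi> \<omega>))"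
      using approx[OF _ R(3), of "\<eta> / 8"] \<eta> by auto
    have "8 * C * N.expect (\<lambda>\<omega>. \<Phi> R (\<xi> \<omega>)) \<le> 8 * C * (1 / R * \<mu>)"
      using C \<xi>_tail[OF R(3)] by (intro mult_left_mono) auto
    then have b_close: "\<bar>real_of_ereal b - N.expect (\<lambda>\<omega>. \<psi> (\<xi> \<omega>))\<bar> < \<eta> / 4"
      using \<psi>(3) R(2) by linarith
    have "(\<lambda>n. 8 * C * (K * \<tau> n)) \<longlonglongrightarrow> 8 * C * (K * 0)"
      using tail_p unfolding \<tau>_def by (intro tendsto_intros)
    then have "\<forall>\<^sub>F n in sequentially. 8 * C * (K * \<tau> n) < \<eta> / 8"
      by (rule order_tendstoD) (use \<eta> in simp)
    moreover have "\<forall>\<^sub>F n in sequentially. dist (expect (\<lambda>\<omega>. \<psi> (Z n \<omega>))) (N.expect (\<lambda>\<omega>. \<psi> (\<xi> \<omega>))) < \<eta> / 4"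
      using \<psi>(1) by (rule tendstoD) (use \<eta> in simp)
    ultimately show "\<forall>\<^sub>F n in sequentially. dist (real_of_ereal (a n)) (real_of_ereal b) < \<eta>"
      using eventually_gt_at_top[of "0::nat"]
    proof eventually_elim
      case (elim n)
      have "8 * C * expect (\<lambda>\<omega>. \<Phi> R (Z n \<omega>)) \<le> 8 * C * (K * (1 / R\<^sup>2 + \<tau> n))"
        using C Z_tail[OF R(3) elim(3)] by (intro mult_left_mono) auto
      also have "\<dots> = 8 * C * (K * (1 / R\<^sup>2)) + 8 * C * (K * \<tau> n)" by (simp add: distrib_left)
      also have "\<dots> < \<eta> / 4" using R(1) elim(1) by linarith
      finally have "\<bar>real_of_ereal (a n) - expect (\<lambda>\<omega>. \<psi> (Z n \<omega>))\<bar> < \<eta> / 8 + \<eta> / 4"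
        using \<psi>(2)[of n] by linarith
      then show ?case using elim(2) b_close \<eta> unfolding dist_real_def by linarith
    qed
  qed
  then have "(\<lambda>n. ereal (real_of_ereal (a n))) \<longlonglongrightarrow> ereal (real_of_ereal b)" by (simp add: lim_ereal)
  then have "a \<longlonglongrightarrow> b" using fin_a fin_b by (simp add: ereal_real')
  then show ?thesis by (simp add: a_def[abs_def] b_def Z_def)
qed

end

theorem theorem3p5:
  fixes M :: "'a measure" and H :: "('a \<Rightarrow> real) set" and E :: "('a \<Rightarrow> real) \<Rightarrow> ereal"
    and M' :: "'b measure" and H' :: "('b \<Rightarrow> real) set" and E' :: "('b \<Rightarrow> real) \<Rightarrow> ereal"
    and X :: "nat \<Rightarrow> 'a \<Rightarrow> real" and S :: "nat \<Rightarrow> 'a \<Rightarrow> real" and \<xi> :: "'b \<Rightarrow> real"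
    and vlow vup :: real
  assumes "sublinear_expectation_space M H E"
    and "iid_sequence H E X"
    and "E (X 1) = 0" and "E (\<lambda>\<omega>. - X 1 \<omega>) = 0"
    and "((\<lambda>c::real. E (\<lambda>\<omega>. max ((X 1 \<omega>)\<^sup>2 - c) 0)) \<longlongrightarrow> 0) at_top"
    and S: "\<And>n \<omega>. S n \<omega> = (\<Sum>k=1..n. X k \<omega>)"
    and "ereal vup = E (\<lambda>\<omega>. (X 1 \<omega>)\<^sup>2)"
    and "ereal vlow = conj_expectation E (\<lambda>\<omega>. (X 1 \<omega>)\<^sup>2)"
    and "sublinear_expectation_space M' H' E'"
    and "G_normal H' E' \<xi> vlow vup"
    and xi_moments: "\<And>k::nat. E' (\<lambda>\<omega>. \<bar>\<xi> \<omega>\<bar> ^ k) < \<infinity>"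
  shows
    "(\<forall>\<phi> :: real \<Rightarrow> real. continuous_on UNIV \<phi> \<and> (\<exists>C. \<forall>x. \<bar>\<phi> x\<bar> \<le> C * (1 + x\<^sup>2)) \<longrightarrow>
        (\<lambda>n. ext_expectation M H E (\<lambda>\<omega>. \<phi> (S n \<omega> / sqrt (real n))))
          \<longlonglongrightarrow> ext_expectation M' H' E' (\<lambda>\<omega>. \<phi> (\<xi> \<omega>))) \<and>
     (\<forall>p::real. 2 < p \<and> E (\<lambda>\<omega>. \<bar>X 1 \<omega>\<bar> powr p) < \<infinity> \<longrightarrow>
       (\<forall>\<phi> :: real \<Rightarrow> real. continuous_on UNIV \<phi> \<and> (\<exists>C. \<forall>x. \<bar>\<phi> x\<bar> \<le> C * (1 + \<bar>x\<bar> powr p)) \<longrightarrow>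
        (\<lambda>n. ext_expectation M H E (\<lambda>\<omega>. \<phi> (S n \<omega> / sqrt (real n))))
          \<longlonglongrightarrow> ext_expectation M' H' E' (\<lambda>\<omega>. \<phi> (\<xi> \<omega>))))"
proof -
  have S_eq: "S n \<omega> / sqrt (real n) = 1 / sqrt (real n) * (\<Sum>i<n. X (Suc i) \<omega>)" for n \<omega>
    by (simp add: S sum.atLeast1_atMost_eq)
  \<comment> \<open>Both claims are instances for a real exponent \<open>p \<ge> 2\<close>. The
    first one is \<open>p = 2\<close>, where the moment condition is finiteness of the upper
    variance.\<close>
  have main: "(\<lambda>n. ext_expectation M H E (\<lambda>\<omega>. \<phi> (S n \<omega> / sqrt (real n))))
          \<longlonglongrightarrow> ext_expectation M' H' E' (\<lambda>\<omega>. \<phi> (\<xi> \<omega>))"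
    if p: "2 \<le> p" "E (\<lambda>\<omega>. \<bar>X 1 \<omega>\<bar> powr p) < \<infinity>"
      and \<phi>: "continuous_on UNIV \<phi>" "\<And>x. \<bar>\<phi> x\<bar> \<le> C * (1 + \<bar>x\<bar> powr p)"
    for p C :: real and \<phi> :: "real \<Rightarrow> real"
  proof -
    interpret centered_iid M H E X p
      using assms p by (simp add: centered_iid_def centered_iid_axioms_def)
    have var: "upper_var = vup" "lower_var = vlow"
    proof -
      have "ereal vup = ereal upper_var"
        using E_X[OF D_square, of 1] assms(7) by (simp add: upper_var_def)
      moreover have "ereal vlow = ereal lower_var"
        using E_X[OF poly_lipschitz_minus[OF D_square], of 1] assms(8)
        by (simp add: lower_var_def conj_expectation_def)
      ultimately show "upper_var = vup" "lower_var = vlow" by auto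
    qed
    have tail: "((\<lambda>c. step_expect (\<lambda>h. max (h\<^sup>2 - c) 0)) \<longlongrightarrow> 0) at_top"
    proof -
      have "((\<lambda>c. ereal (step_expect (\<lambda>h. max (h\<^sup>2 - c) 0))) \<longlongrightarrow> ereal 0) at_top"
        using assms(5) E_X[OF D_square_tail, of 1] by (simp add: zero_ereal_def)
      then show ?thesis by (simp add: lim_ereal)
    qed
    have "(\<lambda>n. real n * step_expect (\<lambda>h. max (\<bar>1 / sqrt (real n) * h\<bar> powr p - 1 / 2) 0)) \<longlonglongrightarrow> 0"
    \<comment> \<open>For \<open>p = 2\<close> and \<open>n > 0\<close> the expression is the
      truncated second moment at level \<open>n / 2\<close>. For \<open>p > 2\<close> it is at most
      \<open>m * n powr (1 - p / 2)\<close> when \<open>n > 0\<close>.\<close>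
    proof (cases "p = 2")
      case True
      have "(\<lambda>n. step_expect (\<lambda>h. max (h\<^sup>2 - real n * (1 / 2)) 0)) \<longlonglongrightarrow> 0"
        by (rule filterlim_compose[OF tail]) real_asymp
      moreover have "\<forall>\<^sub>F n in sequentially. step_expect (\<lambda>h. max (h\<^sup>2 - real n * (1 / 2)) 0)
          = real n * step_expect (\<lambda>h. max (\<bar>1 / sqrt (real n) * h\<bar> powr p - 1 / 2) 0)"
        using eventually_gt_at_top[of "0::nat"]
      proof eventually_elim
        case (elim n)
        have eq: "(\<lambda>h. max (\<bar>1 / sqrt (real n) * h\<bar> powr p - 1 / 2) 0)
            = (\<lambda>h. (1 / real n) * max (h\<^sup>2 - real n * (1 / 2)) 0)"
          using scaled_square_tail[OF elim, of _ "1 / 2"] by (simp add: True powr_numeral)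
        have "step_expect (\<lambda>h. (1 / real n) * max (h\<^sup>2 - real n * (1 / 2)) 0)
            = 1 / real n * step_expect (\<lambda>h. max (h\<^sup>2 - real n * (1 / 2)) 0)"
          by (rule step_expect_cmult[OF D_square_tail]) simp
        then show ?case unfolding eq using elim by simp
      qed
      ultimately show ?thesis by (rule Lim_transform_eventually)
    next
      case False
      define m where "m = step_expect (\<lambda>h. \<bar>h\<bar> powr p)"
      have D: "(\<lambda>h. \<bar>h\<bar> powr p) \<in> D" using p_simps by (intro D_abs_powr) auto
      show ?thesis
      proof (rule tendsto_sandwich)
        have Dt: "(\<lambda>h. max (\<bar>a * h\<bar> powr p - 1 / 2) 0) \<in> D" for a
        proof -
          have "(\<lambda>h. \<bar>0 + a * h\<bar> powr p) \<in> D" by (rule D_affine[OF D])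
          then show ?thesis by (intro poly_lipschitz_max_const poly_lipschitz_diff poly_lipschitz_const) simp
        qed
        show "\<forall>\<^sub>F n in sequentially. 0 \<le> real n * step_expect (\<lambda>h. max (\<bar>1 / sqrt (real n) * h\<bar> powr p - 1 / 2) 0)"
        proof (intro always_eventually allI mult_nonneg_nonneg)
          show "0 \<le> step_expect (\<lambda>h. max (\<bar>1 / sqrt (real n) * h\<bar> powr p - 1 / 2) 0)" for n
            by (rule order_trans[OF _ step_expect_mono[OF poly_lipschitz_const[of 0] Dt]]) auto
        qed simp
        show "\<forall>\<^sub>F n in sequentially. real n * step_expect (\<lambda>h. max (\<bar>1 / sqrt (real n) * h\<bar> powr p - 1 / 2) 0)
            \<le> real n * (1 / sqrt (real n) powr p * m)"
        proof (intro always_eventually allI mult_left_mono)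
          fix n
          have "step_expect (\<lambda>h. max (\<bar>1 / sqrt (real n) * h\<bar> powr p - 1 / 2) 0)
              \<le> step_expect (\<lambda>h. 1 / sqrt (real n) powr p * \<bar>h\<bar> powr p)"
            by (intro step_expect_mono Dt poly_lipschitz_cmult D) (auto simp: powr_divide)
          also have "\<dots> = 1 / sqrt (real n) powr p * m" unfolding m_def by (rule step_expect_cmult[OF D]) simp
          finally show "step_expect (\<lambda>h. max (\<bar>1 / sqrt (real n) * h\<bar> powr p - 1 / 2) 0) \<le> 1 / sqrt (real n) powr p * m" .
        qed simp
        have "(\<lambda>n. real n * (1 / sqrt (real n) powr p)) \<longlonglongrightarrow> 0"
          using False p(1) by real_asymp
        from tendsto_mult_left_zero[OF this, of m]
        show "(\<lambda>n. real n * (1 / sqrt (real n) powr p * m)) \<longlonglongrightarrow> 0" by (simp only: mult.assoc)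
      qed simp
    qed
    from clt_power_growth[OF tail this assms(9) _ xi_moments \<phi>] assms(10)
    show ?thesis unfolding S_eq var by blast
  qed
  have "E (\<lambda>\<omega>. \<bar>X 1 \<omega>\<bar> powr 2) = ereal vup" using assms(7) by (simp add: powr_numeral)
  then have second: "E (\<lambda>\<omega>. \<bar>X 1 \<omega>\<bar> powr 2) < \<infinity>" by simp
  show ?thesis
  proof (intro conjI allI impI; elim conjE exE)
    fix \<phi> :: "real \<Rightarrow> real" and C assume "continuous_on UNIV \<phi>" "\<forall>x. \<bar>\<phi> x\<bar> \<le> C * (1 + x\<^sup>2)"
    then show "(\<lambda>n. ext_expectation M H E (\<lambda>\<omega>. \<phi> (S n \<omega> / sqrt (real n))))
        \<longlonglongrightarrow> ext_expectation M' H' E' (\<lambda>\<omega>. \<phi> (\<xi> \<omega>))"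
      using second by (intro main[of 2 \<phi> C]) (auto simp: powr_numeral)
  next
    fix p :: real and \<phi> :: "real \<Rightarrow> real" and C
    assume "2 < p" "E (\<lambda>\<omega>. \<bar>X 1 \<omega>\<bar> powr p) < \<infinity>" "continuous_on UNIV \<phi>" "\<forall>x. \<bar>\<phi> x\<bar> \<le> C * (1 + \<bar>x\<bar> powr p)"
    then show "(\<lambda>n. ext_expectation M H E (\<lambda>\<omega>. \<phi> (S n \<omega> / sqrt (real n))))
        \<longlonglongrightarrow> ext_expectation M' H' E' (\<lambda>\<omega>. \<phi> (\<xi> \<omega>))"
      by (intro main[of p \<phi> C]) auto
  qed
qed

end
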